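(* Let $\Lambda\in D^+_{p,q|n}$. Then the simple $\mathfrak{gl}_{p+q|n}$-module $L(\Lambda)$ is unitary if and only if its graded dual $L^*(\Lambda)$ is dual-unitary and $L^*(\Lambda)\cong L^-(-\Lambda)$.
   Context: Fix positive integers $p,q,n$ and put $m=p+q$. An index $a\in\{1,\dots,m+n\}$ has parity $[a]=\bar 0$ if $a\le m$ and $[a]=\bar 1$ if $a>m$. $\mathfrak{gl}_{p+q|n}=\mathfrak{gl}_{m|n}$ is the complex general linear Lie superalgebra with basis the matrix units $E_{ab}$ of parity $[a]+[b]$ and bracket $[E_{ab},E_{cd}]=\delta_{b,c}E_{ad}-(-1)^{([a]+[b])([c]+[d])}\delta_{d,a}E_{cb}$. The Cartan subalgebra is spanned by the $E_{aa}$; $\{\epsilon_a\}$ is the basis of its dual with $\epsilon_a(E_{bb})=\delta_{a,b}$, $\delta_\mu:=\epsilon_{m+\mu}$, and $(\lambda_1,\dots,\lambda_m,\omega_1,\dots,\omega_n)$ denotes the weight $\sum_i\lambda_i\epsilon_i+\sum_\mu\omega_\mu\delta_\mu$. $D^+_{p,q|n}$ is the set of such weights with all components real, $\lambda_i-\lambda_{i+1}\in\mathbb{Z}_{\ge0}$ for $i\in\{1,\dots,p-1\}\cup\{p+1,\dots,m-1\}$, and $\omega_\mu-\omega_{\mu+1}\in\mathbb{Z}_{\ge0}$ for $\mu\in\{1,\dots,n-1\}$. $\mathfrak{gl}_{p+q|n}=\mathfrak{k}_-\oplus\mathfrak{k}\oplus\mathfrak{k}_+$, where $\mathfrak{k}\cong\mathfrak{gl}_p\oplus\mathfrak{gl}_{q|n}$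 is spanned by the $E_{ab}$ with $a,b\le p$ or $a,b>p$; $\mathfrak{k}_+$ is spanned by the $E_{ia}$ and $\mathfrak{k}_-$ by the $E_{ai}$ with $1\le i\le p<a\le m+n$. $L_0(\Lambda)$ is the simple $\mathfrak{k}$-module of highest weight $\Lambda$ (highest weights are with respect to the $E_{ab}$, $a\le b$), with $\mathfrak{k}_+$ acting by zero; $V(\Lambda)=\mathrm{U}(\mathfrak{gl}_{p+q|n})\otimes_{\mathrm{U}(\mathfrak{k}\oplus\mathfrak{k}_+)}L_0(\Lambda)\cong \mathrm{U}(\mathfrak{k}_-)\otimes L_0(\Lambda)$; $L(\Lambda)$ is its unique simple quotient. Giving each $E_{ai}\in\mathfrak{k}_-$ degree $1$ and $L_0(\Lambda)$ degree $0$, $L(\Lambda)=\bigoplus_{k\ge0}L_k(\Lambda)$ is $\mathbb{Z}_{\ge0}$-graded with finite-dimensional components, and $L^*(\Lambda):=\bigoplus_{k\ge0}L_k(\Lambda)^*$ is the graded dual with module structure $(Xf)(v)=-(-1)^{[X][f]}f(Xv)$. $L^-(\Lambda')$ denotes the simple module generated by a nonzero vector of weight $\Lambda'$ annihilated by all $E_{ab}$ with $a>b$ (simple lowest-weight module of lowest weight $\Lambda'$). The star-operation $\star$ is the even anti-linear map with $(E_{ab})^\star=E_{ba}$ if $a,b\le p$ or $a,b>p$, and $(E_{ab})^\star=-E_{ba}$ otherwise; the dual star-operation is the even anti-linear map $\ast$ with $(E_{ab})^{\ast}=(-1)^{[a]+[b]}(E_{ab})^\star$. A module $V$ is unitary (respectively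 dual-unitary) if it carries a positive-definite Hermitian form (anti-linear in the first argument) with $\langle E_{ab}v,w\rangle=\langle v,(E_{ab})^\star w\rangle$ (respectively $\langle E_{ab}v,w\rangle=\langle v,(E_{ab})^{\ast}w\rangle$) for all $v,w\in V$ and all $a,b$. *)

theory Defs
  imports Complex_Main "HOL-Library.Z2" "HOL-Library.Poly_Mapping" "HOL-Library.Function_Algebras"
begin

section \<open>Index sets and signs\<close>

definition par :: "nat \<Rightarrow> nat \<Rightarrow> bit" where
  "par m a = (if a \<le> m then 0 else 1)"

abbreviation epar :: "nat \<Rightarrow> nat \<Rightarrow> nat \<Rightarrow> bit" where
  "epar m a b \<equiv> par m a + par m b"

definition koszul :: "bit \<Rightarrow> bit \<Rightarrow> complex" where
  "koszul s t = (if s = 1 \<and> t = 1 then -1 else 1)"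

text \<open>Lie sub-superalgebras of gl(m|n) that are spanned by matrix units are represented by the sets
  of pairs (a,b) for which they contain the matrix unit with indices a, b.  Here N = m + n.\<close>

definition gl_idx :: "nat \<Rightarrow> (nat \<times> nat) set" where
  "gl_idx N = {1..N} \<times> {1..N}"

definition k_idx :: "nat \<Rightarrow> nat \<Rightarrow> (nat \<times> nat) set" where
  "k_idx p N = {1..p} \<times> {1..p} \<union> {p+1..N} \<times> {p+1..N}"

definition kplus_idx :: "nat \<Rightarrow> nat \<Rightarrow> (nat \<times> nat) set" where
  "kplus_idx p N = {1..p} \<times> {p+1..N}"

definition kminus_idx :: "nat \<Rightarrow> nat \<Rightarrow> (nat \<times> nat) set" where
  "kminus_idx p N = {p+1..N} \<times> {1..p}"

text \<open>A weight is given by its components \<open>\<Lambda> 1, \<dots>, \<Lambda> (m+n)\<close>, that is, by its values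
  on the diagonal matrix units; \<open>\<omega>\<^sub>\<mu>\<close> is \<open>\<Lambda> (m+\<mu>)\<close>.\<close>

definition Dplus :: "nat \<Rightarrow> nat \<Rightarrow> nat \<Rightarrow> (nat \<Rightarrow> complex) set" where
  "Dplus p q n = {\<Lambda>. (\<forall>a\<in>{1..p+q+n}. \<Lambda> a \<in> \<real>)
      \<and> (\<forall>i\<in>{1..<p} \<union> {p+1..<p+q}. \<Lambda> i - \<Lambda> (i+1) \<in> \<nat>)
      \<and> (\<forall>\<mu>\<in>{1..<n}. \<Lambda> (p+q+\<mu>) - \<Lambda> (p+q+\<mu>+1) \<in> \<nat>)}"

section \<open>Supermodules\<close>

text \<open>A complex superspace is a pair of subspaces \<open>homog M 0\<close>, \<open>homog M 1\<close> of an ambient complex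
  vector space with scalar multiplication \<open>scl M\<close>; the module itself is their direct sum
  \<open>carr M\<close>.  \<open>act M a b\<close> is the action of the matrix unit with indices a, b and only matters on
  \<open>carr M\<close>.\<close>

record 'v supermod =
  scl :: "complex \<Rightarrow> 'v \<Rightarrow> 'v"
  homog :: "bit \<Rightarrow> 'v set"
  act :: "nat \<Rightarrow> nat \<Rightarrow> 'v \<Rightarrow> 'v"

definition carr :: "'v::ab_group_add supermod \<Rightarrow> 'v set" where
  "carr M = {u + w | u w. u \<in> homog M 0 \<and> w \<in> homog M 1}"

definition linear_on_carr ::
  "'v::ab_group_add supermod \<Rightarrow> (complex \<Rightarrow> 'w \<Rightarrow> 'w) \<Rightarrow> ('v \<Rightarrow> 'w::ab_group_add) \<Rightarrow> bool" where
  "linear_on_carr M s f \<longleftrightarrow>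
     (\<forall>v\<in>carr M. \<forall>w\<in>carr M. f (v + w) = f v + f w) \<and>
     (\<forall>c. \<forall>v\<in>carr M. f (scl M c v) = s c (f v))"

definition supermodule ::
  "nat \<Rightarrow> (nat \<times> nat) set \<Rightarrow> 'v::ab_group_add supermod \<Rightarrow> bool" where
  "supermodule m S M \<longleftrightarrow>
     vector_space (scl M) \<and>
     (\<forall>s. module.subspace (scl M) (homog M s)) \<and>
     homog M 0 \<inter> homog M 1 = {0} \<and>
     (\<forall>(a,b)\<in>S. linear_on_carr M (scl M) (act M a b)) \<and>
     (\<forall>(a,b)\<in>S. \<forall>s. \<forall>v\<in>homog M s. act M a b v \<in> homog M (epar m a b + s)) \<and>
     (\<forall>(a,b)\<in>S. \<forall>(c,d)\<in>S. \<forall>v\<in>carr M.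
        act M a b (act M c d v) - scl M (koszul (epar m a b) (epar m c d)) (act M c d (act M a b v))
        = (if b = c then act M a d v else 0)
          - (if d = a then scl M (koszul (epar m a b) (epar m c d)) (act M c b v) else 0))"

text \<open>As usual for superalgebras, submodules are graded by parity.\<close>

definition submod :: "(nat \<times> nat) set \<Rightarrow> 'v::ab_group_add supermod \<Rightarrow> 'v set \<Rightarrow> bool" where
  "submod S M W \<longleftrightarrow>
     module.subspace (scl M) W \<and>
     (\<forall>w\<in>W. \<exists>u\<in>W \<inter> homog M 0. \<exists>v\<in>W \<inter> homog M 1. w = u + v) \<and>
     (\<forall>(a,b)\<in>S. \<forall>w\<in>W. act M a b w \<in> W)"

definition simple_mod ::
  "nat \<Rightarrow> (nat \<times> nat) set \<Rightarrow> 'v::ab_group_add supermod \<Rightarrow> bool" where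
  "simple_mod m S M \<longleftrightarrow> supermodule m S M \<and> carr M \<noteq> {0} \<and>
     (\<forall>W. submod S M W \<longrightarrow> W = {0} \<or> W = carr M)"

definition even_hom :: "(nat \<times> nat) set \<Rightarrow> 'v::ab_group_add supermod \<Rightarrow> 'w::ab_group_add supermod
    \<Rightarrow> ('v \<Rightarrow> 'w) \<Rightarrow> bool" where
  "even_hom S M M' f \<longleftrightarrow>
     linear_on_carr M (scl M') f \<and>
     (\<forall>s. f ` homog M s \<subseteq> homog M' s) \<and>
     (\<forall>(a,b)\<in>S. \<forall>v\<in>carr M. f (act M a b v) = act M' a b (f v))"

definition isomorphic_mod ::
  "(nat \<times> nat) set \<Rightarrow> 'v::ab_group_add supermod \<Rightarrow> 'w::ab_group_add supermod \<Rightarrow> bool" where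
  "isomorphic_mod S M M' \<longleftrightarrow> (\<exists>f. even_hom S M M' f \<and> bij_betw f (carr M) (carr M'))"

section \<open>Simple highest and lowest weight modules\<close>

text \<open>Parity is normalised by taking highest and lowest weight vectors even.\<close>

definition even_weight_vector ::
  "(nat \<times> nat) set \<Rightarrow> 'v::ab_group_add supermod \<Rightarrow> (nat \<Rightarrow> complex) \<Rightarrow> 'v \<Rightarrow> bool" where
  "even_weight_vector S M \<Lambda> v \<longleftrightarrow> v \<in> homog M 0 \<and> v \<noteq> 0 \<and>
     (\<forall>a. (a,a) \<in> S \<longrightarrow> act M a a v = scl M (\<Lambda> a) v)"

fun act_word :: "'v supermod \<Rightarrow> (nat \<times> nat) list \<Rightarrow> 'v \<Rightarrow> 'v" where
  "act_word M [] v = v"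
| "act_word M ((a,b) # xs) v = act M a b (act_word M xs v)"

definition generates ::
  "(nat \<times> nat) set \<Rightarrow> 'v::ab_group_add supermod \<Rightarrow> 'v \<Rightarrow> bool" where
  "generates S M v \<longleftrightarrow> module.span (scl M) {act_word M xs v | xs. xs \<in> lists S} = carr M"

definition simple_highest_weight_mod ::
  "nat \<Rightarrow> (nat \<times> nat) set \<Rightarrow> (nat \<Rightarrow> complex) \<Rightarrow> 'v::ab_group_add supermod \<Rightarrow> bool" where
  "simple_highest_weight_mod m S \<Lambda> M \<longleftrightarrow> simple_mod m S M \<and>
     (\<exists>v. even_weight_vector S M \<Lambda> v \<and> generates S M v \<and>
          (\<forall>(a,b)\<in>S. a < b \<longrightarrow> act M a b v = 0))"

definition simple_lowest_weight_mod ::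
  "nat \<Rightarrow> (nat \<times> nat) set \<Rightarrow> (nat \<Rightarrow> complex) \<Rightarrow> 'v::ab_group_add supermod \<Rightarrow> bool" where
  "simple_lowest_weight_mod m S \<Lambda> M \<longleftrightarrow> simple_mod m S M \<and>
     (\<exists>v. even_weight_vector S M \<Lambda> v \<and> generates S M v \<and>
          (\<forall>(a,b)\<in>S. a > b \<longrightarrow> act M a b v = 0))"

section \<open>Induced modules\<close>

definition extend_by_zero :: "(nat \<times> nat) set \<Rightarrow> 'v::zero supermod \<Rightarrow> 'v supermod" where
  "extend_by_zero P M = M\<lparr>act := \<lambda>a b v. if (a,b) \<in> P then 0 else act M a b v\<rparr>"

text \<open>Let \<open>\<ss> \<supseteq> \<tt>\<close> be the Lie superalgebras with index sets \<open>S \<supseteq> T\<close>, and M a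
  \<open>\<tt>\<close>-module.  A pair of a word \<open>X\<^sub>1 \<dots> X\<^sub>r\<close> in matrix units of \<open>\<ss>\<close> and a vector \<open>v\<close> of M stands for
  the tensor \<open>X\<^sub>1 \<dots> X\<^sub>r \<otimes> v\<close>.  Then \<open>U(\<ss>) \<otimes>\<^bsub>U(\<tt>)\<^esub> M\<close> is the space of finite formal
  combinations of such pairs modulo \<open>tensor_null m S T M\<close>: the relations are linearity in the second
  factor, the defining relations \<open>XY - (-1)\<^bsup>[X][Y]\<^esup> YX = [X,Y]\<close> of \<open>U(\<ss>)\<close>, and
  \<open>uX \<otimes> v = u \<otimes> Xv\<close> for \<open>X \<in> \<tt>\<close>.\<close>

type_synonym 'v formal_tensor = "((nat \<times> nat) list \<times> 'v) \<Rightarrow>\<^sub>0 complex"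

abbreviation tens :: "(nat \<times> nat) list \<Rightarrow> 'v \<Rightarrow> complex \<Rightarrow> 'v formal_tensor" where
  "tens xs v c \<equiv> Poly_Mapping.single (xs, v) c"

definition formal_tensors ::
  "(nat \<times> nat) set \<Rightarrow> 'v::ab_group_add supermod \<Rightarrow> 'v formal_tensor set" where
  "formal_tensors S M = {f. Poly_Mapping.keys f \<subseteq> lists S \<times> carr M}"

definition tensor_null :: "nat \<Rightarrow> (nat \<times> nat) set \<Rightarrow> (nat \<times> nat) set \<Rightarrow> 'v::ab_group_add supermod
    \<Rightarrow> 'v formal_tensor set" where
  "tensor_null m S T M = module.span (\<lambda>c. Poly_Mapping.map ((*) c))
    ({tens xs (v + w) 1 - tens xs v 1 - tens xs w 1 | xs v w.
        xs \<in> lists S \<and> v \<in> carr M \<and> w \<in> carr M} \<union>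
     {tens xs (scl M c v) 1 - tens xs v c | xs c v. xs \<in> lists S \<and> v \<in> carr M} \<union>
     {tens (xs @ [(a,b),(c,d)] @ ys) v 1
        - tens (xs @ [(c,d),(a,b)] @ ys) v (koszul (epar m a b) (epar m c d))
        - ((if b = c then tens (xs @ [(a,d)] @ ys) v 1 else 0)
           - (if d = a then tens (xs @ [(c,b)] @ ys) v (koszul (epar m a b) (epar m c d)) else 0))
       | xs ys a b c d v. xs \<in> lists S \<and> ys \<in> lists S \<and> (a,b) \<in> S \<and> (c,d) \<in> S \<and> v \<in> carr M} \<union>
     {tens (xs @ [(a,b)]) v 1 - tens xs (act M a b v) 1 | xs a b v.
        xs \<in> lists S \<and> (a,b) \<in> T \<and> v \<in> carr M})"

definition tensor_eval ::
  "'w::ab_group_add supermod \<Rightarrow> ('v \<Rightarrow> 'w) \<Rightarrow> 'v formal_tensor \<Rightarrow> 'w" where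
  "tensor_eval V \<iota> f =
     (\<Sum>(xs,v)\<in>Poly_Mapping.keys f. scl V (Poly_Mapping.lookup f (xs,v)) (act_word V xs (\<iota> v)))"

text \<open>\<open>is_induced m S T M V \<iota>\<close>: the map \<open>u \<otimes> v \<mapsto> u \<cdot> \<iota> v\<close> is an isomorphism from
  \<open>U(\<ss>) \<otimes>\<^bsub>U(\<tt>)\<^esub> M\<close> onto V; thus \<open>\<iota>\<close> is \<open>v \<mapsto> 1 \<otimes> v\<close>.\<close>

definition is_induced :: "nat \<Rightarrow> (nat \<times> nat) set \<Rightarrow> (nat \<times> nat) set \<Rightarrow> 'v::ab_group_add supermod
    \<Rightarrow> 'w::ab_group_add supermod \<Rightarrow> ('v \<Rightarrow> 'w) \<Rightarrow> bool" where
  "is_induced m S T M V \<iota> \<longleftrightarrow>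
     supermodule m T M \<and> supermodule m S V \<and> even_hom T M V \<iota> \<and>
     tensor_eval V \<iota> ` formal_tensors S M = carr V \<and>
     {f \<in> formal_tensors S M. tensor_eval V \<iota> f = 0} = tensor_null m S T M"

text \<open>\<open>V\<close> is \<open>V(\<Lambda>)\<close>, formed from a simple \<open>\<kk>\<close>-module \<open>M\<close> of highest weight \<open>\<Lambda>\<close>, and
  \<open>\<pi>\<close> maps it onto its simple quotient \<open>L = L(\<Lambda>)\<close>.\<close>

definition is_simple_quotient_of_induced ::
  "nat \<Rightarrow> nat \<Rightarrow> nat \<Rightarrow> (nat \<Rightarrow> complex) \<Rightarrow> 'u::ab_group_add supermod
    \<Rightarrow> 'v::ab_group_add supermod \<Rightarrow> ('u \<Rightarrow> 'v) \<Rightarrow> 'w::ab_group_add supermod \<Rightarrow> ('v \<Rightarrow> 'w) \<Rightarrow> bool" where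
  "is_simple_quotient_of_induced p q n \<Lambda> M V \<iota> L \<pi> \<longleftrightarrow>
     (let m = p + q; N = p + q + n in
        simple_highest_weight_mod m (k_idx p N) \<Lambda> M \<and>
        is_induced m (gl_idx N) (k_idx p N \<union> kplus_idx p N)
          (extend_by_zero (kplus_idx p N) M) V \<iota> \<and>
        simple_mod m (gl_idx N) L \<and> even_hom (gl_idx N) V L \<pi> \<and> \<pi> ` carr V = carr L)"

section \<open>Graded dual\<close>

text \<open>\<open>degree_part p N L B k\<close> is the degree k component of L, where \<open>B\<close> is the degree 0
  component.\<close>

definition degree_part ::
  "nat \<Rightarrow> nat \<Rightarrow> 'v::ab_group_add supermod \<Rightarrow> 'v set \<Rightarrow> nat \<Rightarrow> 'v set" where
  "degree_part p N L B k = module.span (scl L)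
     {act_word L xs v | xs v. xs \<in> lists (kminus_idx p N) \<and> length xs = k \<and> v \<in> B}"

definition parity_comp :: "'v::ab_group_add supermod \<Rightarrow> bit \<Rightarrow> 'v \<Rightarrow> 'v" where
  "parity_comp M s v = (THE u. u \<in> homog M s \<and> v - u \<in> homog M (s + 1))"

text \<open>Functionals on \<open>carr L\<close> are extended by 0 to the ambient type.  The direct sum of the duals of
  the degree components consists of the functionals that vanish in almost all degrees.  In the
  action, \<open>f\<close> is split into its even and odd parts, which are \<open>f \<circ> parity_comp L 0\<close> and
  \<open>f \<circ> parity_comp L 1\<close>.\<close>

definition graded_dual :: "nat \<Rightarrow> nat \<Rightarrow> nat \<Rightarrow> 'v::ab_group_add supermod \<Rightarrow> 'v set
    \<Rightarrow> ('v \<Rightarrow> complex) supermod" where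
  "graded_dual p m N L B = \<lparr>
     scl = (\<lambda>c f v. c * f v),
     homog = (\<lambda>s. {f. linear_on_carr L (*) f \<and> (\<forall>v. v \<notin> carr L \<longrightarrow> f v = 0) \<and>
                      (\<exists>K. \<forall>k\<ge>K. \<forall>v\<in>degree_part p N L B k. f v = 0) \<and>
                      (\<forall>v\<in>homog L (s + 1). f v = 0)}),
     act = (\<lambda>a b f v. if v \<in> carr L
              then - (\<Sum>s\<in>{0,1}. koszul (epar m a b) s * f (parity_comp L s (act L a b v)))
              else 0)\<rparr>"

section \<open>Unitarity\<close>

definition positive_hermitian_form ::
  "'v::ab_group_add supermod \<Rightarrow> ('v \<Rightarrow> 'v \<Rightarrow> complex) \<Rightarrow> bool" where
  "positive_hermitian_form M h \<longleftrightarrow>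
     (\<forall>v\<in>carr M. linear_on_carr M (*) (h v)) \<and>
     (\<forall>v\<in>carr M. \<forall>w\<in>carr M. h w v = cnj (h v w)) \<and>
     (\<forall>v\<in>carr M. v \<noteq> 0 \<longrightarrow> Re (h v v) > 0)"

text \<open>The image of the matrix unit with indices a, b under either star-operation is
  \<open>\<sigma> a b\<close> times the one with indices b, a.\<close>

definition star_sign :: "nat \<Rightarrow> nat \<Rightarrow> nat \<Rightarrow> complex" where
  "star_sign p a b = (if (a \<le> p \<and> b \<le> p) \<or> (a > p \<and> b > p) then 1 else -1)"

definition dual_star_sign :: "nat \<Rightarrow> nat \<Rightarrow> nat \<Rightarrow> nat \<Rightarrow> complex" where
  "dual_star_sign p m a b = (if epar m a b = 1 then -1 else 1) * star_sign p a b"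

definition unitary_wrt ::
  "(nat \<Rightarrow> nat \<Rightarrow> complex) \<Rightarrow> nat \<Rightarrow> 'v::ab_group_add supermod \<Rightarrow> bool" where
  "unitary_wrt \<sigma> N M \<longleftrightarrow> (\<exists>h. positive_hermitian_form M h \<and>
     (\<forall>a\<in>{1..N}. \<forall>b\<in>{1..N}. \<forall>v\<in>carr M. \<forall>w\<in>carr M.
        h (act M a b v) w = h v (scl M (\<sigma> a b) (act M b a w))))"

definition unitary :: "nat \<Rightarrow> nat \<Rightarrow> 'v::ab_group_add supermod \<Rightarrow> bool" where
  "unitary p N M \<longleftrightarrow> unitary_wrt (star_sign p) N M"

definition dual_unitary :: "nat \<Rightarrow> nat \<Rightarrow> nat \<Rightarrow> 'v::ab_group_add supermod \<Rightarrow> bool" where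
  "dual_unitary p m N M \<longleftrightarrow> unitary_wrt (dual_star_sign p m) N M"

end

theory Submission
  imports Defs "HOL-Library.Product_Plus"
begin

text \<open>
  Let \<open>B\<close> be the image of \<open>L\<^sub>0(\<Lambda>)\<close> in \<open>L = L(\<Lambda>)\<close>, and \<open>v0\<close> its highest weight vector.

  Suppose that \<open>L\<close> carries an invariant form \<open>h\<close>, which by averaging over the parity may be taken
  even.  The Riesz map \<open>v \<mapsto> h v\<close> is an anti-linear injection of \<open>L\<close> into its dual.  It carries
  the matrix unit with indices b, a to plus or minus the one with indices a, b
  (\<open>act_dual_riesz\<close>); the Koszul sign in the action on the dual is what turns the
  star-operation into the dual one.  The graded components of \<open>L\<close> are orthogonal, being eigenspaces
  of a self-adjoint operator (\<open>pieces_orthogonal\<close>), and finite-dimensional, so the Riesz map is onto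
  the graded dual (\<open>riesz_surj\<close>).  It transports the form, the simplicity of \<open>L\<close>, and the highest weight
  vector of weight \<open>\<Lambda>\<close>, which becomes a lowest weight vector of weight \<open>-\<Lambda>\<close>.  A simple lowest weight
  module is determined by its lowest weight (\<open>simple_lowest_weight_mods_isomorphic\<close>), so the graded
  dual is \<open>L\<^sup>-(-\<Lambda>)\<close>.

  The components are finite-dimensional because \<open>B\<close> is, and for \<open>B\<close> this is a consequence of unitarity: the Casimir operator
  of \<open>\<gg>\<ll>\<^sub>p \<oplus> \<gg>\<ll>\<^sub>q \<oplus> \<gg>\<ll>\<^sub>n\<close> acts by a scalar on the even module generated by \<open>v0\<close>, its expectation value
  bounds the square of each component of a weight (\<open>casimir_bounds_weights\<close>), and thus only finitely
  many words in even lowering operators act on \<open>v0\<close> without killing it.  The odd lowering operators of \<open>\<kk>\<close>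
  anticommute and multiply the dimension by a finite factor only (\<open>finite_odd_generation\<close>).

  Conversely, let the graded dual carry an even invariant form \<open>g\<close> and a lowest weight vector \<open>f0\<close>.  The
  vectors \<open>v\<close> for which evaluation at \<open>v\<close> has the form \<open>g \<phi>\<close> form a submodule of \<open>L\<close>.  It contains \<open>v0\<close>:
  evaluation at \<open>v0\<close> and \<open>g f0\<close> both vanish on the images of the raising operators, hence are
  proportional.  By simplicity every \<open>v\<close> is represented by some \<open>\<phi> v\<close>, and \<open>h v w = \<phi> v w\<close> is the
  required form on \<open>L\<close> (\<open>unitary_if_dual_unitary\<close>).

  All decompositions of words in matrix units that occur here (degrees of \<open>L\<close>, odd over even operators, lowering
  words on a highest weight line, raising words on a lowest weight line) are instances of a single statement about
  gradings, \<open>act_word_F_piece\<close>.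
\<close>

section \<open>Supermodules\<close>

(* Sums of parities stay sums instead of being rewritten as exclusive disjunctions. *)
declare add_bit_eq_xor [simp del]

lemma bit_add_self [simp]: "s + s = (0::bit)" "s + (s + t) = (t::bit)"
    "s + (t + (s + (t + u))) = (u::bit)"
  by (cases s; cases t; simp)+

lemma koszul_simps [simp]: "koszul 0 s = 1" "koszul s 0 = 1" "koszul 1 1 = -1"
  by (simp_all add: koszul_def)

lemma koszul_nonzero [simp]: "koszul s t \<noteq> 0"
  by (simp add: koszul_def)

lemma koszul_commute: "koszul s t = koszul t s"
  by (simp add: koszul_def)

lemma koszul_add: "koszul s (t + u) = koszul s t * koszul s u"
  by (cases s; cases t; cases u) simp_all

lemma koszul_add': "koszul (t + u) s = koszul t s * koszul u s"
  by (cases s; cases t; cases u) simp_all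

lemma koszul_square [simp]: "koszul s t * koszul s t = 1" "koszul s t * (koszul s t * c) = c"
  by (simp_all add: koszul_def)

lemma supermoduleI:
  assumes "vector_space (scl M)" "\<And>s. module.subspace (scl M) (homog M s)"
    and "homog M 0 \<inter> homog M 1 = {0}"
    and "\<And>a b. (a,b) \<in> S \<Longrightarrow> linear_on_carr M (scl M) (act M a b)"
    and "\<And>a b s v. (a,b) \<in> S \<Longrightarrow> v \<in> homog M s \<Longrightarrow> act M a b v \<in> homog M (epar m a b + s)"
    and "\<And>a b c d v. (a,b) \<in> S \<Longrightarrow> (c,d) \<in> S \<Longrightarrow> v \<in> carr M \<Longrightarrow>
        act M a b (act M c d v) - scl M (koszul (epar m a b) (epar m c d)) (act M c d (act M a b v))
        = (if b = c then act M a d v else 0)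
          - (if d = a then scl M (koszul (epar m a b) (epar m c d)) (act M c b v) else 0)"
  shows "supermodule m S M"
  unfolding supermodule_def
  by (intro conjI allI; (rule assms)?; clarify; rule assms; assumption)

locale smod =
  fixes m :: nat and S :: "(nat \<times> nat) set" and M :: "'v::ab_group_add supermod"
  assumes supermodule: "supermodule m S M"
begin

sublocale vector_space "scl M"
  using supermodule by (simp add: supermodule_def)

lemma subspace_homog: "subspace (homog M s)"
  using supermodule by (simp add: supermodule_def)

lemma homog_disjoint: "v \<in> homog M s \<Longrightarrow> v \<in> homog M (s + 1) \<Longrightarrow> v = 0"
  using supermodule by (cases s) (auto simp: supermodule_def)

lemma homog_in_carr:
  assumes "v \<in> homog M s"
  shows "v \<in> carr M"
proof (cases "s = 0")
  case True
  then have "v = v + 0" "v \<in> homog M 0" "0 \<in> homog M 1"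
    using assms subspace_0[OF subspace_homog] by auto
  then show ?thesis unfolding carr_def by blast
next
  case False
  then have "v = 0 + v" "0 \<in> homog M 0" "v \<in> homog M 1"
    using assms subspace_0[OF subspace_homog] by auto
  then show ?thesis unfolding carr_def by blast
qed

lemma subspace_carr: "subspace (carr M)"
proof (rule subspaceI)
  show "0 \<in> carr M"
    using homog_in_carr subspace_0[OF subspace_homog] by blast
  show "x + y \<in> carr M" if xy: "x \<in> carr M" "y \<in> carr M" for x y
  proof -
    obtain u w where "x = u + w" "u \<in> homog M 0" "w \<in> homog M 1"
      using xy(1) unfolding carr_def by auto
    moreover obtain u' w' where "y = u' + w'" "u' \<in> homog M 0" "w' \<in> homog M 1"
      using xy(2) unfolding carr_def by auto
    ultimately have "x + y = (u + u') + (w + w')" "u + u' \<in> homog M 0" "w + w' \<in> homog M 1"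
      using subspace_add[OF subspace_homog] by simp_all
    then show ?thesis unfolding carr_def by blast
  qed
  show "scl M c x \<in> carr M" if x: "x \<in> carr M" for c x
  proof -
    obtain u w where "x = u + w" "u \<in> homog M 0" "w \<in> homog M 1"
      using x unfolding carr_def by auto
    then have "scl M c x = scl M c u + scl M c w" "scl M c u \<in> homog M 0" "scl M c w \<in> homog M 1"
      using subspace_scale[OF subspace_homog] by (simp_all add: scale_right_distrib)
    then show ?thesis unfolding carr_def by blast
  qed
qed

lemmas carr_closed = subspace_0[OF subspace_carr] subspace_add[OF subspace_carr]
  subspace_diff[OF subspace_carr] subspace_neg[OF subspace_carr] subspace_scale[OF subspace_carr]

lemma act_homog: "(a,b) \<in> S \<Longrightarrow> v \<in> homog M s \<Longrightarrow> act M a b v \<in> homog M (epar m a b + s)"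
  using supermodule unfolding supermodule_def by blast

lemma act_add: "(a,b) \<in> S \<Longrightarrow> v \<in> carr M \<Longrightarrow> w \<in> carr M
    \<Longrightarrow> act M a b (v + w) = act M a b v + act M a b w"
  using supermodule unfolding supermodule_def linear_on_carr_def by blast

lemma act_scale: "(a,b) \<in> S \<Longrightarrow> v \<in> carr M \<Longrightarrow> act M a b (scl M c v) = scl M c (act M a b v)"
  using supermodule unfolding supermodule_def linear_on_carr_def by blast

lemma act_in_carr: "(a,b) \<in> S \<Longrightarrow> v \<in> carr M \<Longrightarrow> act M a b v \<in> carr M"
proof -
  assume ab: "(a,b) \<in> S" and "v \<in> carr M"
  then obtain u w where "v = u + w" "u \<in> homog M 0" "w \<in> homog M 1"
    by (auto simp: carr_def)
  then show ?thesis
    using ab act_add homog_in_carr act_homog carr_closed by metis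
qed

lemma act_zero: "(a,b) \<in> S \<Longrightarrow> act M a b 0 = 0"
  using act_scale[of a b 0 0] carr_closed by simp

lemma act_neg: "(a,b) \<in> S \<Longrightarrow> v \<in> carr M \<Longrightarrow> act M a b (- v) = - act M a b v"
  using act_scale[of a b v "-1"] by simp

lemma act_diff: "(a,b) \<in> S \<Longrightarrow> v \<in> carr M \<Longrightarrow> w \<in> carr M
    \<Longrightarrow> act M a b (v - w) = act M a b v - act M a b w"
  using act_add[of a b v "-w"] act_neg[of a b w] carr_closed by simp

lemma act_sum: "(a,b) \<in> S \<Longrightarrow> (\<And>i. i \<in> I \<Longrightarrow> f i \<in> carr M)
    \<Longrightarrow> act M a b (sum f I) = (\<Sum>i\<in>I. act M a b (f i))"
proof (induction I rule: infinite_finite_induct)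
  case (insert x F)
  then show ?case
    using act_add[of a b "f x" "sum f F"] subspace_sum[OF subspace_carr, of F f] by simp
qed (simp_all add: act_zero)

lemma act_commute: 
  assumes "(a,b) \<in> S" "(c,d) \<in> S" "v \<in> carr M"
  shows "act M a b (act M c d v) = scl M (koszul (epar m a b) (epar m c d)) (act M c d (act M a b v))
    + ((if b = c then act M a d v else 0)
       - (if d = a then scl M (koszul (epar m a b) (epar m c d)) (act M c b v) else 0))"
proof -
  have relation: "\<forall>(a,b)\<in>S. \<forall>(c,d)\<in>S. \<forall>v\<in>carr M.
        act M a b (act M c d v) - scl M (koszul (epar m a b) (epar m c d)) (act M c d (act M a b v))
        = (if b = c then act M a d v else 0)
          - (if d = a then scl M (koszul (epar m a b) (epar m c d)) (act M c b v) else 0)"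
    using supermodule unfolding supermodule_def by (elim conjE)
  have "act M a b (act M c d v) - scl M (koszul (epar m a b) (epar m c d)) (act M c d (act M a b v))
        = (if b = c then act M a d v else 0)
          - (if d = a then scl M (koszul (epar m a b) (epar m c d)) (act M c b v) else 0)"
    using relation[THEN bspec, OF assms(1), unfolded prod.case, THEN bspec, OF assms(2), unfolded prod.case,
      THEN bspec, OF assms(3)] .
  then show ?thesis
    unfolding diff_eq_eq by (simp only: add.commute)
qed

lemma act_diag_commute:
  assumes "(c,c) \<in> S" "(a,b) \<in> S" "v \<in> carr M"
  shows "act M c c (act M a b v) = act M a b (act M c c v)
    + scl M (of_bool (c = a) - of_bool (c = b)) (act M a b v)"
  using act_commute[OF assms] by (auto simp: algebra_simps)

lemma act_on_span:
  assumes "v \<in> span G" "(a,b) \<in> S" "G \<subseteq> carr M" "subspace W" "\<And>x. x \<in> G \<Longrightarrow> act M a b x \<in> W"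
  shows "act M a b v \<in> W"
proof -
  have "v \<in> carr M \<and> act M a b v \<in> W"
    using assms(1)
  proof (induction rule: span_induct_alt)
    case base
    show ?case using assms(2,4) act_zero carr_closed(1) subspace_0 by simp
  next
    case (step c x y)
    then have "x \<in> carr M" "act M a b x \<in> W" using assms(3,5) by auto
    then show ?case
      using step.IH assms(2) by (simp add: act_add act_scale carr_closed subspace_add[OF assms(4)] subspace_scale[OF assms(4)])
  qed
  then show ?thesis ..
qed

lemma act_word_in_carr: "xs \<in> lists S \<Longrightarrow> v \<in> carr M \<Longrightarrow> act_word M xs v \<in> carr M"
proof (induction rule: lists.induct)
  case (Cons x xs)
  then show ?case by (cases x) (simp add: act_in_carr)
qed simp

lemma act_word_homog: "xs \<in> lists S \<Longrightarrow> v \<in> homog M s \<Longrightarrow> \<exists>t. act_word M xs v \<in> homog M t"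
proof (induction rule: lists.induct)
  case (Cons x xs)
  then show ?case by (cases x) (auto intro: act_homog)
qed auto

lemma act_word_add: "xs \<in> lists S \<Longrightarrow> v \<in> carr M \<Longrightarrow> w \<in> carr M
   \<Longrightarrow> act_word M xs (v + w) = act_word M xs v + act_word M xs w"
proof (induction rule: lists.induct)
  case (Cons x xs)
  then show ?case by (cases x) (simp add: act_add act_word_in_carr)
qed simp

lemma act_word_scale: "xs \<in> lists S \<Longrightarrow> v \<in> carr M \<Longrightarrow> act_word M xs (scl M c v) = scl M c (act_word M xs v)"
proof (induction rule: lists.induct)
  case (Cons x xs)
  then show ?case by (cases x) (simp add: act_scale act_word_in_carr)
qed simp

lemma act_word_zero: "xs \<in> lists S \<Longrightarrow> act_word M xs 0 = 0"
  using act_word_scale[of xs 0 0] carr_closed(1) by simp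

lemma act_word_on_span:
  assumes "v \<in> span G" "xs \<in> lists S" "G \<subseteq> carr M" "subspace W" "\<And>x. x \<in> G \<Longrightarrow> act_word M xs x \<in> W"
  shows "act_word M xs v \<in> W"
proof -
  have "v \<in> carr M \<and> act_word M xs v \<in> W"
    using assms(1)
  proof (induction rule: span_induct_alt)
    case base
    show ?case using assms(2,4) act_word_zero carr_closed(1) subspace_0 by simp
  next
    case (step c x y)
    then have "x \<in> carr M" "act_word M xs x \<in> W" using assms(3,5) by auto
    then show ?case
      using step.IH act_word_add[OF assms(2)] act_word_scale[OF assms(2)]
      by (simp add: carr_closed subspace_add[OF assms(4)] subspace_scale[OF assms(4)])
  qed
  then show ?thesis ..
qed

lemma restrict:
  assumes "S' \<subseteq> S"
  shows "smod m S' M"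
proof -
  have *: "\<forall>x\<in>S'. P x" if "\<forall>x\<in>S. P x" for P
    using that assms by blast
  have **: "\<forall>(a,b)\<in>S'. \<forall>(c,d)\<in>S'. P a b c d" if "\<forall>(a,b)\<in>S. \<forall>(c,d)\<in>S. P a b c d" for P
    using that assms by blast
  show ?thesis
    using supermodule unfolding smod_def supermodule_def
    by (elim conjE, intro conjI) (assumption | rule **, assumption | rule *, assumption)+
qed

subsection \<open>Parity components\<close>

lemma parity_comp_unique:
  assumes "u \<in> homog M s" "v - u \<in> homog M (s + 1)"
  shows "parity_comp M s v = u"
  unfolding parity_comp_def
proof (rule the_equality)
  fix u' assume u': "u' \<in> homog M s \<and> v - u' \<in> homog M (s + 1)"
  have "(v - u) - (v - u') = u' - u" by simp
  then have "u' - u = 0"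
    using u' assms subspace_diff[OF subspace_homog] homog_disjoint by metis
  then show "u' = u" by simp
qed (use assms in simp)

lemma parity_decomposition:
  assumes "v \<in> carr M"
  shows "parity_comp M s v \<in> homog M s" "v - parity_comp M s v \<in> homog M (s + 1)"
proof -
  obtain u w where uw: "v = u + w" "u \<in> homog M 0" "w \<in> homog M 1"
    using assms by (auto simp: carr_def)
  have "\<exists>x. x \<in> homog M s \<and> v - x \<in> homog M (s + 1)"
    using uw by (cases s) (auto intro: exI[of _ u] exI[of _ w])
  then show "parity_comp M s v \<in> homog M s" "v - parity_comp M s v \<in> homog M (s + 1)"
    using parity_comp_unique by auto
qed

lemma parity_comp_homog [simp]: "v \<in> homog M s \<Longrightarrow> parity_comp M s v = v"
  using parity_comp_unique[of v s v] subspace_0[OF subspace_homog] by simp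

lemma parity_comp_zero [simp]: "parity_comp M s 0 = 0"
  by (rule parity_comp_homog[OF subspace_0[OF subspace_homog]])

lemma parity_comp_opposite [simp]: "v \<in> homog M (s + 1) \<Longrightarrow> parity_comp M s v = 0"
  using parity_comp_unique[of 0 s v] subspace_0[OF subspace_homog] by simp

lemma parity_comp_opposite' [simp]: "v \<in> homog M s \<Longrightarrow> parity_comp M (s + 1) v = 0"
  using parity_comp_opposite[of v "s + 1"] by (simp add: add.assoc)

lemma parity_comp_in_carr: "v \<in> carr M \<Longrightarrow> parity_comp M s v \<in> carr M"
  using parity_decomposition homog_in_carr by blast

lemma parity_comp_add:
  assumes "v \<in> carr M" "w \<in> carr M"
  shows "parity_comp M s (v + w) = parity_comp M s v + parity_comp M s w"
proof (rule parity_comp_unique)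
  have "v + w - (parity_comp M s v + parity_comp M s w)
    = (v - parity_comp M s v) + (w - parity_comp M s w)" by simp
  then show "v + w - (parity_comp M s v + parity_comp M s w) \<in> homog M (s + 1)"
    using parity_decomposition assms subspace_add[OF subspace_homog] by metis
qed (use parity_decomposition assms subspace_add[OF subspace_homog] in blast)

lemma parity_comp_scale:
  assumes "v \<in> carr M"
  shows "parity_comp M s (scl M c v) = scl M c (parity_comp M s v)"
proof (rule parity_comp_unique)
  have "scl M c v - scl M c (parity_comp M s v) = scl M c (v - parity_comp M s v)"
    by (simp add: scale_right_diff_distrib)
  then show "scl M c v - scl M c (parity_comp M s v) \<in> homog M (s + 1)"
    using parity_decomposition assms subspace_scale[OF subspace_homog] by metis
qed (use parity_decomposition assms subspace_scale[OF subspace_homog] in blast)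

lemma parity_comp_sum:
  assumes "v \<in> carr M"
  shows "v = parity_comp M 0 v + parity_comp M 1 v"
proof -
  obtain u w where uw: "v = u + w" "u \<in> homog M 0" "w \<in> homog M 1"
    using assms by (auto simp: carr_def)
  then have "parity_comp M 0 v = u" "parity_comp M 1 v = w"
    by (intro parity_comp_unique; simp)+
  then show ?thesis using uw by simp
qed

lemma parity_comp_on_span:
  assumes "v \<in> span G" "G \<subseteq> carr M" "subspace W" "\<And>x. x \<in> G \<Longrightarrow> parity_comp M s x \<in> W"
  shows "parity_comp M s v \<in> W"
proof -
  have "v \<in> carr M \<and> parity_comp M s v \<in> W"
    using assms(1)
  proof (induction rule: span_induct_alt)
    case base
    show ?case using carr_closed(1) subspace_0[OF assms(3)] by simp
  next
    case (step c x y)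
    then have "x \<in> carr M" "parity_comp M s x \<in> W" using assms(2,4) by auto
    then show ?case
      using step.IH by (simp add: parity_comp_add parity_comp_scale carr_closed
        subspace_add[OF assms(3)] subspace_scale[OF assms(3)])
  qed
  then show ?thesis ..
qed

text \<open>An odd operator exchanges the two parity components, hence the shifted index on the right.\<close>

lemma parity_comp_act:
  assumes "v \<in> carr M" "(a,b) \<in> S"
  shows "parity_comp M s (act M a b v) = act M a b (parity_comp M (epar m a b + s) v)"
proof (rule parity_comp_unique)
  have "act M a b (parity_comp M (epar m a b + s) v) \<in> homog M (epar m a b + (epar m a b + s))"
    using act_homog assms parity_decomposition by blast
  then show "act M a b (parity_comp M (epar m a b + s) v) \<in> homog M s"
    by (simp only: bit_add_self)
  have "act M a b (v - parity_comp M (epar m a b + s) v) \<in> homog M (epar m a b + (epar m a b + s + 1))"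
    using act_homog assms parity_decomposition by blast
  then show "act M a b v - act M a b (parity_comp M (epar m a b + s) v) \<in> homog M (s + 1)"
    using assms(1) act_diff[OF assms(2,1) parity_comp_in_carr[OF assms(1)]]
    by (simp only: add.assoc bit_add_self)
qed

lemma homog_induct [consumes 1, case_names homog add]:
  assumes "v \<in> carr M" "\<And>s v. v \<in> homog M s \<Longrightarrow> P v"
    "\<And>v w. v \<in> carr M \<Longrightarrow> w \<in> carr M \<Longrightarrow> P v \<Longrightarrow> P w \<Longrightarrow> P (v + w)"
  shows "P v"
proof -
  obtain u w where "v = u + w" "u \<in> homog M 0" "w \<in> homog M 1"
    using assms(1) unfolding carr_def by auto
  then show ?thesis using assms(2,3) homog_in_carr by simp
qed

text \<open>It suffices to look at even parts, since the odd part of an element is the difference between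
  the element and its even part.\<close>

lemma submodI:
  assumes "subspace W" "W \<subseteq> carr M" "\<And>w. w \<in> W \<Longrightarrow> parity_comp M 0 w \<in> W"
    "\<And>a b w. (a,b) \<in> S \<Longrightarrow> w \<in> W \<Longrightarrow> act M a b w \<in> W"
  shows "submod S M W"
  unfolding submod_def
proof (intro conjI ballI)
  fix w assume w: "w \<in> W"
  then have wc: "w \<in> carr M" using assms(2) by blast
  have "w - parity_comp M 0 w = parity_comp M 1 w"
    by (subst (1) parity_comp_sum[OF wc]) simp
  then have "parity_comp M 1 w \<in> W"
    using assms(3)[OF w] w subspace_diff[OF assms(1)] by metis
  then show "\<exists>u\<in>W \<inter> homog M 0. \<exists>v\<in>W \<inter> homog M 1. w = u + v"
    using parity_comp_sum[OF wc] parity_decomposition[OF wc] assms(3)[OF w] by blast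
qed (use assms in auto)

lemma submod_parity_comp:
  assumes "submod S M W" "w \<in> W"
  shows "parity_comp M s w \<in> W"
proof -
  obtain u v where uv: "u \<in> W \<inter> homog M 0" "v \<in> W \<inter> homog M 1" "w = u + v"
    using assms unfolding submod_def by blast
  then have "parity_comp M 0 w = u" "parity_comp M 1 w = v"
    by (intro parity_comp_unique; simp)+
  then show ?thesis using uv by (cases s) auto
qed

text \<open>Matrix units are homogeneous operators, so words in them map a homogeneous vector to
  homogeneous vectors; therefore their span is graded by parity.\<close>

lemma submod_words:
  assumes "x \<in> homog M s"
  shows "submod S M (span {act_word M xs x |xs. xs \<in> lists S})" (is "submod S M (span ?G)")
proof (rule submodI)
  have G: "?G \<subseteq> carr M"
    using act_word_in_carr homog_in_carr[OF assms] by blast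
  then show sub: "span ?G \<subseteq> carr M"
    using span_minimal subspace_carr by blast
  show "act M a b w \<in> span ?G" if "(a,b) \<in> S" "w \<in> span ?G" for a b w
  proof (rule act_on_span[OF that(2,1) G])
    fix y assume "y \<in> ?G"
    then obtain xs where "xs \<in> lists S" "y = act_word M xs x" by blast
    then have "act M a b y = act_word M ((a,b) # xs) x" "(a,b) # xs \<in> lists S"
      using that by simp_all
    then have "act M a b y \<in> ?G" by blast
    then show "act M a b y \<in> span ?G" by (rule span_base)
  qed simp
  fix w assume w: "w \<in> span ?G"
  show "parity_comp M 0 w \<in> span ?G"
  proof (rule parity_comp_on_span[OF w G subspace_span])
    fix y assume y: "y \<in> ?G"
    then obtain xs where "xs \<in> lists S" "y = act_word M xs x" by blast
    then obtain t where t: "y \<in> homog M t" using act_word_homog assms by blast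
    show "parity_comp M 0 y \<in> span ?G"
    proof (cases "t = 0")
      case True
      then show ?thesis using t span_base[OF y] by (simp only: parity_comp_homog)
    next
      case False
      then have "parity_comp M 0 y = 0" using t parity_comp_opposite[of y 0] by simp
      then show ?thesis by (simp only: span_zero)
    qed
  qed
qed simp

lemma simple_mod_generated:
  assumes "simple_mod m S M" "x \<in> homog M s" "x \<noteq> 0"
  shows "generates S M x"
proof -
  have "act_word M [] x \<in> span {act_word M xs x |xs. xs \<in> lists S}"
    by (rule span_base) blast
  then have "span {act_word M xs x |xs. xs \<in> lists S} \<noteq> {0}"
    using assms by auto
  then show ?thesis
    using assms(1) submod_words[OF assms(2)] unfolding simple_mod_def generates_def by blast
qed

subsection \<open>Independence of eigenvectors\<close>

text \<open>Applying \<open>f - c i\<close> to a vanishing sum removes the summand of index \<open>i\<close> and multiplies the others by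
  nonzero scalars.\<close>

lemma eigenvectors_independent:
  assumes "finite J" "linear_on_carr M (scl M) f" "inj_on c J"
    "\<And>j. j \<in> J \<Longrightarrow> v j \<in> carr M" "\<And>j. j \<in> J \<Longrightarrow> f (v j) = scl M (c j) (v j)"
    "(\<Sum>j\<in>J. v j) = 0" "j \<in> J"
  shows "v j = 0"
  using assms(1,3-)
proof (induction J arbitrary: v j rule: finite_induct)
  case (insert i J)
  have f_sum: "f (\<Sum>j\<in>K. v j) = (\<Sum>j\<in>K. f (v j))" if "K \<subseteq> insert i J" for K
    using finite_subset[OF that] insert.hyps that
  proof (induction K rule: infinite_finite_induct)
    case empty
    have "f (scl M 0 0) = scl M 0 (f 0)"
      using assms(2) carr_closed(1) unfolding linear_on_carr_def by blast
    then show ?case by simp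
  next
    case (insert k K)
    then have "v k \<in> carr M" "sum v K \<in> carr M"
      using insert.prems \<open>\<And>j. j \<in> Set.insert i J \<Longrightarrow> v j \<in> carr M\<close>
      by (auto intro!: subspace_sum[OF subspace_carr])
    then have "f (v k + sum v K) = f (v k) + f (sum v K)"
      using assms(2) unfolding linear_on_carr_def by blast
    then show ?case using insert by simp
  qed simp
  have "(\<Sum>j\<in>J. scl M (c j - c i) (v j)) = (\<Sum>j\<in>insert i J. scl M (c j) (v j) - scl M (c i) (v j))"
    using insert.hyps by (simp add: scale_left_diff_distrib)
  also have "\<dots> = f (\<Sum>j\<in>insert i J. v j) - scl M (c i) (\<Sum>j\<in>insert i J. v j)"
    unfolding f_sum[OF subset_refl] sum_subtractf scale_sum_right
    by (intro arg_cong2[where f = "(-)"] sum.cong refl) (simp add: insert.prems(3))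
  also have "\<dots> = 0"
    using f_sum[of "{}"] insert.prems(4) by simp
  finally have zero: "(\<Sum>j\<in>J. scl M (c j - c i) (v j)) = 0" .
  have J: "scl M (c j - c i) (v j) = 0" if "j \<in> J" for j
  proof (rule insert.IH[where v = "\<lambda>j. scl M (c j - c i) (v j)", OF _ _ _ zero that])
    show "inj_on c J" using insert.prems(1) by simp
    show "scl M (c j - c i) (v j) \<in> carr M" if "j \<in> J" for j
      using that by (simp add: insert.prems(2) carr_closed)
    show "f (scl M (c j - c i) (v j)) = scl M (c j) (scl M (c j - c i) (v j))" if "j \<in> J" for j
    proof -
      have "f (scl M (c j - c i) (v j)) = scl M (c j - c i) (f (v j))"
        using assms(2) insert.prems(2)[of j] that unfolding linear_on_carr_def by simp
      then show ?thesis using insert.prems(3) that by (simp add: mult.commute)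
    qed
  qed
  have vJ: "v j = 0" if "j \<in> J" for j
    using J[OF that] insert.prems(1) insert.hyps(2) that by (auto simp: inj_on_def)
  moreover have "v i = 0"
    using insert.prems(4) insert.hyps vJ by simp
  ultimately show ?case using insert.prems by auto
qed simp

end

section \<open>Graded generation\<close>

text \<open>A function \<open>g\<close> on the indices grades the matrix units, those with indices a, b having degree
  \<open>g a - g b\<close>; brackets are compatible with this degree.\<close>

definition word_degree :: "(nat \<Rightarrow> int) \<Rightarrow> (nat \<times> nat) list \<Rightarrow> int" where
  "word_degree g xs = (\<Sum>(a,b)\<leftarrow>xs. g a - g b)"

lemma word_degree_simps [simp]:
  "word_degree g [] = 0" "word_degree g ((a,b) # xs) = g a - g b + word_degree g xs"
  by (simp_all add: word_degree_def)

definition positive_letters :: "(nat \<times> nat) set \<Rightarrow> (nat \<Rightarrow> int) \<Rightarrow> (nat \<times> nat) set" where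
  "positive_letters S g = {(a,b) \<in> S. g b < g a}"

lemma length_le_word_degree:
  "xs \<in> lists (positive_letters S g) \<Longrightarrow> int (length xs) \<le> word_degree g xs"
proof (induction rule: lists.induct)
  case (Cons x xs)
  then show ?case by (cases x) (auto simp: positive_letters_def)
qed simp

text \<open>The common form of the decompositions used below: letters of degree zero preserve \<open>Y\<close> and letters of
  negative degree annihilate it.  Depending on \<open>g\<close> and \<open>Y\<close>, the letters of positive degree are the elements of \<open>\<kk>\<^sub>-\<close>
  acting on \<open>B\<close>, the odd lowering operators of \<open>\<kk>\<close> acting on an even submodule, or the lowering (or raising)
  operators acting on a line.\<close>

locale graded_generation = smod m S M
  for m S and M :: "'v::ab_group_add supermod" +
  fixes g :: "nat \<Rightarrow> int" and Y :: "'v set"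
  assumes trans: "(a,b) \<in> S \<Longrightarrow> (b,c) \<in> S \<Longrightarrow> (a,c) \<in> S"
    and subspace_Y: "subspace Y"
    and Y_in_carr: "Y \<subseteq> carr M"
    and Y_degree_zero: "(a,b) \<in> S \<Longrightarrow> g a = g b \<Longrightarrow> y \<in> Y \<Longrightarrow> act M a b y \<in> Y"
    and Y_degree_neg: "(a,b) \<in> S \<Longrightarrow> g a < g b \<Longrightarrow> y \<in> Y \<Longrightarrow> act M a b y = 0"
begin

abbreviation F where "F \<equiv> positive_letters S g"

lemma F_subset: "F \<subseteq> S"
  by (auto simp: positive_letters_def)

lemma lists_F_subset: "lists F \<subseteq> lists S"
  using F_subset by (rule lists_mono)

definition piece_gens :: "int \<Rightarrow> 'v set" where
  "piece_gens k = {act_word M xs y |xs y. xs \<in> lists F \<and> word_degree g xs = k \<and> y \<in> Y}"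

definition piece :: "int \<Rightarrow> 'v set" where
  "piece k = span (piece_gens k)"

lemma subspace_piece: "subspace (piece k)"
  by (simp add: piece_def)

lemma piece_gens_in_carr: "piece_gens k \<subseteq> carr M"
  using act_word_in_carr lists_F_subset Y_in_carr unfolding piece_gens_def by blast

lemma piece_in_carr: "piece k \<subseteq> carr M"
  unfolding piece_def using piece_gens_in_carr subspace_carr by (rule span_minimal)

lemma word_in_piece: "xs \<in> lists F \<Longrightarrow> word_degree g xs = k \<Longrightarrow> y \<in> Y \<Longrightarrow> act_word M xs y \<in> piece k"
  unfolding piece_def piece_gens_def by (rule span_base) blast

lemma F_act_piece:
  assumes "(a,b) \<in> F" "v \<in> piece k"
  shows "act M a b v \<in> piece (g a - g b + k)"
proof (rule act_on_span[OF assms(2)[unfolded piece_def] _ piece_gens_in_carr subspace_piece])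
  fix x assume "x \<in> piece_gens k"
  then obtain xs y where xs: "xs \<in> lists F" "word_degree g xs = k" "y \<in> Y" "x = act_word M xs y"
    unfolding piece_gens_def by blast
  then have "act_word M ((a,b) # xs) y \<in> piece (g a - g b + k)"
    using assms(1) by (intro word_in_piece) simp_all
  then show "act M a b x \<in> piece (g a - g b + k)"
    using xs by simp
qed (use assms F_subset in auto)

text \<open>By induction on the length of the word: moving a letter past the first letter of the word leaves it in front of
  a shorter word, and the bracket of the two letters is again a combination of letters of the right degree in front of that
  shorter word, because the index set is closed under composition of pairs.\<close>

lemma act_word_F_piece:
  assumes "xs \<in> lists F" "y \<in> Y"
  shows "(a,b) \<in> S \<Longrightarrow> act M a b (act_word M xs y) \<in> piece (g a - g b + word_degree g xs)"
  using assms(1)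
proof (induction arbitrary: a b rule: lists.induct)
  case Nil
  consider "g b < g a" | "g a = g b" | "g a < g b" by linarith
  then show ?case
  proof cases
    case 1
    then have "act_word M [(a,b)] y \<in> piece (g a - g b + word_degree g [])"
      using Nil assms(2) by (intro word_in_piece) (simp_all add: positive_letters_def)
    then show ?thesis by simp
  next
    case 2
    then have "act_word M [] (act M a b y) \<in> piece (g a - g b + word_degree g [])"
      using Nil assms(2) Y_degree_zero by (intro word_in_piece) simp_all
    then show ?thesis by simp
  next
    case 3
    then show ?thesis
      using Y_degree_neg Nil assms(2) subspace_0[OF subspace_piece] by simp
  qed
next
  case (Cons x xs)
  obtain c d where x: "x = (c,d)" by (cases x)
  let ?w = "act_word M xs y" and ?k = "word_degree g xs"
  have cd: "(c,d) \<in> F" "(c,d) \<in> S" using Cons.hyps F_subset x by auto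
  have w: "?w \<in> carr M"
    using act_word_in_carr Cons.hyps(2) lists_F_subset assms(2) Y_in_carr by blast
  have "act M c d (act M a b ?w) \<in> piece (g c - g d + (g a - g b + ?k))"
    using F_act_piece[OF cd(1) Cons.IH[OF Cons.prems]] .
  then have 1: "scl M (koszul (epar m a b) (epar m c d)) (act M c d (act M a b ?w))
      \<in> piece (g a - g b + word_degree g (x # xs))"
    using subspace_scale[OF subspace_piece] by (simp add: x algebra_simps)
  have 2: "(if b = c then act M a d ?w else 0) \<in> piece (g a - g b + word_degree g (x # xs))"
    using Cons.IH[of a d] trans Cons.prems cd subspace_0[OF subspace_piece] by (auto simp: x algebra_simps)
  have 3: "act M c b ?w \<in> piece (g a - g b + word_degree g (x # xs))" if "d = a"
    using Cons.IH[of c b] trans[of c d b] Cons.prems cd that by (simp add: x algebra_simps)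
  then have 3: "(if d = a then scl M (koszul (epar m a b) (epar m c d)) (act M c b ?w) else 0)
      \<in> piece (g a - g b + word_degree g (x # xs))"
    using subspace_scale[OF subspace_piece] subspace_0[OF subspace_piece] by simp
  show ?case
    unfolding x act_word.simps act_commute[OF Cons.prems cd(2) w]
    using subspace_add[OF subspace_piece 1 subspace_diff[OF subspace_piece 2 3]] by (simp add: x)
qed

lemma act_piece:
  assumes "(a,b) \<in> S" "v \<in> piece k"
  shows "act M a b v \<in> piece (g a - g b + k)"
proof (rule act_on_span[OF assms(2)[unfolded piece_def] assms(1) piece_gens_in_carr subspace_piece])
  fix x assume "x \<in> piece_gens k"
  then show "act M a b x \<in> piece (g a - g b + k)"
    using act_word_F_piece assms(1) unfolding piece_gens_def by blast
qed

lemma act_word_piece: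
  assumes "xs \<in> lists S" "y \<in> Y"
  shows "act_word M xs y \<in> piece (word_degree g xs)"
  using assms(1)
proof (induction rule: lists.induct)
  case Nil
  then show ?case using word_in_piece[of "[]" 0 y] assms(2) by simp
next
  case (Cons x xs)
  then show ?case by (cases x) (simp add: act_piece)
qed

end

section \<open>Euler operators\<close>

context smod
begin

text \<open>The diagonal element \<open>\<Sum>g(a) E\<^sub>a\<^sub>a\<close>, whose bracket with a matrix unit multiplies it by its degree.\<close>

definition euler :: "(nat \<Rightarrow> int) \<Rightarrow> 'v \<Rightarrow> 'v" where
  "euler g v = (\<Sum>a | (a,a) \<in> S. scl M (of_int (g a)) (act M a a v))"

lemma euler_in_carr: "v \<in> carr M \<Longrightarrow> euler g v \<in> carr M"
  unfolding euler_def by (rule subspace_sum[OF subspace_carr]) (simp add: carr_closed act_in_carr)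

lemma linear_euler: "linear_on_carr M (scl M) (euler g)"
  unfolding linear_on_carr_def euler_def
  by (simp add: act_add act_scale scale_right_distrib sum.distrib scale_sum_right mult.commute)

lemma euler_act:
  assumes "finite S" "(a,b) \<in> S" "(a,a) \<in> S" "(b,b) \<in> S" "v \<in> carr M"
  shows "euler g (act M a b v) = act M a b (euler g v) + scl M (of_int (g a - g b)) (act M a b v)"
proof -
  let ?I = "{c. (c,c) \<in> S}"
  have fin: "finite ?I"
    using finite_vimageI[OF assms(1), of "\<lambda>c. (c,c)"] by (auto simp: inj_on_def vimage_def)
  have "euler g (act M a b v) = (\<Sum>c\<in>?I. scl M (of_int (g c)) (act M a b (act M c c v)))
      + (\<Sum>c\<in>?I. scl M (of_int (g c) * (of_bool (c = a) - of_bool (c = b))) (act M a b v))"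
    unfolding euler_def sum.distrib[symmetric]
    by (intro sum.cong refl) (simp add: act_diag_commute[OF _ assms(2,5)] scale_right_distrib)
  also have "(\<Sum>c\<in>?I. scl M (of_int (g c)) (act M a b (act M c c v))) = act M a b (euler g v)"
    unfolding euler_def using assms
    by (subst act_sum) (auto simp: act_scale act_in_carr carr_closed)
  also have "(\<Sum>c\<in>?I. scl M (of_int (g c) * (of_bool (c = a) - of_bool (c = b))) (act M a b v))
      = scl M (\<Sum>c\<in>?I. of_int (g c) * (of_bool (c = a) - of_bool (c = b))) (act M a b v)"
    by (simp add: scale_sum_left)
  also have "(\<Sum>c\<in>?I. of_int (g c) * (of_bool (c = a) - of_bool (c = b))) = (of_int (g a - g b) :: complex)"
    using fin assms(3,4) by (simp add: algebra_simps sum_subtractf of_bool_def if_distrib[of "(*) _"] cong: if_cong)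
  finally show ?thesis .
qed

lemma subspace_eigenspace: "linear_on_carr M (scl M) f \<Longrightarrow> subspace {v \<in> carr M. f v = scl M c v}"
proof (rule subspaceI)
  assume f: "linear_on_carr M (scl M) f"
  have "f (scl M 0 0) = scl M 0 (f 0)"
    using f carr_closed(1) unfolding linear_on_carr_def by blast
  then show "0 \<in> {v \<in> carr M. f v = scl M c v}" using carr_closed(1) by simp
qed (auto simp: linear_on_carr_def carr_closed scale_right_distrib mult.commute)

end

context graded_generation
begin

lemma euler_piece:
  assumes S: "finite S" "\<And>a b. (a,b) \<in> S \<Longrightarrow> (b,a) \<in> S"
    and Y: "\<And>y. y \<in> Y \<Longrightarrow> euler g y = scl M c y"
    and v: "v \<in> piece k"
  shows "euler g v = scl M (c + of_int k) v"
proof -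
  have "piece_gens k \<subseteq> {v \<in> carr M. euler g v = scl M (c + of_int k) v}"
  proof
    fix x assume "x \<in> piece_gens k"
    then obtain xs y where xs: "xs \<in> lists F" "word_degree g xs = k" "y \<in> Y" "x = act_word M xs y"
      unfolding piece_gens_def by blast
    then have "xs \<in> lists S" using lists_F_subset by blast
    then have "euler g (act_word M xs y) = scl M (c + of_int (word_degree g xs)) (act_word M xs y)
      \<and> act_word M xs y \<in> carr M"
    proof (induction rule: lists.induct)
      case Nil
      then show ?case using Y xs Y_in_carr by auto
    next
      case (Cons x xs)
      obtain a b where x: "x = (a,b)" by (cases x)
      then have "(a,b) \<in> S" "(a,a) \<in> S" "(b,b) \<in> S" using Cons S(2) trans by blast+
      then show ?case
        using Cons S(1) by (simp add: x euler_act act_scale act_in_carr flip: scale_left_distrib)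
    qed
    then show "x \<in> {v \<in> carr M. euler g v = scl M (c + of_int k) v}"
      using xs by simp
  qed
  then have "piece k \<subseteq> {v \<in> carr M. euler g v = scl M (c + of_int k) v}"
    unfolding piece_def using subspace_eigenspace[OF linear_euler] by (rule span_minimal)
  then show ?thesis using v by blast
qed

end

section \<open>The Casimir operator of an even subalgebra\<close>

lemma sum_over_fibre:
  assumes "finite S"
  shows "(\<Sum>(a,b)\<in>S. if a = d then f b else 0) = (\<Sum>b | (d,b) \<in> S. f b)"
    and "(\<Sum>(a,b)\<in>S. if b = d then f a else 0) = (\<Sum>a | (a,d) \<in> S. f a)"
proof -
  have "(\<Sum>(a,b)\<in>S. if a = d then f b else 0) = (\<Sum>x\<in>{x\<in>S. fst x = d}. f (snd x))"
    by (subst sum.inter_filter[OF assms]) (auto intro!: sum.cong split: prod.splits)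
  also have "\<dots> = (\<Sum>b | (d,b) \<in> S. f b)"
    by (rule sum.reindex_bij_witness[where i = "Pair d" and j = snd]) auto
  finally show "(\<Sum>(a,b)\<in>S. if a = d then f b else 0) = (\<Sum>b | (d,b) \<in> S. f b)" .
  have "(\<Sum>(a,b)\<in>S. if b = d then f a else 0) = (\<Sum>x\<in>{x\<in>S. snd x = d}. f (fst x))"
    by (subst sum.inter_filter[OF assms]) (auto intro!: sum.cong split: prod.splits)
  also have "\<dots> = (\<Sum>a | (a,d) \<in> S. f a)"
    by (rule sum.reindex_bij_witness[where i = "\<lambda>a. (a,d)" and j = fst]) auto
  finally show "(\<Sum>(a,b)\<in>S. if b = d then f a else 0) = (\<Sum>a | (a,d) \<in> S. f a)" .
qed

context smod
begin

definition casimir :: "'v \<Rightarrow> 'v" where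
  "casimir v = (\<Sum>(a,b)\<in>S. act M a b (act M b a v))"

lemma act_even_commute:
  assumes "epar m a b = 0" "(a,b) \<in> S" "(c,d) \<in> S" "v \<in> carr M"
  shows "act M a b (act M c d v) = act M c d (act M a b v)
    + (if b = c then act M a d v else 0) - (if d = a then act M c b v else 0)"
  using act_commute[OF assms(2-)] assms(1) by simp

text \<open>The bracket with each summand consists of four terms.  Summed over the equivalence relation \<open>S\<close> they
  cancel in pairs, since c and d belong to the same class.\<close>

lemma casimir_commute:
  assumes S: "finite S" "\<And>a b. (a,b) \<in> S \<Longrightarrow> (b,a) \<in> S"
      "\<And>a b c. (a,b) \<in> S \<Longrightarrow> (b,c) \<in> S \<Longrightarrow> (a,c) \<in> S"
    and even: "\<And>a b. (a,b) \<in> S \<Longrightarrow> epar m a b = 0"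
    and cd: "(c,d) \<in> S" and v: "v \<in> carr M"
  shows "act M c d (casimir v) = casimir (act M c d v)"
proof -
  have summand: "act M c d (act M a b (act M b a v)) = act M a b (act M b a (act M c d v))
      + (if b = d then act M a d (act M c a v) else 0) - (if a = c then act M c b (act M b d v) else 0)
      + (if a = d then act M c b (act M b d v) else 0) - (if b = c then act M a d (act M c a v) else 0)"
    if ab: "(a,b) \<in> S" for a b
  proof -
    have ba: "(b,a) \<in> S" using S(2) ab .
    have 1: "act M c d (act M a b (act M b a v)) = act M a b (act M c d (act M b a v))
      + (if a = d then act M c b (act M b a v) else 0) - (if b = c then act M a d (act M b a v) else 0)"
      using act_even_commute[OF even[OF cd] cd ab, of "act M b a v"] ba v
      by (simp add: act_in_carr eq_commute[of d a])
    have 2: "act M c d (act M b a v) = act M b a (act M c d v)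
      + (if b = d then act M c a v else 0) - (if a = c then act M b d v else 0)"
      using act_even_commute[OF even[OF cd] cd ba v] by (simp add: eq_commute[of d b])
    have ca: "act M a b (if b = d then act M c a v else 0) = (if b = d then act M a d (act M c a v) else 0)"
      using ab by (simp add: act_zero)
    have bd: "act M a b (if a = c then act M b d v else 0) = (if a = c then act M c b (act M b d v) else 0)"
      using ab by (simp add: act_zero)
    have carrs: "(if b = d then act M c a v else 0) \<in> carr M" "(if a = c then act M b d v else 0) \<in> carr M"
        "act M b a (act M c d v) \<in> carr M"
      using act_in_carr[OF _ v] act_in_carr[OF ba act_in_carr[OF cd v]] carr_closed(1) cd S(3) ba by auto
    show ?thesis
      unfolding 1 2 by (simp add: act_diff[OF ab] act_add[OF ab] carrs carr_closed ca bd)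
  qed
  have "act M c d (casimir v) = (\<Sum>(a,b)\<in>S. act M c d (act M a b (act M b a v)))"
    unfolding casimir_def using S(2) v cd by (subst act_sum) (auto simp: act_in_carr split_def)
  also have "\<dots> = (\<Sum>(a,b)\<in>S. act M a b (act M b a (act M c d v))
      + (if b = d then act M a d (act M c a v) else 0) - (if a = c then act M c b (act M b d v) else 0)
      + (if a = d then act M c b (act M b d v) else 0) - (if b = c then act M a d (act M c a v) else 0))"
    using summand by (intro sum.cong) auto
  also have "\<dots> = casimir (act M c d v)
      + (\<Sum>a | (a,d) \<in> S. act M a d (act M c a v)) - (\<Sum>b | (c,b) \<in> S. act M c b (act M b d v))
      + (\<Sum>b | (d,b) \<in> S. act M c b (act M b d v)) - (\<Sum>a | (a,c) \<in> S. act M a d (act M c a v))"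
    unfolding casimir_def sum_over_fibre[OF S(1), symmetric] by (simp add: split_def sum.distrib sum_subtractf)
  also have "{b. (c,b) \<in> S} = {b. (d,b) \<in> S}"
    using cd S(2,3) by blast
  also have "{a. (a,c) \<in> S} = {a. (a,d) \<in> S}"
    using cd S(2,3) by blast
  finally show ?thesis by simp
qed

text \<open>Each summand maps the vector into the line that it spans: for a < b the raising operator is
  moved to the right, where it annihilates the vector and leaves a diagonal bracket behind.\<close>

lemma casimir_highest_weight:
  assumes S: "\<And>a b. (a,b) \<in> S \<Longrightarrow> (b,a) \<in> S" "\<And>a b c. (a,b) \<in> S \<Longrightarrow> (b,c) \<in> S \<Longrightarrow> (a,c) \<in> S"
    and even: "\<And>a b. (a,b) \<in> S \<Longrightarrow> epar m a b = 0"
    and v: "v \<in> carr M" "\<And>a. (a,a) \<in> S \<Longrightarrow> act M a a v = scl M (\<Lambda> a) v"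
      "\<And>a b. (a,b) \<in> S \<Longrightarrow> a < b \<Longrightarrow> act M a b v = 0"
  shows "\<exists>c. casimir v = scl M c v"
proof -
  have "act M a b (act M b a v) \<in> span {v}" if ab: "(a,b) \<in> S" for a b
  proof -
    have *: "(b,a) \<in> S" "(a,a) \<in> S" "(b,b) \<in> S" using ab S by blast+
    consider "a < b" | "a = b" | "b < a" by linarith
    then show ?thesis
    proof cases
      case 1
      then show ?thesis
        using act_even_commute[OF even[OF ab] ab *(1) v(1)] v(2,3) * ab
        by (simp add: act_zero span_diff span_scale span_base)
    next
      case 2
      then show ?thesis using * v by (simp add: act_scale span_scale span_base)
    next
      case 3
      then show ?thesis using v(3)[OF *(1)] ab by (simp add: act_zero span_zero)
    qed
  qed
  then have "casimir v \<in> span {v}"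
    unfolding casimir_def by (intro span_sum) auto
  then show ?thesis by (auto simp: span_singleton)
qed

lemma act_word_weight:
  assumes "xs \<in> lists S" "v \<in> carr M" "\<And>a. (a,a) \<in> S \<Longrightarrow> act M a a v = scl M (\<Lambda> a) v"
  shows "\<exists>\<mu>. \<forall>a. (a,a) \<in> S \<longrightarrow> act M a a (act_word M xs v) = scl M (\<mu> a) (act_word M xs v)"
  using assms(1)
proof (induction rule: lists.induct)
  case Nil
  then show ?case using assms(3) by auto
next
  case (Cons x xs)
  obtain c d where x: "x = (c,d)" by (cases x)
  obtain \<mu> where \<mu>: "\<forall>a. (a,a) \<in> S \<longrightarrow> act M a a (act_word M xs v) = scl M (\<mu> a) (act_word M xs v)"
    using Cons.IH by blast
  have "act M a a (act_word M (x # xs) v)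
      = scl M (\<mu> a + (of_bool (a = c) - of_bool (a = d))) (act_word M (x # xs) v)" if "(a,a) \<in> S" for a
    using that \<mu> Cons.hyps act_word_in_carr[OF Cons.hyps(2) assms(2)]
    by (simp add: x act_diag_commute act_scale scale_left_distrib)
  then show ?case by (intro exI allI impI)
qed

end

section \<open>Hermitian forms\<close>

locale hermitian_smod = smod m S M
  for m S and M :: "'v::ab_group_add supermod" +
  fixes h :: "'v \<Rightarrow> 'v \<Rightarrow> complex"
  assumes form: "positive_hermitian_form M h"
begin

lemma form_linear: "u \<in> carr M \<Longrightarrow> linear_on_carr M (*) (h u)"
  using form unfolding positive_hermitian_form_def by blast

lemma form_cnj: "u \<in> carr M \<Longrightarrow> v \<in> carr M \<Longrightarrow> cnj (h u v) = h v u"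
  using form unfolding positive_hermitian_form_def by metis

lemma form_pos: "v \<in> carr M \<Longrightarrow> v \<noteq> 0 \<Longrightarrow> 0 < Re (h v v)"
  using form unfolding positive_hermitian_form_def by blast

lemma form_add_right: "u \<in> carr M \<Longrightarrow> v \<in> carr M \<Longrightarrow> w \<in> carr M \<Longrightarrow> h u (v + w) = h u v + h u w"
  using form_linear[of u] by (simp add: linear_on_carr_def)

lemma form_scale_right: "u \<in> carr M \<Longrightarrow> v \<in> carr M \<Longrightarrow> h u (scl M c v) = c * h u v"
  using form_linear[of u] by (simp add: linear_on_carr_def)

lemma form_add_left:
  assumes "u \<in> carr M" "v \<in> carr M" "w \<in> carr M"
  shows "h (v + w) u = h v u + h w u"
proof -
  have "cnj (h u (v + w)) = cnj (h u v) + cnj (h u w)"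
    using assms by (simp add: form_add_right)
  then show ?thesis using assms by (simp add: form_cnj carr_closed)
qed

lemma form_scale_left:
  assumes "u \<in> carr M" "v \<in> carr M"
  shows "h (scl M c v) u = cnj c * h v u"
proof -
  have "cnj (h u (scl M c v)) = cnj c * cnj (h u v)"
    using assms by (simp add: form_scale_right)
  then show ?thesis using assms by (simp add: form_cnj carr_closed)
qed

lemma form_zero_right: "u \<in> carr M \<Longrightarrow> h u 0 = 0"
  using form_scale_right[of u u 0] by simp

lemma form_zero_left: "u \<in> carr M \<Longrightarrow> h 0 u = 0"
  using form_scale_left[of u u 0] by simp

lemma form_diff_right: "u \<in> carr M \<Longrightarrow> v \<in> carr M \<Longrightarrow> w \<in> carr M \<Longrightarrow> h u (v - w) = h u v - h u w"
  using form_add_right[of u "v - w" w] carr_closed by (simp add: algebra_simps)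

lemma form_diff_left: "u \<in> carr M \<Longrightarrow> v \<in> carr M \<Longrightarrow> w \<in> carr M \<Longrightarrow> h (v - w) u = h v u - h w u"
  using form_add_left[of u "v - w" w] carr_closed by (simp add: algebra_simps)

lemma form_sum_right:
  "u \<in> carr M \<Longrightarrow> (\<And>i. i \<in> I \<Longrightarrow> f i \<in> carr M) \<Longrightarrow> h u (sum f I) = (\<Sum>i\<in>I. h u (f i))"
proof (induction I rule: infinite_finite_induct)
  case (insert x F)
  then show ?case
    using form_add_right[of u "f x" "sum f F"] subspace_sum[OF subspace_carr, of F f] by simp
qed (simp_all add: form_zero_right)

lemma form_nonneg: "v \<in> carr M \<Longrightarrow> 0 \<le> Re (h v v)"
  using form_pos[of v] form_zero_right[of v] by (cases "v = 0") auto

lemma form_real: "v \<in> carr M \<Longrightarrow> h v v = complex_of_real (Re (h v v))"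
  using form_cnj[of v v] by (simp add: complex_eq_iff)

lemma form_definite: "v \<in> carr M \<Longrightarrow> h v v = 0 \<Longrightarrow> v = 0"
  using form_pos[of v] by auto

lemma form_nondegenerate:
  assumes "u \<in> carr M" "v \<in> carr M" "\<And>w. w \<in> carr M \<Longrightarrow> h u w = h v w"
  shows "u = v"
proof -
  have "h (u - v) (u - v) = 0"
    using assms form_diff_left[of "u - v" u v] by (simp add: carr_closed)
  then show ?thesis using form_definite[of "u - v"] assms carr_closed by simp
qed

lemma orthogonal_span:
  assumes "u \<in> carr M" "G \<subseteq> carr M" "\<And>x. x \<in> G \<Longrightarrow> h u x = 0" "v \<in> span G"
  shows "h u v = 0"
proof -
  have "v \<in> carr M \<and> h u v = 0"
    using assms(4)
  proof (induction rule: span_induct_alt)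
    case base
    then show ?case using assms(1) form_zero_right carr_closed(1) by simp
  next
    case (step c x y)
    then have "x \<in> carr M" using assms(2) by blast
    then show ?case using step assms(1,3) by (simp add: form_add_right form_scale_right carr_closed)
  qed
  then show ?thesis ..
qed

text \<open>By induction on the generators, as in the Gram-Schmidt process: a new generator \<open>x\<close> is replaced by
  its component \<open>y\<close> orthogonal to the span of the previous ones.\<close>

lemma riesz_finite_span:
  assumes "finite G" "G \<subseteq> carr M" "linear_on_carr M (*) f"
  shows "\<exists>v \<in> span G. \<forall>w \<in> span G. h v w = f w"
  using assms
proof (induction G arbitrary: f rule: finite_induct)
  case empty
  have "f (scl M 0 0) = 0 * f 0"
    using empty.prems(2) carr_closed(1) unfolding linear_on_carr_def by blast
  then show ?case by (simp add: form_zero_right carr_closed(1))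
next
  case (insert x G)
  have x: "x \<in> carr M" and G: "G \<subseteq> carr M" using insert.prems(1) by auto
  have G': "span G \<subseteq> carr M" using span_minimal[OF G subspace_carr] .
  obtain u where u: "u \<in> span G" "\<And>w. w \<in> span G \<Longrightarrow> h u w = h x w"
    using insert.IH[OF G form_linear[OF x]] by blast
  obtain v where v: "v \<in> span G" "\<And>w. w \<in> span G \<Longrightarrow> h v w = f w"
    using insert.IH[OF G insert.prems(2)] by blast
  define y where "y = x - u"
  have uc: "u \<in> carr M" and vc: "v \<in> carr M" and yc: "y \<in> carr M"
    using u v G' x carr_closed by (auto simp: y_def)
  have yG: "h y w = 0" "h w y = 0" if "w \<in> span G" for w
  proof -
    have "w \<in> carr M" using that G' by blast
    then show "h y w = 0"
      using u(2)[OF that] uc x by (simp add: y_def form_diff_left)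
    then show "h w y = 0"
      using form_cnj[of y w] yc \<open>w \<in> carr M\<close> by simp
  qed
  \<comment> \<open>The coefficient is conjugated because the form is anti-linear in its first argument; if \<open>y = 0\<close>, the added term vanishes.\<close>
  define z where "z = v + scl M (cnj (f y) / h y y) y"
  have sub: "span G \<subseteq> span (insert x G)" by (rule span_mono) blast
  have y_in: "y \<in> span (insert x G)"
    unfolding y_def by (intro span_diff subsetD[OF sub u(1)] span_base) simp
  have "z \<in> span (insert x G)"
    unfolding z_def by (intro span_add subsetD[OF sub v(1)] span_scale y_in)
  moreover have "h z w = f w" if w: "w \<in> span (insert x G)" for w
  proof -
    obtain k where k: "w - scl M k x \<in> span G"
      using w by (auto simp: span_insert)
    define t where "t = w - scl M k x + scl M k u"
    have t: "t \<in> span G" unfolding t_def by (intro span_add k span_scale u(1))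
    have w_eq: "w = t + scl M k y" by (simp add: t_def y_def scale_right_diff_distrib)
    have tc: "t \<in> carr M" using t G' by blast
    have fw: "f w = f t + k * f y"
      unfolding w_eq using insert.prems(2) tc yc carr_closed unfolding linear_on_carr_def by simp
    have "h z t = h v t" unfolding z_def
      using vc yc tc yG[OF t] by (simp add: form_add_left form_scale_left carr_closed)
    moreover have "h z y = f y"
    proof (cases "y = 0")
      case True
      have "f (scl M 0 0) = 0 * f 0"
        using insert.prems(2) carr_closed(1) unfolding linear_on_carr_def by blast
      moreover have "z \<in> carr M" using vc yc by (simp add: z_def carr_closed)
      ultimately show ?thesis using True by (simp add: form_zero_right)
    next
      case False
      then have "h y y \<noteq> 0" "cnj (h y y) = h y y"
        using form_definite yc form_cnj by auto
      then show ?thesis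
        unfolding z_def using vc yc yG[OF v(1)]
        by (simp add: form_add_left form_scale_left carr_closed)
    qed
    moreover have "z \<in> carr M" using vc yc by (simp add: z_def carr_closed)
    ultimately show ?thesis
      unfolding fw using v(2)[OF t] tc yc
      by (subst w_eq) (simp add: form_add_right form_scale_right carr_closed)
  qed
  ultimately show ?case by blast
qed

end

text \<open>The expectation value of the Casimir operator at \<open>w\<close> is the sum of the squared norms of all \<open>act M b a w\<close>;
  a single diagonal term already contributes \<open>\<bar>\<mu>\<bar>\<^sup>2\<close> times the squared norm of \<open>w\<close>.\<close>

lemma (in hermitian_smod) casimir_bounds_weights:
  assumes S: "finite S" "\<And>a b. (a,b) \<in> S \<Longrightarrow> (b,a) \<in> S"
    and adjoint: "\<And>a b v w. (a,b) \<in> S \<Longrightarrow> v \<in> carr M \<Longrightarrow> w \<in> carr M \<Longrightarrow> h (act M a b v) w = h v (act M b a w)"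
    and w: "w \<in> carr M" "w \<noteq> 0" "casimir w = scl M c w"
    and a: "(a,a) \<in> S" "act M a a w = scl M \<mu> w"
  shows "(cmod \<mu>)\<^sup>2 \<le> cmod c"
proof -
  have "h w (casimir w) = (\<Sum>(a,b)\<in>S. h (act M b a w) (act M b a w))"
    unfolding casimir_def using w(1) S(2) adjoint
    by (subst form_sum_right) (auto simp: act_in_carr intro!: sum.cong)
  then have "Re (h w (casimir w)) = (\<Sum>(a,b)\<in>S. Re (h (act M b a w) (act M b a w)))"
    by (simp add: split_def)
  also have "\<dots> \<ge> (case (a,a) of (a,b) \<Rightarrow> Re (h (act M b a w) (act M b a w)))"
    by (rule member_le_sum[OF a(1)]) (use S w(1) form_nonneg act_in_carr in auto)
  also have "(case (a,a) of (a,b) \<Rightarrow> Re (h (act M b a w) (act M b a w))) = (cmod \<mu>)\<^sup>2 * Re (h w w)"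
  proof -
    have "h (act M a a w) (act M a a w) = (cnj \<mu> * \<mu>) * h w w"
      using w(1) a by (simp add: form_scale_left form_scale_right carr_closed)
    also have "\<dots> = complex_of_real ((cmod \<mu>)\<^sup>2 * Re (h w w))"
      using form_real[OF w(1)] complex_norm_square[of \<mu>] by (simp add: mult.commute)
    finally show ?thesis by simp
  qed
  finally have "(cmod \<mu>)\<^sup>2 * Re (h w w) \<le> Re (c * h w w)"
    using w by (simp add: form_scale_right)
  also have "\<dots> = Re c * Re (h w w)"
    by (subst form_real[OF w(1)]) simp
  finally have "(cmod \<mu>)\<^sup>2 \<le> Re c"
    using form_pos[OF w(1,2)] by simp
  then show ?thesis using complex_Re_le_cmod[of c] by linarith
qed

section \<open>Finite generation over the Levi subalgebra\<close>

context graded_generation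
begin

text \<open>A weak form of the Poincare-Birkhoff-Witt theorem: letters of degree zero or less can be moved
  to the right and absorbed by \<open>Y\<close>.\<close>

lemma span_words_eq:
  "span {act_word M xs y |xs y. xs \<in> lists S \<and> y \<in> Y} = span {act_word M xs y |xs y. xs \<in> lists F \<and> y \<in> Y}"
  (is "span ?S = span ?F")
proof (rule span_unique)
  show "?S \<subseteq> span ?F"
  proof
    fix x assume "x \<in> ?S"
    then obtain xs y where "xs \<in> lists S" "y \<in> Y" "x = act_word M xs y" by blast
    then have "x \<in> piece (word_degree g xs)" using act_word_piece by blast
    moreover have "piece_gens k \<subseteq> ?F" for k
      unfolding piece_gens_def by blast
    ultimately show "x \<in> span ?F"
      unfolding piece_def using span_mono by blast
  qed
  show "span ?F \<subseteq> T'" if "?S \<subseteq> T'" "subspace T'" for T'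
    using that lists_F_subset by (intro span_minimal) blast+
qed simp

end

context smod
begin

text \<open>The square of a letter that anticommutes with itself is zero, and a letter repeated in an
  anticommuting word can be moved next to its other occurrence.\<close>

lemma act_word_zero_if_letter_zero:
  assumes "xs \<in> lists T" "T \<subseteq> S" "v \<in> carr M" "(a,b) \<in> set xs"
    and anti: "\<And>a b c d v. (a,b) \<in> T \<Longrightarrow> (c,d) \<in> T \<Longrightarrow> v \<in> carr M \<Longrightarrow>
      act M a b (act M c d v) = - act M c d (act M a b v)"
  shows "act M a b (act_word M xs v) = 0"
  using assms(1,4)
proof (induction rule: lists.induct)
  case (Cons x xs)
  obtain c d where x: "x = (c,d)" by (cases x)
  have ab: "(a,b) \<in> T" using Cons by auto
  let ?w = "act_word M xs v"
  have w: "?w \<in> carr M"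
    using act_word_in_carr lists_mono[OF assms(2)] Cons.hyps(2) assms(3) by blast
  have cd: "(c,d) \<in> T" using Cons.hyps x by simp
  show ?case
  proof (cases "x = (a,b)")
    case True
    have "act M a b (act M a b ?w) + act M a b (act M a b ?w) = 0"
      using anti[OF ab ab w] unfolding eq_neg_iff_add_eq_0 .
    moreover have "scl M 2 (act M a b (act M a b ?w)) = act M a b (act M a b ?w) + act M a b (act M a b ?w)"
      using scale_left_distrib[of 1 1 "act M a b (act M a b ?w)"] by simp
    ultimately have "scl M 2 (act M a b (act M a b ?w)) = 0" by simp
    then show ?thesis using True by simp
  next
    case False
    then have "act M a b ?w = 0" using Cons.IH Cons.prems by simp
    then show ?thesis using anti[OF ab cd w] cd assms(2) act_zero[of c d] by (auto simp: x)
  qed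
qed simp

lemma anticommuting_word_bound:
  assumes "xs \<in> lists T" "T \<subseteq> S" "finite T" "v \<in> carr M" "act_word M xs v \<noteq> 0"
    and anti: "\<And>a b c d v. (a,b) \<in> T \<Longrightarrow> (c,d) \<in> T \<Longrightarrow> v \<in> carr M \<Longrightarrow>
      act M a b (act M c d v) = - act M c d (act M a b v)"
  shows "length xs \<le> card T"
proof -
  have "distinct xs"
    using assms(1,5)
  proof (induction rule: lists.induct)
    case (Cons x xs)
    obtain a b where x: "x = (a,b)" by (cases x)
    have ab: "(a,b) \<in> S" using Cons.hyps x assms(2) by auto
    have "(a,b) \<notin> set xs"
      using act_word_zero_if_letter_zero[OF Cons.hyps(2) assms(2,4) _ anti] Cons.prems x by auto
    moreover have "act_word M xs v \<noteq> 0"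
      using Cons.prems act_zero[OF ab] by (auto simp: x)
    ultimately show ?case using Cons.IH x by simp
  qed simp
  then have "length xs = card (set xs)" by (simp add: distinct_card)
  also have "\<dots> \<le> card T" using assms(1,3) by (intro card_mono) auto
  finally show ?thesis .
qed

end

text \<open>For this \<open>g\<close> the letters of positive degree are odd lowering operators, which generate an
  exterior algebra; only words without repetitions contribute.\<close>

lemma (in graded_generation) finite_odd_generation:
  assumes g: "g = (\<lambda>a. if a \<le> m then 0 else 1)" and "finite S" "finite G" "Y = span G"
  shows "\<exists>G'. finite G' \<and> G' \<subseteq> carr M \<and>
    span {act_word M xs y |xs y. xs \<in> lists S \<and> y \<in> Y} = span G'"
proof -
  have fin: "finite F" using finite_subset[OF F_subset assms(2)] .
  have anti: "act M a b (act M c d v) = - act M c d (act M a b v)"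
    if "(a,b) \<in> F" "(c,d) \<in> F" "v \<in> carr M" for a b c d v
  proof -
    have "b \<le> m" "m < a" "d \<le> m" "m < c"
      using that by (auto simp: positive_letters_def g split: if_splits)
    then show ?thesis
      using act_commute[of a b c d v] that F_subset by (auto simp: par_def)
  qed
  have G: "G \<subseteq> carr M" using span_superset assms(4) Y_in_carr by blast
  define G' where "G' = (\<lambda>(xs,y). act_word M xs y) ` ({xs. set xs \<subseteq> F \<and> length xs \<le> card F} \<times> G)"
  have "finite G'"
    unfolding G'_def using finite_lists_length_le[OF fin] assms(3) by simp
  moreover have G'_gens: "G' \<subseteq> {act_word M xs y |xs y. xs \<in> lists F \<and> y \<in> Y}"
    unfolding G'_def assms(4) using span_base[of _ G] by (auto simp: in_lists_conv_set)
  moreover have "{act_word M xs y |xs y. xs \<in> lists F \<and> y \<in> Y} \<subseteq> carr M"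
    using act_word_in_carr lists_F_subset Y_in_carr by blast
  moreover have "{act_word M xs y |xs y. xs \<in> lists F \<and> y \<in> Y} \<subseteq> span G'"
  proof
    fix x assume "x \<in> {act_word M xs y |xs y. xs \<in> lists F \<and> y \<in> Y}"
    then obtain xs y where xs: "xs \<in> lists F" "y \<in> span G" and x: "x = act_word M xs y"
      using assms(4) by blast
    have xsS: "xs \<in> lists S" using xs lists_F_subset by blast
    show "x \<in> span G'"
      unfolding x
    proof (rule act_word_on_span[OF xs(2) xsS G subspace_span])
      fix z assume z: "z \<in> G"
      show "act_word M xs z \<in> span G'"
      proof (cases "act_word M xs z = 0")
        case True
        then show ?thesis by (simp add: span_zero)
      next
        case False
        have "length xs \<le> card F"
          using anticommuting_word_bound[OF xs(1) F_subset fin _ False anti] z G by blast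
        then have "act_word M xs z \<in> G'"
          unfolding G'_def using xs(1) z by (intro image_eqI[of _ _ "(xs,z)"]) auto
        then show ?thesis by (rule span_base)
      qed
    qed
  qed
  ultimately have "span {act_word M xs y |xs y. xs \<in> lists F \<and> y \<in> Y} = span G'" "G' \<subseteq> carr M"
    unfolding span_eq using order.trans[OF _ span_superset] by simp_all
  then show ?thesis
    unfolding span_words_eq using \<open>finite G'\<close> by (intro exI[of _ G'] conjI)
qed

text \<open>A word in lowering operators that does not kill the highest weight vector produces a weight
  vector.  Its weight is bounded by the Casimir eigenvalue, and the weight determines the degree of the word for the
  grading \<open>g a = a\<close>, which is at least its length.  Hence finitely many words suffice.\<close>

lemma (in hermitian_smod) finite_even_generation:
  assumes S: "finite S" "\<And>a b. (a,b) \<in> S \<Longrightarrow> (b,a) \<in> S"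
      "\<And>a b c. (a,b) \<in> S \<Longrightarrow> (b,c) \<in> S \<Longrightarrow> (a,c) \<in> S"
    and even: "\<And>a b. (a,b) \<in> S \<Longrightarrow> epar m a b = 0"
    and adjoint: "\<And>a b v w. (a,b) \<in> S \<Longrightarrow> v \<in> carr M \<Longrightarrow> w \<in> carr M \<Longrightarrow> h (act M a b v) w = h v (act M b a w)"
    and v: "v \<in> carr M" "\<And>a. (a,a) \<in> S \<Longrightarrow> act M a a v = scl M (\<Lambda> a) v"
      "\<And>a b. (a,b) \<in> S \<Longrightarrow> a < b \<Longrightarrow> act M a b v = 0"
  shows "\<exists>G. finite G \<and> G \<subseteq> carr M \<and> span {act_word M xs v |xs. xs \<in> lists S} = span G"
proof -
  let ?I = "{a. (a,a) \<in> S}"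
  have act_line: "act M a b (scl M k v) = scl M k (act M a b v)" if "(a,b) \<in> S" for a b k
    using that v(1) by (simp add: act_scale)
  interpret graded_generation m S M int "span {v}"
  proof unfold_locales
    show "span {v} \<subseteq> carr M" using v(1) by (intro span_minimal subspace_carr) simp
    show "act M a b y \<in> span {v}" if "(a,b) \<in> S" "int a = int b" "y \<in> span {v}" for a b y
      using that v(2) by (auto simp: span_singleton act_line)
    show "act M a b y = 0" if "(a,b) \<in> S" "int a < int b" "y \<in> span {v}" for a b y
      using that v(3) by (auto simp: span_singleton act_line)
  qed (use S(3) in blast, simp)
  have "\<exists>c. casimir v = scl M c v"
    by (rule casimir_highest_weight) (fact S(2) S(3) even v)+
  then obtain c where cv: "casimir v = scl M c v" ..
  have c: "casimir (act_word M xs v) = scl M c (act_word M xs v)" if "xs \<in> lists S" for xs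
    using that
  proof (induction rule: lists.induct)
    case (Cons x xs)
    obtain a b where x: "x = (a,b)" by (cases x)
    have "act_word M xs v \<in> carr M" using act_word_in_carr Cons.hyps(2) v(1) by blast
    then have "act M a b (casimir (act_word M xs v)) = casimir (act M a b (act_word M xs v))"
      using Cons.hyps(1) by (intro casimir_commute S(1) even) (auto simp: x intro: S(2,3))
    then show ?case
      using Cons act_word_in_carr[OF Cons.hyps(2) v(1)] by (auto simp: x act_scale)
  qed (simp add: cv)
  \<comment> \<open>The eigenvalue of the Euler operator for the grading \<open>g a = a\<close> at the highest weight vector; the degree of a word is the
    difference between its Euler eigenvalue and \<open>c0\<close>.\<close>
  define c0 where "c0 = (\<Sum>a\<in>?I. of_int (int a) * \<Lambda> a)"
  have euler_weight: "euler int w = scl M (\<Sum>a\<in>?I. of_int (int a) * \<mu> a) w"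
    if "\<forall>a. (a,a) \<in> S \<longrightarrow> act M a a w = scl M (\<mu> a) w" for w \<mu>
    unfolding euler_def using that by (simp add: scale_sum_left)
  have euler_Y: "euler int y = scl M c0 y" if "y \<in> span {v}" for y
  proof (rule euler_weight[where \<mu> = \<Lambda>, folded c0_def])
    show "\<forall>a. (a,a) \<in> S \<longrightarrow> act M a a y = scl M (\<Lambda> a) y"
      using that v(2) by (auto simp: span_singleton act_line mult.commute)
  qed
  define K where "K = nat \<lceil>(\<Sum>a\<in>?I. real a * sqrt (cmod c)) + cmod c0\<rceil>"
  have bound: "length xs \<le> K" if xs: "xs \<in> lists F" "act_word M xs v \<noteq> 0" for xs
  proof -
    let ?w = "act_word M xs v"
    have xsS: "xs \<in> lists S" using xs(1) lists_F_subset by blast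
    have w: "?w \<in> carr M" using act_word_in_carr[OF xsS v(1)] .
    obtain \<mu> where \<mu>: "\<forall>a. (a,a) \<in> S \<longrightarrow> act M a a ?w = scl M (\<mu> a) ?w"
      using act_word_weight[OF xsS v(1), of \<Lambda>] v(2) by blast
    have "v \<in> span {v}" by (simp add: span_base)
    then have "?w \<in> piece (word_degree int xs)" using word_in_piece xs(1) by blast
    then have "euler int ?w = scl M (c0 + of_int (word_degree int xs)) ?w"
      by (intro euler_piece S(1) euler_Y) (auto intro: S(2))
    then have "scl M (c0 + of_int (word_degree int xs)) ?w = scl M (\<Sum>a\<in>?I. of_int (int a) * \<mu> a) ?w"
      using euler_weight[OF \<mu>] by (simp only:)
    then have deg: "of_int (word_degree int xs) = (\<Sum>a\<in>?I. of_int (int a) * \<mu> a) - c0"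
      using xs(2) unfolding scale_cancel_right by (simp add: algebra_simps)
    have \<mu>_bound: "cmod (\<mu> a) \<le> sqrt (cmod c)" if "a \<in> ?I" for a
    proof (rule real_le_rsqrt)
      show "(cmod (\<mu> a))\<^sup>2 \<le> cmod c"
        by (rule casimir_bounds_weights[where w = ?w and a = a])
          (fact S(1) S(2) adjoint w xs(2) c[OF xsS] | use that \<mu> in simp)+
    qed
    have "real (length xs) \<le> real_of_int (word_degree int xs)"
      using length_le_word_degree[of xs S int] xs(1) by (simp add: positive_letters_def)
    also have "\<dots> \<le> cmod (of_int (word_degree int xs))"
      by simp
    also have "\<dots> \<le> cmod (\<Sum>a\<in>?I. of_int (int a) * \<mu> a) + cmod c0"
      unfolding deg by (rule norm_triangle_ineq4)
    also have "cmod (\<Sum>a\<in>?I. of_int (int a) * \<mu> a) \<le> (\<Sum>a\<in>?I. real a * sqrt (cmod c))"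
      using \<mu>_bound by (intro sum_norm_le) (auto simp: norm_mult intro: mult_left_mono)
    finally show ?thesis unfolding K_def by linarith
  qed
  have finF: "finite F" using finite_subset[OF F_subset S(1)] .
  define G where "G = (\<lambda>xs. act_word M xs v) ` {xs. set xs \<subseteq> F \<and> length xs \<le> K}"
  have "finite G"
    unfolding G_def using finite_lists_length_le[OF finF] by simp
  moreover have G_gens: "G \<subseteq> {act_word M xs v |xs. xs \<in> lists S}"
    unfolding G_def using F_subset by (auto simp: in_lists_conv_set)
  moreover have "{act_word M xs v |xs. xs \<in> lists S} \<subseteq> carr M"
    using act_word_in_carr v(1) by blast
  moreover have "{act_word M xs v |xs. xs \<in> lists S} \<subseteq> span G"
  proof -
    have "{act_word M xs v |xs. xs \<in> lists S} \<subseteq> span {act_word M xs y |xs y. xs \<in> lists S \<and> y \<in> span {v}}"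
      using span_base[of v "{v}"] by (auto intro!: span_base)
    also have "\<dots> = span {act_word M xs y |xs y. xs \<in> lists F \<and> y \<in> span {v}}"
      by (rule span_words_eq)
    also have "\<dots> \<subseteq> span G"
    proof (rule span_minimal)
      show "{act_word M xs y |xs y. xs \<in> lists F \<and> y \<in> span {v}} \<subseteq> span G"
      proof
        fix x assume "x \<in> {act_word M xs y |xs y. xs \<in> lists F \<and> y \<in> span {v}}"
        then obtain xs k where xs: "xs \<in> lists F" and x: "x = act_word M xs (scl M k v)"
          by (auto simp: span_singleton)
        have x': "x = scl M k (act_word M xs v)"
          unfolding x using act_word_scale xs lists_F_subset v(1) by blast
        show "x \<in> span G"
        proof (cases "act_word M xs v = 0")
          case True
          then show ?thesis by (simp add: x' span_zero)
        next
          case False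
          then have "act_word M xs v \<in> G"
            unfolding G_def using xs bound by auto
          then show ?thesis unfolding x' by (intro span_scale span_base)
        qed
      qed
    qed simp
    finally show ?thesis .
  qed
  ultimately have "span {act_word M xs v |xs. xs \<in> lists S} = span G" "G \<subseteq> carr M"
    unfolding span_eq using order.trans[OF _ span_superset] by simp_all
  then show ?thesis
    using \<open>finite G\<close> by (intro exI[of _ G] conjI)
qed

section \<open>Homomorphisms\<close>

context smod
begin

lemma linear_map_zero:
  assumes "vector_space s'" "linear_on_carr M s' f"
  shows "f 0 = 0"
proof -
  interpret target: vector_space s' by fact
  have "f (scl M 0 0) = s' 0 (f 0)"
    using assms(2) carr_closed(1) unfolding linear_on_carr_def by blast
  then show ?thesis by simp
qed

lemma linear_map_span:
  assumes s': "vector_space s'" and f: "linear_on_carr M s' f"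
    and G: "G \<subseteq> carr M" and W: "module.subspace s' W" "\<And>x. x \<in> G \<Longrightarrow> f x \<in> W" and v: "v \<in> span G"
  shows "f v \<in> W"
proof -
  interpret target: vector_space s' by fact
  have "v \<in> carr M \<and> f v \<in> W"
    using v
  proof (induction rule: span_induct_alt)
    case base
    show ?case using linear_map_zero[OF s' f] carr_closed(1) target.subspace_0[OF W(1)] by simp
  next
    case (step c x y)
    then have "x \<in> carr M" "f x \<in> W" using G W(2) by auto
    then show ?case
      using step.IH f carr_closed target.subspace_add[OF W(1)] target.subspace_scale[OF W(1)]
      unfolding linear_on_carr_def by simp
  qed
  then show ?thesis ..
qed

lemma linear_map_diff:
  assumes f: "linear_on_carr M s' f" and vw: "v \<in> carr M" "w \<in> carr M"
  shows "f (v - w) = f v - f w"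
proof -
  have "f (v - w + w) = f (v - w) + f w"
    using f vw carr_closed(3)[OF vw] unfolding linear_on_carr_def by blast
  then show ?thesis by (simp add: eq_diff_eq)
qed

lemma linear_map_sum:
  assumes s': "vector_space s'" and f: "linear_on_carr M s' f"
  shows "(\<And>i. i \<in> I \<Longrightarrow> x i \<in> carr M) \<Longrightarrow> f (sum x I) = (\<Sum>i\<in>I. f (x i))"
proof (induction I rule: infinite_finite_induct)
  case (insert i F)
  then have "x i \<in> carr M" "sum x F \<in> carr M"
    using subspace_sum[OF subspace_carr, of F x] by auto
  then show ?case using insert f unfolding linear_on_carr_def by simp
qed (simp_all add: linear_map_zero[OF s' f])

lemma hom_act_word:
  assumes "\<And>a b v. (a,b) \<in> S \<Longrightarrow> v \<in> carr M \<Longrightarrow> f (act M a b v) = act M' a b (f v)"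
    and "v \<in> carr M" "xs \<in> lists S"
  shows "f (act_word M xs v) = act_word M' xs (f v)"
  using assms(3)
proof (induction rule: lists.induct)
  case (Cons x xs)
  obtain a b where x: "x = (a,b)" by (cases x)
  have "act_word M xs v \<in> carr M" using act_word_in_carr Cons.hyps(2) assms(2) by blast
  then show ?case using Cons assms(1) by (simp add: x)
qed simp

end

section \<open>The simple quotient of a parabolically induced module\<close>

text \<open>In this grading \<open>\<kk>\<^sub>-\<close>, \<open>\<kk>\<close>, \<open>\<kk>\<^sub>+\<close> have degrees 1, 0, -1.\<close>

definition block_degree :: "nat \<Rightarrow> nat \<Rightarrow> int" where
  "block_degree p a = (if a \<le> p then 0 else 1)"

text \<open>What the argument retains from the construction of \<open>L\<close> as a quotient of the induced module: \<open>B\<close> is the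
  image of \<open>L\<^sub>0(\<Lambda>)\<close>, and \<open>v0\<close> that of its highest weight vector.\<close>

locale simple_parabolic_quotient =
  fixes p q n :: nat and \<Lambda> :: "nat \<Rightarrow> complex" and L :: "'w::ab_group_add supermod"
    and B :: "'w set" and v0 :: 'w
  assumes simple: "simple_mod (p+q) (gl_idx (p+q+n)) L"
    and B_generated: "B = module.span (scl L) {act_word L xs v0 |xs. xs \<in> lists (k_idx p (p+q+n))}"
    and B_kplus: "\<And>a b y. (a,b) \<in> kplus_idx p (p+q+n) \<Longrightarrow> y \<in> B \<Longrightarrow> act L a b y = 0"
    and generated: "carr L = module.span (scl L) {act_word L xs y |xs y. xs \<in> lists (gl_idx (p+q+n)) \<and> y \<in> B}"
    and v0_even: "v0 \<in> homog L 0" and v0_nonzero: "v0 \<noteq> 0"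
    and v0_weight: "\<And>a. a \<in> {1..p+q+n} \<Longrightarrow> act L a a v0 = scl L (\<Lambda> a) v0"
    and v0_raising: "\<And>a b. a \<in> {1..p+q+n} \<Longrightarrow> b \<in> {1..p+q+n} \<Longrightarrow> a < b \<Longrightarrow> act L a b v0 = 0"

text \<open>The composite of \<open>\<iota>\<close> and \<open>\<pi>\<close> is a homomorphism of \<open>\<kk>\<close>-modules whose image is annihilated
  by \<open>\<kk>\<^sub>+\<close> and generates \<open>L\<close>.  In particular, it cannot kill the highest weight vector, as otherwise \<open>L\<close> would
  vanish.\<close>

lemma simple_parabolic_quotientI:
  fixes L0 :: "'u::ab_group_add supermod" and V :: "'v::ab_group_add supermod"
    and L :: "'w::ab_group_add supermod"
  assumes quot: "is_simple_quotient_of_induced p q n \<Lambda> L0 V \<iota> L \<pi>"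
  shows "\<exists>v0. simple_parabolic_quotient p q n \<Lambda> L (\<pi> ` \<iota> ` carr L0) v0"
proof -
  let ?m = "p + q" and ?N = "p + q + n"
  let ?k = "k_idx p ?N" and ?kp = "kplus_idx p ?N" and ?gl = "gl_idx ?N"
  let ?E = "extend_by_zero ?kp L0"
  define j where "j = \<pi> \<circ> \<iota>"
  have hw: "simple_highest_weight_mod ?m ?k \<Lambda> L0"
    and ind: "is_induced ?m ?gl (?k \<union> ?kp) ?E V \<iota>"
    and simple: "simple_mod ?m ?gl L" and \<pi>: "even_hom ?gl V L \<pi>" "\<pi> ` carr V = carr L"
    using quot unfolding is_simple_quotient_of_induced_def Let_def by simp_all
  interpret L0: smod ?m ?k L0
    using hw unfolding simple_highest_weight_mod_def simple_mod_def by unfold_locales simp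
  interpret V: smod ?m ?gl V
    using ind unfolding is_induced_def by unfold_locales simp
  interpret L: smod ?m ?gl L
    using simple unfolding simple_mod_def by unfold_locales simp
  have \<iota>: "even_hom (?k \<union> ?kp) ?E V \<iota>"
    and eval: "tensor_eval V \<iota> ` formal_tensors ?gl ?E = carr V"
    using ind unfolding is_induced_def by simp_all
  have E: "carr ?E = carr L0" "homog ?E = homog L0" "scl ?E = scl L0"
    by (simp_all add: extend_by_zero_def carr_def)
  have disj: "(a,b) \<notin> ?kp" if "(a,b) \<in> ?k" for a b
    using that by (auto simp: k_idx_def kplus_idx_def)
  have E_act: "act ?E a b u = (if (a,b) \<in> ?kp then 0 else act L0 a b u)" for a b u
    by (simp add: extend_by_zero_def)
  have sub: "?k \<subseteq> ?gl" "?kp \<subseteq> ?gl"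
    by (auto simp: k_idx_def kplus_idx_def gl_idx_def)
  have \<iota>_carr: "\<iota> u \<in> carr V" if "u \<in> carr L0" for u
    using that
  proof (induction rule: L0.homog_induct)
    case (homog s v)
    then show ?case using \<iota> V.homog_in_carr unfolding even_hom_def E by blast
  next
    case (add v w)
    then show ?case using \<iota> V.carr_closed(2) unfolding even_hom_def linear_on_carr_def E by simp
  qed
  have \<pi>_lin: "linear_on_carr V (scl L) \<pi>" using \<pi>(1) by (simp add: even_hom_def)
  have j_lin: "linear_on_carr L0 (scl L) j"
    using \<iota> \<pi>_lin \<iota>_carr unfolding even_hom_def linear_on_carr_def E j_def by simp
  have \<pi>_act: "\<pi> (act V a b v) = act L a b (\<pi> v)" if "(a,b) \<in> ?gl" "v \<in> carr V" for a b v
    using \<pi>(1) that unfolding even_hom_def by blast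
  have \<iota>_act: "\<iota> (act ?E a b u) = act V a b (\<iota> u)" if "(a,b) \<in> ?k \<union> ?kp" "u \<in> carr L0" for a b u
    using \<iota> that unfolding even_hom_def E by blast
  have j_act: "j (act L0 a b u) = act L a b (j u)" if "(a,b) \<in> ?k" "u \<in> carr L0" for a b u
    using \<iota>_act[of a b u] \<pi>_act[of a b "\<iota> u"] that disj sub \<iota>_carr
    by (auto simp: E_act j_def)
  have j_kplus: "act L a b (j u) = 0" if "(a,b) \<in> ?kp" "u \<in> carr L0" for a b u
    using \<iota>_act[of a b u] \<pi>_act[of a b "\<iota> u"] that sub \<iota>_carr
      L0.linear_map_zero[OF L.vector_space_axioms j_lin]
    by (auto simp: E_act j_def)
  have j_carr: "j u \<in> carr L" if "u \<in> carr L0" for u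
    using \<iota>_carr[OF that] \<pi>(2) by (auto simp: j_def)
  obtain u0 where u0: "u0 \<in> homog L0 0" "u0 \<noteq> 0" "\<And>a. (a,a) \<in> ?k \<Longrightarrow> act L0 a a u0 = scl L0 (\<Lambda> a) u0"
    "L0.span {act_word L0 xs u0 |xs. xs \<in> lists ?k} = carr L0"
    "\<And>a b. (a,b) \<in> ?k \<Longrightarrow> a < b \<Longrightarrow> act L0 a b u0 = 0"
    using hw unfolding simple_highest_weight_mod_def even_weight_vector_def generates_def by blast
  have u0c: "u0 \<in> carr L0" using u0(1) L0.homog_in_carr by blast
  let ?B = "\<pi> ` \<iota> ` carr L0"
  have B_eq: "?B = j ` carr L0" by (simp add: j_def image_image)
  have j_word: "j (act_word L0 xs u0) = act_word L xs (j u0)" if "xs \<in> lists ?k" for xs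
    by (rule L0.hom_act_word[OF j_act u0c that])
  have B: "?B = L.span {act_word L xs (j u0) |xs. xs \<in> lists ?k}" (is "_ = L.span ?G")
  proof (rule antisym)
    show "?B \<subseteq> L.span ?G"
      unfolding B_eq
    proof (rule image_subsetI)
      fix u assume u: "u \<in> carr L0"
      show "j u \<in> L.span ?G"
      proof (rule L0.linear_map_span[OF L.vector_space_axioms j_lin])
        show "{act_word L0 xs u0 |xs. xs \<in> lists ?k} \<subseteq> carr L0"
          using L0.act_word_in_carr u0c by blast
        show "u \<in> L0.span {act_word L0 xs u0 |xs. xs \<in> lists ?k}" using u0(4) u by simp
        show "j x \<in> L.span ?G" if "x \<in> {act_word L0 xs u0 |xs. xs \<in> lists ?k}" for x
          using that j_word by (intro L.span_base) auto
      qed simp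
    qed
    have "L.subspace ?B"
    proof (rule L.subspaceI)
      show "0 \<in> ?B"
        unfolding B_eq using L0.linear_map_zero[OF L.vector_space_axioms j_lin] L0.carr_closed(1)
        by (metis imageI)
      show "x + y \<in> ?B" if "x \<in> ?B" "y \<in> ?B" for x y
      proof -
        obtain u w where uw: "u \<in> carr L0" "w \<in> carr L0" "x = j u" "y = j w"
          using \<open>x \<in> ?B\<close> \<open>y \<in> ?B\<close> unfolding B_eq by auto
        then have "x + y = j (u + w)" using j_lin unfolding linear_on_carr_def by simp
        then show ?thesis unfolding B_eq using L0.carr_closed(2)[OF uw(1,2)] by simp
      qed
      show "scl L c x \<in> ?B" if "x \<in> ?B" for c x
      proof -
        obtain u where u: "u \<in> carr L0" "x = j u"
          using \<open>x \<in> ?B\<close> unfolding B_eq by auto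
        then have "scl L c x = j (scl L0 c u)" using j_lin unfolding linear_on_carr_def by simp
        then show ?thesis unfolding B_eq using L0.carr_closed(5)[OF u(1)] by simp
      qed
    qed
    moreover have "?G \<subseteq> ?B"
    proof
      fix x assume "x \<in> ?G"
      then obtain xs where xs: "xs \<in> lists ?k" "x = act_word L xs (j u0)" by blast
      then have "x = j (act_word L0 xs u0)" using j_word by simp
      then show "x \<in> ?B" unfolding B_eq using L0.act_word_in_carr[OF xs(1) u0c] by simp
    qed
    ultimately show "L.span ?G \<subseteq> ?B" by (intro L.span_minimal)
  qed
  have gen: "carr L = L.span {act_word L xs y |xs y. xs \<in> lists ?gl \<and> y \<in> ?B}" (is "_ = L.span ?H")
  proof (rule antisym)
    show "L.span ?H \<subseteq> carr L"
    proof (rule L.span_minimal[OF _ L.subspace_carr])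
      show "?H \<subseteq> carr L"
        using L.act_word_in_carr j_carr unfolding B_eq by blast
    qed
    show "carr L \<subseteq> L.span ?H"
    proof
      fix x assume "x \<in> carr L"
      then obtain f where f: "f \<in> formal_tensors ?gl ?E" "x = \<pi> (tensor_eval V \<iota> f)"
        using \<pi>(2) eval by (metis imageE)
      have keys: "xs \<in> lists ?gl" "u \<in> carr L0" if "(xs,u) \<in> Poly_Mapping.keys f" for xs u
        using f(1) that unfolding formal_tensors_def E by auto
      have term_carr: "scl V c (act_word V xs (\<iota> u)) \<in> carr V"
        if "(xs,u) \<in> Poly_Mapping.keys f" for c xs u
        using keys[OF that] V.act_word_in_carr \<iota>_carr V.carr_closed(5) by simp
      have "x = (\<Sum>i\<in>Poly_Mapping.keys f. \<pi> (case i of (xs,u) \<Rightarrow>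
            scl V (Poly_Mapping.lookup f (xs,u)) (act_word V xs (\<iota> u))))"
        unfolding f(2) tensor_eval_def
        by (rule V.linear_map_sum[OF L.vector_space_axioms \<pi>_lin]) (use term_carr in auto)
      also have "\<dots> \<in> L.span ?H"
      proof (rule L.span_sum)
        fix i assume i: "i \<in> Poly_Mapping.keys f"
        obtain xs u where xsu: "i = (xs,u)" by (cases i)
        have xs: "xs \<in> lists ?gl" and u: "u \<in> carr L0" using keys i xsu by auto
        have "\<pi> (scl V c (act_word V xs (\<iota> u))) = scl L c (act_word L xs (j u))" for c
          using \<pi>_lin V.act_word_in_carr[OF xs \<iota>_carr[OF u]] V.hom_act_word[OF \<pi>_act \<iota>_carr[OF u] xs]
          unfolding linear_on_carr_def by (simp add: j_def)
        moreover have "act_word L xs (j u) \<in> ?H" unfolding B_eq using xs u by blast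
        ultimately show "\<pi> (case i of (xs,u) \<Rightarrow>
            scl V (Poly_Mapping.lookup f (xs,u)) (act_word V xs (\<iota> u))) \<in> L.span ?H"
          unfolding xsu by (simp add: L.span_scale L.span_base)
      qed
      finally show "x \<in> L.span ?H" .
    qed
  qed
  have "simple_parabolic_quotient p q n \<Lambda> L ?B (j u0)"
  proof
    show "simple_mod ?m ?gl L" by fact
    show "?B = L.span {act_word L xs (j u0) |xs. xs \<in> lists ?k}" by (rule B)
    show "carr L = L.span {act_word L xs y |xs y. xs \<in> lists ?gl \<and> y \<in> ?B}" by (rule gen)
    show "act L a b y = 0" if "(a,b) \<in> ?kp" "y \<in> ?B" for a b y
      using j_kplus that unfolding B_eq by blast
    have "\<iota> u0 \<in> homog V 0" using \<iota> u0(1) unfolding even_hom_def E by blast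
    then show "j u0 \<in> homog L 0" using \<pi>(1) unfolding even_hom_def j_def by auto
    show "act L a a (j u0) = scl L (\<Lambda> a) (j u0)" if "a \<in> {1..?N}" for a
    proof -
      have "(a,a) \<in> ?k" using that by (auto simp: k_idx_def)
      then show ?thesis
        using j_act[of a a u0] u0(3)[of a] j_lin u0c unfolding linear_on_carr_def by simp
    qed
    show "act L a b (j u0) = 0" if "a \<in> {1..?N}" "b \<in> {1..?N}" "a < b" for a b
    proof (cases "(a,b) \<in> ?k")
      case True
      then show ?thesis
        using j_act[OF True u0c] u0(5)[OF True that(3)] L0.linear_map_zero[OF L.vector_space_axioms j_lin] by simp
    next
      case False
      then have "(a,b) \<in> ?kp" using that by (auto simp: k_idx_def kplus_idx_def)
      then show ?thesis using j_kplus u0c by blast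
    qed
    show "j u0 \<noteq> 0"
    proof
      assume "j u0 = 0"
      then have "act_word L xs (j u0) = 0" if "xs \<in> lists ?k" for xs
        using L.act_word_zero subsetD[OF lists_mono[OF sub(1)] that] by simp
      then have "L.span ?G \<subseteq> {0}" by (intro L.span_minimal) auto
      then have "?B \<subseteq> {0}" using B by simp
      then have y: "y = 0" if "y \<in> ?B" for y using that by blast
      have "act_word L xs y = 0" if "xs \<in> lists ?gl" "y \<in> ?B" for xs y
        unfolding y[OF that(2)] by (rule L.act_word_zero[OF that(1)])
      then have "?H \<subseteq> {0}" by blast
      then have "L.span ?H \<subseteq> {0}" by (intro L.span_minimal) auto
      then have "carr L = {0}" using gen L.carr_closed(1) by auto
      then show False using simple by (simp add: simple_mod_def)
    qed
  qed
  then show ?thesis by blast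
qed

context simple_parabolic_quotient
begin

abbreviation gl where "gl \<equiv> gl_idx (p+q+n)"

abbreviation levi where "levi \<equiv> k_idx p (p+q+n)"

sublocale smod "p+q" "gl" L
  using simple by unfold_locales (simp add: simple_mod_def)

lemma finite_gl: "finite (gl)"
  by (simp add: gl_idx_def)

lemma gl_sym: "(a,b) \<in> gl \<Longrightarrow> (b,a) \<in> gl"
  by (auto simp: gl_idx_def)

lemma gl_iff: "(a,b) \<in> gl \<longleftrightarrow> a \<in> {1..p+q+n} \<and> b \<in> {1..p+q+n}"
  by (auto simp: gl_idx_def)

lemma k_in_gl: "levi \<subseteq> gl"
  by (auto simp: k_idx_def gl_idx_def)

lemma v0_in_carr: "v0 \<in> carr L"
  using v0_even homog_in_carr by blast

lemma B_words_in_carr: "{act_word L xs v0 |xs. xs \<in> lists (levi)} \<subseteq> carr L"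
  using act_word_in_carr v0_in_carr lists_mono[OF k_in_gl] by blast

lemma B_in_carr: "B \<subseteq> carr L"
  unfolding B_generated using B_words_in_carr subspace_carr by (rule span_minimal)

lemma subspace_B: "subspace B"
  unfolding B_generated by simp

lemma k_act_B:
  assumes "(a,b) \<in> levi" "y \<in> B"
  shows "act L a b y \<in> B"
proof (rule act_on_span[OF assms(2)[unfolded B_generated] _ B_words_in_carr subspace_B])
  show "(a,b) \<in> gl" using assms(1) k_in_gl by blast
  fix x assume "x \<in> {act_word L xs v0 |xs. xs \<in> lists (levi)}"
  then obtain xs where "xs \<in> lists (levi)" "x = act_word L xs v0" by blast
  then have "act L a b x = act_word L ((a,b) # xs) v0" "(a,b) # xs \<in> lists (levi)"
    using assms(1) by simp_all
  then have "act L a b x \<in> {act_word L xs v0 |xs. xs \<in> lists (levi)}" by blast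
  then show "act L a b x \<in> B" unfolding B_generated by (rule span_base)
qed

lemma block_degree_k: "(a,b) \<in> levi \<longleftrightarrow> (a,b) \<in> gl \<and> block_degree p a = block_degree p b"
  by (auto simp: k_idx_def gl_idx_def block_degree_def)

lemma block_degree_kplus: "(a,b) \<in> kplus_idx p (p+q+n) \<longleftrightarrow> (a,b) \<in> gl \<and> block_degree p a < block_degree p b"
  by (auto simp: kplus_idx_def gl_idx_def block_degree_def)

sublocale graded_generation "p+q" "gl" L "block_degree p" B
proof unfold_locales
  show "act L a b y \<in> B" if "(a,b) \<in> gl" "block_degree p a = block_degree p b" "y \<in> B" for a b y
    using that k_act_B block_degree_k by blast
  show "act L a b y = 0" if "(a,b) \<in> gl" "block_degree p a < block_degree p b" "y \<in> B" for a b y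
    using that B_kplus block_degree_kplus by blast
qed (auto simp: gl_idx_def subspace_B B_in_carr[THEN subsetD])

lemma positive_letters_kminus: "positive_letters (gl) (block_degree p) = kminus_idx p (p+q+n)"
  by (auto simp: positive_letters_def kminus_idx_def gl_idx_def block_degree_def split: if_splits)

lemma word_degree_kminus:
  "xs \<in> lists (kminus_idx p (p+q+n)) \<Longrightarrow> word_degree (block_degree p) xs = int (length xs)"
proof (induction rule: lists.induct)
  case (Cons x xs)
  then show ?case by (cases x) (auto simp: block_degree_def kminus_idx_def)
qed simp

lemma degree_part_piece: "degree_part p (p+q+n) L B k = piece (int k)"
proof -
  have "{act_word L xs v |xs v. xs \<in> lists (kminus_idx p (p+q+n)) \<and> length xs = k \<and> v \<in> B}
      = piece_gens (int k)"
    unfolding piece_gens_def positive_letters_kminus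
    by (rule Collect_cong) (metis word_degree_kminus of_nat_eq_iff)
  then show ?thesis unfolding degree_part_def piece_def by simp
qed

lemma carr_span_pieces: "carr L = span (\<Union>k. piece (int k))"
proof (rule antisym)
  show "span (\<Union>k. piece (int k)) \<subseteq> carr L"
    using piece_in_carr by (intro span_minimal subspace_carr) blast
  show "carr L \<subseteq> span (\<Union>k. piece (int k))"
    unfolding generated span_words_eq
  proof (intro span_minimal subspace_span subsetI)
    fix x assume "x \<in> {act_word L xs y |xs y. xs \<in> lists F \<and> y \<in> B}"
    then obtain xs y where xs: "xs \<in> lists F" "y \<in> B" "x = act_word L xs y" by blast
    then have "x \<in> piece (int (length xs))"
      using word_in_piece word_degree_kminus positive_letters_kminus by simp
    then show "x \<in> span (\<Union>k. piece (int k))" by (intro span_base) blast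
  qed
qed

lemma carr_bounded_degree:
  assumes "v \<in> carr L"
  shows "\<exists>K. v \<in> span (\<Union>k<K. piece (int k))"
proof -
  have "v \<in> span (\<Union>k. piece (int k))" using assms carr_span_pieces by simp
  then show ?thesis
  proof (induction rule: span_induct_alt)
    case base
    show ?case using span_zero by blast
  next
    case (step c x y)
    then obtain k where k: "x \<in> piece (int k)" by blast
    obtain K where K: "y \<in> span (\<Union>k<K. piece (int k))" using step.IH by blast
    have "x \<in> span (\<Union>j<max K (Suc k). piece (int j))"
      using k by (intro span_base) (auto intro!: bexI[of _ k])
    moreover have "y \<in> span (\<Union>j<max K (Suc k). piece (int j))"
      by (rule subsetD[OF span_mono K]) force
    ultimately show ?case
      by (intro exI[of _ "max K (Suc k)"] span_add span_scale)
  qed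
qed

section \<open>The graded dual as a supermodule\<close>

text \<open>The functionals that make up the graded dual, regardless of parity.\<close>

definition finite_functional :: "('w \<Rightarrow> complex) \<Rightarrow> bool" where
  "finite_functional f \<longleftrightarrow> linear_on_carr L (*) f \<and> (\<forall>v. v \<notin> carr L \<longrightarrow> f v = 0) \<and>
     (\<exists>K. \<forall>k\<ge>K. \<forall>v\<in>piece (int k). f v = 0)"

definition dual :: "('w \<Rightarrow> complex) supermod" where
  "dual = graded_dual p (p+q) (p+q+n) L B"

lemma scl_dual: "scl dual c f v = c * f v"
  by (simp add: dual_def graded_dual_def)

lemma homog_dual: "homog dual s = {f. finite_functional f \<and> (\<forall>v\<in>homog L (s+1). f v = 0)}"
  by (auto simp: dual_def graded_dual_def finite_functional_def degree_part_piece)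

lemma functional_lin:
  assumes "finite_functional f"
  shows "v \<in> carr L \<Longrightarrow> w \<in> carr L \<Longrightarrow> f (v + w) = f v + f w"
    "v \<in> carr L \<Longrightarrow> f (scl L c v) = c * f v"
    "v \<in> carr L \<Longrightarrow> w \<in> carr L \<Longrightarrow> f (v - w) = f v - f w"
    "f 0 = 0" "v \<notin> carr L \<Longrightarrow> f v = 0"
proof -
  have lin: "linear_on_carr L (*) f" and out: "\<And>v. v \<notin> carr L \<Longrightarrow> f v = 0"
    using assms by (auto simp: finite_functional_def)
  show add: "f (v + w) = f v + f w" if "v \<in> carr L" "w \<in> carr L" for v w
    using lin that by (simp add: linear_on_carr_def)
  show scale: "f (scl L c v) = c * f v" if "v \<in> carr L" for v c
    using lin that by (simp add: linear_on_carr_def)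
  show "v \<in> carr L \<Longrightarrow> w \<in> carr L \<Longrightarrow> f (v - w) = f v - f w"
    using add[of "v - w" w] carr_closed by simp
  show "f 0 = 0" using scale[of 0 0] carr_closed(1) by simp
  show "v \<notin> carr L \<Longrightarrow> f v = 0" by (rule out)
qed

lemma finite_functional_add:
  assumes "finite_functional f" "finite_functional f'"
  shows "finite_functional (f + f')"
proof -
  obtain K K' where "\<forall>k\<ge>K. \<forall>v\<in>piece (int k). f v = 0" "\<forall>k\<ge>K'. \<forall>v\<in>piece (int k). f' v = 0"
    using assms unfolding finite_functional_def by blast
  then have "\<forall>k\<ge>max K K'. \<forall>v\<in>piece (int k). (f + f') v = 0" by auto
  then show ?thesis
    using assms unfolding finite_functional_def linear_on_carr_def
    by (intro conjI exI[of _ "max K K'"]) (auto simp: algebra_simps)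
qed

lemma finite_functional_scale:
  assumes "finite_functional f"
  shows "finite_functional (scl dual c f)"
proof -
  obtain K where "\<forall>k\<ge>K. \<forall>v\<in>piece (int k). f v = 0"
    using assms unfolding finite_functional_def by blast
  then show ?thesis
    using assms unfolding finite_functional_def linear_on_carr_def
    by (intro conjI exI[of _ K]) (auto simp: scl_dual distrib_left)
qed

lemma finite_functional_zero: "finite_functional 0"
  unfolding finite_functional_def linear_on_carr_def by simp

lemma carr_dual_functional: "f \<in> carr dual \<Longrightarrow> finite_functional f"
  unfolding carr_def by (auto simp: homog_dual finite_functional_add)

lemma homog_dual_parity_comp:
  assumes "f \<in> homog dual s" "v \<in> carr L"
  shows "f (parity_comp L s v) = f v" "f (parity_comp L (s+1) v) = 0"
proof -
  have f: "finite_functional f" "\<And>v. v \<in> homog L (s+1) \<Longrightarrow> f v = 0"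
    using assms(1) by (auto simp: homog_dual)
  show 1: "f (parity_comp L (s+1) v) = 0"
    using f(2) parity_decomposition(1)[OF assms(2)] by blast
  have "f (v - parity_comp L s v) = 0"
    using f(2) parity_decomposition(2)[OF assms(2)] by blast
  then show "f (parity_comp L s v) = f v"
    using functional_lin(3)[OF f(1) assms(2) parity_comp_in_carr[OF assms(2)]] by simp
qed

text \<open>Only the component of parity s of \<open>act L a b v\<close> is seen by a functional of parity s.\<close>

lemma act_dual_homog:
  assumes "f \<in> homog dual s" "v \<in> carr L" "(a,b) \<in> gl"
  shows "act dual a b f v = - (koszul (epar (p+q) a b) s * f (act L a b v))"
proof -
  have x: "act L a b v \<in> carr L" using act_in_carr assms by blast
  have "(\<Sum>t\<in>{0,1}. koszul (epar (p+q) a b) t * f (parity_comp L t (act L a b v)))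
    = koszul (epar (p+q) a b) s * f (act L a b v)"
    using homog_dual_parity_comp[OF assms(1) x] by (cases s) simp_all
  then show ?thesis using assms(2) by (simp add: dual_def graded_dual_def)
qed

lemma act_dual_outside: "v \<notin> carr L \<Longrightarrow> act dual a b f v = 0"
  by (simp add: dual_def graded_dual_def)

lemma act_dual_add: "act dual a b (f + f') = act dual a b f + act dual a b f'"
  by (rule ext) (simp add: dual_def graded_dual_def algebra_simps)

lemma act_dual_scale: "act dual a b (scl dual c f) = scl dual c (act dual a b f)"
  by (rule ext) (simp add: dual_def graded_dual_def algebra_simps)

lemma act_dual_in_homog:
  assumes f: "f \<in> homog dual s" and ab: "(a,b) \<in> gl"
  shows "act dual a b f \<in> homog dual (epar (p+q) a b + s)"
proof -
  have ff: "finite_functional f" and f0: "\<And>v. v \<in> homog L (s+1) \<Longrightarrow> f v = 0"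
    using f by (auto simp: homog_dual)
  obtain K where K: "\<And>k v. k \<ge> K \<Longrightarrow> v \<in> piece (int k) \<Longrightarrow> f v = 0"
    using ff unfolding finite_functional_def by blast
  \<comment> \<open>A matrix unit lowers the degree by at most one.\<close>
  have "act dual a b f v = 0" if k: "k \<ge> Suc K" and v: "v \<in> piece (int k)" for k v
  proof -
    define j where "j = nat (block_degree p a - block_degree p b + int k)"
    have "j \<ge> K" "block_degree p a - block_degree p b + int k = int j"
      using k unfolding j_def block_degree_def by auto
    then have "f (act L a b v) = 0" using K act_piece[OF ab v] by simp
    then show ?thesis using act_dual_homog[OF f _ ab] v piece_in_carr by fastforce
  qed
  moreover have "linear_on_carr L (*) (act dual a b f)"
    unfolding linear_on_carr_def
    using ab by (simp add: act_dual_homog[OF f _ ab] carr_closed act_add act_scale act_in_carr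
        functional_lin[OF ff] algebra_simps)
  ultimately have "finite_functional (act dual a b f)"
    unfolding finite_functional_def using act_dual_outside by blast
  moreover have "act dual a b f v = 0" if v: "v \<in> homog L (epar (p+q) a b + s + 1)" for v
  proof -
    have "act L a b v \<in> homog L (epar (p+q) a b + (epar (p+q) a b + (s + 1)))"
      using act_homog[OF ab v] by (simp only: add.assoc)
    then have "act L a b v \<in> homog L (s + 1)" by (simp only: bit_add_self)
    then show ?thesis using act_dual_homog[OF f homog_in_carr[OF v] ab] f0 by simp
  qed
  ultimately show ?thesis by (simp add: homog_dual)
qed

text \<open>The Koszul sign is bimultiplicative, so moving two matrix units past a functional costs the same sign
  as moving their bracket past it.\<close>

lemma act_dual_commute_homog:
  assumes f: "f \<in> homog dual s" and ab: "(a,b) \<in> gl" and cd: "(c,d) \<in> gl"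
  defines "\<kappa> \<equiv> koszul (epar (p+q) a b) (epar (p+q) c d)"
  shows "act dual a b (act dual c d f) - scl dual \<kappa> (act dual c d (act dual a b f))
        = (if b = c then act dual a d f else 0) - (if d = a then scl dual \<kappa> (act dual c b f) else 0)"
proof (rule ext)
  fix v
  let ?P = "epar (p+q) a b" and ?Q = "epar (p+q) c d"
  show "(act dual a b (act dual c d f) - scl dual \<kappa> (act dual c d (act dual a b f))) v
        = ((if b = c then act dual a d f else 0) - (if d = a then scl dual \<kappa> (act dual c b f) else 0)) v"
  proof (cases "v \<in> carr L")
    case False
    then show ?thesis by (simp add: act_dual_outside scl_dual)
  next
    case v: True
    have ff: "finite_functional f" using f by (auto simp: homog_dual)
    have ad: "(a,d) \<in> gl" and cb: "(c,b) \<in> gl"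
      using ab cd by (auto simp: gl_idx_def)
    have 1: "act dual a b (act dual c d f) v
        = \<kappa> * koszul ?P s * koszul ?Q s * f (act L c d (act L a b v))"
      using act_dual_homog[OF act_dual_in_homog[OF f cd] v ab] act_dual_homog[OF f act_in_carr[OF ab v] cd]
      by (simp add: \<kappa>_def koszul_add[of ?P ?Q s])
    have 2: "act dual c d (act dual a b f) v
        = \<kappa> * koszul ?P s * koszul ?Q s * f (act L a b (act L c d v))"
      using act_dual_homog[OF act_dual_in_homog[OF f ab] v cd] act_dual_homog[OF f act_in_carr[OF cd v] ab]
      by (simp add: \<kappa>_def koszul_add[of ?Q ?P s] koszul_commute[of ?P ?Q])
    have "act L a b (act L c d v) = scl L \<kappa> (act L c d (act L a b v))
       + ((if b = c then act L a d v else 0) - (if d = a then scl L \<kappa> (act L c b v) else 0))"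
      unfolding \<kappa>_def by (rule act_commute[OF ab cd v])
    moreover have "(if b = c then act L a d v else 0) \<in> carr L" "(if d = a then scl L \<kappa> (act L c b v) else 0) \<in> carr L"
      using act_in_carr[OF ad v] act_in_carr[OF cb v] carr_closed by auto
    ultimately have 3: "f (act L a b (act L c d v)) = \<kappa> * f (act L c d (act L a b v))
       + (if b = c then f (act L a d v) else 0) - (if d = a then \<kappa> * f (act L c b v) else 0)"
      using act_in_carr[OF cd act_in_carr[OF ab v]] act_in_carr[OF cb v] by (simp add: functional_lin[OF ff] carr_closed)
    have \<kappa>: "\<kappa> * \<kappa> = 1" "\<kappa> * (\<kappa> * z) = z" for z by (simp_all add: \<kappa>_def)
    have "(act dual a b (act dual c d f) - scl dual \<kappa> (act dual c d (act dual a b f))) v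
        = - (koszul ?P s * koszul ?Q s * ((if b = c then f (act L a d v) else 0) - (if d = a then \<kappa> * f (act L c b v) else 0)))"
      by (simp add: scl_dual 1 2 3 algebra_simps \<kappa>)
    also have "\<dots> = ((if b = c then act dual a d f else 0) - (if d = a then scl dual \<kappa> (act dual c b f) else 0)) v"
    proof -
      have "koszul ?P s * koszul ?Q s = koszul (epar (p+q) a d) s" if "b = c"
        unfolding koszul_add'[symmetric] using that by (simp add: add.assoc)
      moreover have "koszul ?P s * koszul ?Q s = koszul (epar (p+q) c b) s" if "d = a"
        unfolding koszul_add'[symmetric] using that by (simp add: add.commute add.left_commute add.assoc)
      ultimately show ?thesis
        using act_dual_homog[OF f v ad] act_dual_homog[OF f v cb] by (auto simp: scl_dual right_diff_distrib)
    qed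
    finally show ?thesis .
  qed
qed

lemma vector_space_dual: "vector_space (scl dual)"
  by unfold_locales (auto simp: fun_eq_iff scl_dual algebra_simps)

lemma smod_dual: "smod (p+q) (gl) dual"
proof
  interpret D: vector_space "scl dual" by (rule vector_space_dual)
  have "D.subspace (homog dual s)" for s
  proof (rule D.subspaceI)
    show "0 \<in> homog dual s" by (simp add: homog_dual finite_functional_zero)
    show "x + y \<in> homog dual s" if "x \<in> homog dual s" "y \<in> homog dual s" for x y
      using that by (simp add: homog_dual finite_functional_add)
    show "scl dual c x \<in> homog dual s" if "x \<in> homog dual s" for c x
      using that by (simp add: homog_dual finite_functional_scale scl_dual)
  qed
  moreover have "homog dual 0 \<inter> homog dual 1 = {0}"
  proof -
    have "f = 0" if f: "f \<in> homog dual 0" "f \<in> homog dual 1" for f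
    proof (rule ext)
      fix v
      have "f v = 0" if "v \<in> carr L"
        using homog_dual_parity_comp[OF f(1) that] homog_dual_parity_comp[OF f(2) that] by simp
      then show "f v = 0 v"
        using f(1) functional_lin(5) by (cases "v \<in> carr L") (auto simp: homog_dual)
    qed
    then show ?thesis by (auto simp: homog_dual finite_functional_zero)
  qed
  moreover have "linear_on_carr dual (scl dual) (act dual a b)" for a b
    by (simp add: linear_on_carr_def act_dual_add act_dual_scale)
  moreover have "act dual a b (act dual c d f)
      - scl dual (koszul (epar (p+q) a b) (epar (p+q) c d)) (act dual c d (act dual a b f))
        = (if b = c then act dual a d f else 0)
          - (if d = a then scl dual (koszul (epar (p+q) a b) (epar (p+q) c d)) (act dual c b f) else 0)"
    if abcd: "(a,b) \<in> gl" "(c,d) \<in> gl" and fc: "f \<in> carr dual" for a b c d f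
  proof -
    obtain f0 f1 where f: "f = f0 + f1" "f0 \<in> homog dual 0" "f1 \<in> homog dual 1"
      using fc unfolding carr_def by auto
    let ?\<kappa> = "koszul (epar (p+q) a b) (epar (p+q) c d)"
    let ?lhs = "\<lambda>f. act dual a b (act dual c d f) - scl dual ?\<kappa> (act dual c d (act dual a b f))"
    let ?rhs = "\<lambda>f. (if b = c then act dual a d f else 0) - (if d = a then scl dual ?\<kappa> (act dual c b f) else 0)"
    have "?lhs f = ?lhs f0 + ?lhs f1"
      by (simp add: f(1) act_dual_add D.scale_right_distrib)
    also have "\<dots> = ?rhs f0 + ?rhs f1"
      using act_dual_commute_homog[OF f(2) abcd] act_dual_commute_homog[OF f(3) abcd] by (simp only:)
    also have "\<dots> = ?rhs f"
      by (simp add: f(1) act_dual_add D.scale_right_distrib)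
    finally show ?thesis .
  qed
  ultimately show "supermodule (p+q) (gl) dual"
    by (intro supermoduleI vector_space_dual act_dual_in_homog)
qed

end

section \<open>Even invariant forms\<close>

text \<open>The sum of the restrictions of the form to the even and to the odd part is still invariant,
  since an odd matrix unit exchanges the two restrictions.\<close>

lemma (in smod) even_invariant_form:
  assumes uni: "unitary_wrt \<sigma> N M" and S: "S = gl_idx N"
  obtains h where "hermitian_smod m S M h"
    "\<And>s u v. u \<in> homog M s \<Longrightarrow> v \<in> homog M (s+1) \<Longrightarrow> h u v = 0"
    "\<And>a b v w. (a,b) \<in> S \<Longrightarrow> v \<in> carr M \<Longrightarrow> w \<in> carr M \<Longrightarrow> h (act M a b v) w = \<sigma> a b * h v (act M b a w)"
proof -
  obtain h where form: "positive_hermitian_form M h"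
    and inv: "\<And>a b v w. a \<in> {1..N} \<Longrightarrow> b \<in> {1..N} \<Longrightarrow> v \<in> carr M \<Longrightarrow> w \<in> carr M
      \<Longrightarrow> h (act M a b v) w = h v (scl M (\<sigma> a b) (act M b a w))"
    using uni unfolding unitary_wrt_def by blast
  interpret H: hermitian_smod m S M h
    using form by unfold_locales
  let ?p = "parity_comp M"
  define h' where "h' v w = h (?p 0 v) (?p 0 w) + h (?p 1 v) (?p 1 w)" for v w
  have pc: "?p s v \<in> carr M" if "v \<in> carr M" for s v
    using that by (rule parity_comp_in_carr)
  have pos: "0 < Re (h' v v)" if v: "v \<in> carr M" "v \<noteq> 0" for v
  proof -
    have "?p 0 v \<noteq> 0 \<or> ?p 1 v \<noteq> 0" using parity_comp_sum[OF v(1)] v(2) by auto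
    then show ?thesis
      using H.form_pos[OF pc[OF v(1)], of 0] H.form_pos[OF pc[OF v(1)], of 1]
        H.form_nonneg[OF pc[OF v(1)], of 0] H.form_nonneg[OF pc[OF v(1)], of 1]
      by (auto simp: h'_def)
  qed
  have lin: "linear_on_carr M (*) (h' v)" if "v \<in> carr M" for v
    using that unfolding linear_on_carr_def h'_def
    by (simp add: parity_comp_add parity_comp_scale pc H.form_add_right H.form_scale_right distrib_left)
  have herm: "h' w v = cnj (h' v w)" if "v \<in> carr M" "w \<in> carr M" for v w
    using that by (simp add: h'_def pc H.form_cnj)
  have form': "positive_hermitian_form M h'"
    unfolding positive_hermitian_form_def using pos lin herm by blast
  have even: "h' u v = 0" if "u \<in> homog M s" "v \<in> homog M (s+1)" for u v s
  proof -
    have "u \<in> carr M" "v \<in> carr M" using that homog_in_carr by blast+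
    moreover have "?p (s+1) u = 0" "?p s v = 0" using that by simp_all
    ultimately show ?thesis
      using H.form_zero_left H.form_zero_right pc
      by (cases s) (simp_all add: h'_def)
  qed
  have inv': "h' (act M a b v) w = \<sigma> a b * h' v (act M b a w)"
    if ab: "(a,b) \<in> S" and vw: "v \<in> carr M" "w \<in> carr M" for a b v w
  proof -
    have ba: "(b,a) \<in> S" and *: "a \<in> {1..N}" "b \<in> {1..N}" using ab by (auto simp: S gl_idx_def)
    have inv: "h (act M a b x) y = \<sigma> a b * h x (act M b a y)" if "x \<in> carr M" "y \<in> carr M" for x y
      using inv[OF * that] H.form_scale_right[OF that(1) act_in_carr[OF ba that(2)]] by simp
    show ?thesis
      unfolding h'_def parity_comp_act[OF vw(1) ab] parity_comp_act[OF vw(2) ba, unfolded add.commute[of "par m b"]]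
      using vw by (cases "epar m a b = 0") (simp_all add: inv pc distrib_left)
  qed
  have "hermitian_smod m S M h'" using form' by unfold_locales
  then show thesis
    by (rule that) (fact even inv')+
qed

section \<open>Uniqueness of simple lowest weight modules\<close>

context graded_generation
begin

lemma sum_of_pieces:
  assumes "v \<in> span {act_word M xs y |xs y. xs \<in> lists S \<and> y \<in> Y}"
  shows "\<exists>K f. (\<forall>k. f k \<in> piece (int k)) \<and> (\<forall>k\<ge>K. f k = 0) \<and> v = (\<Sum>k<K. f k)"
  using assms unfolding span_words_eq
proof (induction rule: span_induct_alt)
  case base
  show ?case
    by (intro exI[of _ 0] exI[of _ "\<lambda>_. 0"]) (simp add: subspace_0[OF subspace_piece])
next
  case (step c x y)
  obtain K f where f: "\<And>k. f k \<in> piece (int k)" "\<And>k. k \<ge> K \<Longrightarrow> f k = 0" "y = (\<Sum>k<K. f k)"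
    using step.IH by blast
  obtain xs z where xs: "xs \<in> lists F" "z \<in> Y" "x = act_word M xs z" using step.hyps by blast
  define k0 where "k0 = nat (word_degree g xs)"
  have "int (length xs) \<le> word_degree g xs"
    using length_le_word_degree[of xs S g] xs(1) by (simp add: positive_letters_def)
  then have x: "x \<in> piece (int k0)"
    using word_in_piece[OF xs(1) _ xs(2)] xs(3) by (simp add: k0_def)
  define f' where "f' k = f k + (if k = k0 then scl M c x else 0)" for k
  let ?K = "max K (Suc k0)"
  have "(\<Sum>k<?K. f' k) = (\<Sum>k<?K. f k) + (\<Sum>k<?K. if k = k0 then scl M c x else 0)"
    unfolding f'_def by (rule sum.distrib)
  also have "(\<Sum>k<?K. f k) = y"
    unfolding f(3) by (rule sum.mono_neutral_right) (auto intro: f(2))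
  also have "(\<Sum>k<?K. if k = k0 then scl M c x else 0) = scl M c x"
    by (subst sum.delta) (simp_all add: less_max_iff_disj)
  finally have "scl M c x + y = (\<Sum>k<?K. f' k)" by (simp add: add.commute)
  moreover have "f' k \<in> piece (int k)" for k
    unfolding f'_def using f(1) x
    by (intro subspace_add[OF subspace_piece]) (auto intro: subspace_scale[OF subspace_piece] subspace_0[OF subspace_piece])
  moreover have "f' k = 0" if "k \<ge> ?K" for k
    using that f(2) by (auto simp: f'_def)
  ultimately show ?case by blast
qed

lemma piece_zero: "piece 0 \<subseteq> Y"
proof -
  have "piece_gens 0 \<subseteq> Y"
  proof
    fix x assume "x \<in> piece_gens 0"
    then obtain xs y where xs: "xs \<in> lists F" "word_degree g xs = 0" "y \<in> Y" "x = act_word M xs y"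
      unfolding piece_gens_def by blast
    have "int (length xs) \<le> word_degree g xs"
      using length_le_word_degree[of xs S g] xs(1) by (simp add: positive_letters_def)
    then show "x \<in> Y" using xs by simp
  qed
  then show ?thesis unfolding piece_def using subspace_Y by (rule span_minimal)
qed

text \<open>The components of different degrees are eigenspaces of the Euler operator for different
  eigenvalues, and the component of degree zero is contained in \<open>Y\<close>.\<close>

lemma euler_eigenvector_in_Y:
  assumes S: "finite S" "\<And>a b. (a,b) \<in> S \<Longrightarrow> (b,a) \<in> S"
    and Y: "\<And>y. y \<in> Y \<Longrightarrow> euler g y = scl M c y"
    and v: "v \<in> span {act_word M xs y |xs y. xs \<in> lists S \<and> y \<in> Y}" "euler g v = scl M c v"
  shows "v \<in> Y"
proof -
  obtain K f where f: "\<And>k. f k \<in> piece (int k)" "\<And>k. k \<ge> K \<Longrightarrow> f k = 0" "v = (\<Sum>k<K. f k)"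
    using sum_of_pieces[OF v(1)] by blast
  have fc: "f k \<in> carr M" for k using f(1) piece_in_carr by blast
  have vc: "v \<in> carr M" unfolding f(3) using fc by (intro subspace_sum[OF subspace_carr])
  define u where "u k = f k - (if k = 0 then v else 0)" for k
  have ev: "euler g (u k) = scl M (c + of_nat k) (u k)" for k
  proof -
    have "euler g (f k) = scl M (c + of_int (int k)) (f k)"
      by (rule euler_piece[OF S(1) _ _ f(1)]) (fact S(2) Y)+
    moreover have "euler g (u k) = euler g (f k) - (if k = 0 then euler g v else 0)"
      using linear_map_diff[OF linear_euler fc vc] by (simp add: u_def)
    ultimately show ?thesis
      using v(2) by (simp add: u_def scale_right_diff_distrib)
  qed
  have "u 0 = 0"
  proof (rule eigenvectors_independent[where J = "{..<Suc K}" and c = "\<lambda>k. c + of_nat k" and v = u])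
    show "inj_on (\<lambda>k. c + of_nat k) {..<Suc K}" by (auto simp: inj_on_def)
    show "(\<Sum>k<Suc K. u k) = 0"
      unfolding u_def sum_subtractf using f(2)[of K] by (simp add: f(3)[symmetric] del: sum.lessThan_Suc add: sum.lessThan_Suc[of f] sum.delta)
    show "u k \<in> carr M" for k using fc vc carr_closed by (simp add: u_def)
  qed (use ev linear_euler in auto)
  then have "v = f 0" by (simp add: u_def)
  then show ?thesis using f(1)[of 0] piece_zero by auto
qed

end

definition prod_smod :: "'v supermod \<Rightarrow> 'w supermod \<Rightarrow> ('v \<times> 'w) supermod" where
  "prod_smod M M' = \<lparr>scl = (\<lambda>c x. (scl M c (fst x), scl M' c (snd x))),
     homog = (\<lambda>s. homog M s \<times> homog M' s),
     act = (\<lambda>a b x. (act M a b (fst x), act M' a b (snd x)))\<rparr>"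

lemma prod_smod_simps [simp]:
  "scl (prod_smod M M') c x = (scl M c (fst x), scl M' c (snd x))"
  "homog (prod_smod M M') s = homog M s \<times> homog M' s"
  "act (prod_smod M M') a b x = (act M a b (fst x), act M' a b (snd x))"
  by (simp_all add: prod_smod_def)

lemma carr_prod_smod: "carr (prod_smod M M') = carr M \<times> carr M'"
proof (intro set_eqI iffI)
  fix x assume "x \<in> carr (prod_smod M M')"
  then show "x \<in> carr M \<times> carr M'" unfolding carr_def by force
next
  fix x assume "x \<in> carr M \<times> carr M'"
  then obtain u w u' w' where "x = (u,u') + (w,w')" "u \<in> homog M 0" "w \<in> homog M 1"
      "u' \<in> homog M' 0" "w' \<in> homog M' 1"
    unfolding carr_def by auto
  then show "x \<in> carr (prod_smod M M')" unfolding carr_def by auto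
qed

lemma act_word_prod_smod: "act_word (prod_smod M M') xs (x,x') = (act_word M xs x, act_word M' xs x')"
  by (induction xs) auto

lemma smod_prod:
  assumes "smod m S M" "smod m S M'"
  shows "smod m S (prod_smod M M')"
proof
  interpret M: smod m S M by fact
  interpret M': smod m S M' by fact
  show "supermodule m S (prod_smod M M')"
  proof (rule supermoduleI)
    show vs: "vector_space (scl (prod_smod M M'))"
      by unfold_locales (auto simp: plus_prod_def M.scale_right_distrib M'.scale_right_distrib
          M.scale_left_distrib M'.scale_left_distrib)
    interpret P: vector_space "scl (prod_smod M M')" by (rule vs)
    show "P.subspace (homog (prod_smod M M') s)" for s
      by (rule P.subspaceI) (auto simp: plus_prod_def zero_prod_def
          M.subspace_0[OF M.subspace_homog] M'.subspace_0[OF M'.subspace_homog]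
          M.subspace_add[OF M.subspace_homog] M'.subspace_add[OF M'.subspace_homog]
          M.subspace_scale[OF M.subspace_homog] M'.subspace_scale[OF M'.subspace_homog])
    show "homog (prod_smod M M') 0 \<inter> homog (prod_smod M M') 1 = {0}"
      using M.supermodule M'.supermodule unfolding supermodule_def zero_prod_def prod_smod_simps
      by (simp add: Times_Int_Times)
    show "linear_on_carr (prod_smod M M') (scl (prod_smod M M')) (act (prod_smod M M') a b)"
      if "(a,b) \<in> S" for a b
      using that by (auto simp: linear_on_carr_def carr_prod_smod plus_prod_def M.act_add M'.act_add
          M.act_scale M'.act_scale)
    show "act (prod_smod M M') a b v \<in> homog (prod_smod M M') (epar m a b + s)"
      if "(a,b) \<in> S" "v \<in> homog (prod_smod M M') s" for a b s v
      using that M.act_homog[OF that(1), of _ s] M'.act_homog[OF that(1), of _ s] by auto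
    show "act (prod_smod M M') a b (act (prod_smod M M') c d v)
        - scl (prod_smod M M') (koszul (epar m a b) (epar m c d)) (act (prod_smod M M') c d (act (prod_smod M M') a b v))
        = (if b = c then act (prod_smod M M') a d v else 0)
          - (if d = a then scl (prod_smod M M') (koszul (epar m a b) (epar m c d)) (act (prod_smod M M') c b v) else 0)"
      if "(a,b) \<in> S" "(c,d) \<in> S" "v \<in> carr (prod_smod M M')" for a b c d v
      using that M.act_commute[OF that(1,2), of "fst v"] M'.act_commute[OF that(1,2), of "snd v"]
      by (auto simp: carr_prod_smod prod_eq_iff)
  qed
qed

text \<open>The submodule of the direct sum generated by a pair \<open>(x,x')\<close> of lowest weight vectors of equal weight is the graph
  of an isomorphism.  Indeed, its vectors of the lowest weight are the multiples of \<open>(x,x')\<close>; so it contains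
  neither \<open>(x,0)\<close> nor \<open>(0,x')\<close>, and its intersections with the two simple summands must vanish.\<close>

locale lowest_weight_pair =
  fixes m N :: nat and M :: "'v::ab_group_add supermod" and M' :: "'w::ab_group_add supermod"
    and \<mu> :: "nat \<Rightarrow> complex" and x :: 'v and x' :: 'w
  assumes simple: "simple_mod m (gl_idx N) M" "simple_mod m (gl_idx N) M'"
    and x: "even_weight_vector (gl_idx N) M \<mu> x" "generates (gl_idx N) M x"
      "\<And>a b. (a,b) \<in> gl_idx N \<Longrightarrow> a > b \<Longrightarrow> act M a b x = 0"
    and x': "even_weight_vector (gl_idx N) M' \<mu> x'" "generates (gl_idx N) M' x'"
      "\<And>a b. (a,b) \<in> gl_idx N \<Longrightarrow> a > b \<Longrightarrow> act M' a b x' = 0"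
begin

sublocale M: smod m "gl_idx N" M
  using simple by unfold_locales (simp add: simple_mod_def)

sublocale M': smod m "gl_idx N" M'
  using simple by unfold_locales (simp add: simple_mod_def)

abbreviation P where "P \<equiv> prod_smod M M'"

sublocale P: smod m "gl_idx N" P
  using smod_prod M.smod_axioms M'.smod_axioms .

definition graph :: "('v \<times> 'w) set" where
  "graph = P.span {act_word P xs (x,x') |xs. xs \<in> lists (gl_idx N)}"

lemma x_homog: "x \<in> homog M 0" "x' \<in> homog M' 0" "x \<noteq> 0" "x' \<noteq> 0"
  using x(1) x'(1) by (auto simp: even_weight_vector_def)

lemma x_carr: "x \<in> carr M" "x' \<in> carr M'"
  using x_homog M.homog_in_carr M'.homog_in_carr by blast+

lemma x_weight: "(a,a) \<in> gl_idx N \<Longrightarrow> act M a a x = scl M (\<mu> a) x"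
    "(a,a) \<in> gl_idx N \<Longrightarrow> act M' a a x' = scl M' (\<mu> a) x'"
  using x(1) x'(1) by (auto simp: even_weight_vector_def)

lemma submod_graph: "submod (gl_idx N) P graph"
  unfolding graph_def by (rule P.submod_words[of _ 0]) (simp add: x_homog)

lemma subspace_graph: "P.subspace graph"
  unfolding graph_def by simp

lemma graph_in_carr: "graph \<subseteq> carr M \<times> carr M'"
proof -
  have "(x,x') \<in> carr P" by (simp add: carr_prod_smod x_carr)
  then have "{act_word P xs (x,x') |xs. xs \<in> lists (gl_idx N)} \<subseteq> carr P"
    using P.act_word_in_carr by blast
  then show ?thesis
    unfolding graph_def carr_prod_smod[symmetric] using P.subspace_carr by (rule P.span_minimal)
qed

lemma graph_closed:
  "(0,0) \<in> graph"
  "(u,u') \<in> graph \<Longrightarrow> (v,v') \<in> graph \<Longrightarrow> (u + v, u' + v') \<in> graph"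
  "(u,u') \<in> graph \<Longrightarrow> (v,v') \<in> graph \<Longrightarrow> (u - v, u' - v') \<in> graph"
  "(u,u') \<in> graph \<Longrightarrow> (scl M c u, scl M' c u') \<in> graph"
  "(a,b) \<in> gl_idx N \<Longrightarrow> (u,u') \<in> graph \<Longrightarrow> (act M a b u, act M' a b u') \<in> graph"
  "(u,u') \<in> graph \<Longrightarrow> (parity_comp M s u, parity_comp M' s u') \<in> graph"
proof -
  show "(0,0) \<in> graph" using P.subspace_0[OF subspace_graph] by (simp add: zero_prod_def)
  show "(u,u') \<in> graph \<Longrightarrow> (v,v') \<in> graph \<Longrightarrow> (u + v, u' + v') \<in> graph"
    using P.subspace_add[OF subspace_graph, of "(u,u')" "(v,v')"] by simp
  show "(u,u') \<in> graph \<Longrightarrow> (v,v') \<in> graph \<Longrightarrow> (u - v, u' - v') \<in> graph"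
    using P.subspace_diff[OF subspace_graph, of "(u,u')" "(v,v')"] by simp
  show "(u,u') \<in> graph \<Longrightarrow> (scl M c u, scl M' c u') \<in> graph"
    using P.subspace_scale[OF subspace_graph, of "(u,u')" c] by simp
  show "(a,b) \<in> gl_idx N \<Longrightarrow> (u,u') \<in> graph \<Longrightarrow> (act M a b u, act M' a b u') \<in> graph"
    using submod_graph unfolding submod_def by fastforce
  show "(parity_comp M s u, parity_comp M' s u') \<in> graph" if "(u,u') \<in> graph"
  proof -
    have "u \<in> carr M" "u' \<in> carr M'" using that graph_in_carr by blast+
    then have "parity_comp P s (u,u') = (parity_comp M s u, parity_comp M' s u')"
      using M.parity_decomposition[of u s] M'.parity_decomposition[of u' s]
      by (intro P.parity_comp_unique) auto
    then show ?thesis using P.submod_parity_comp[OF submod_graph that] by metis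
  qed
qed

lemma fst_graph: "fst ` graph = carr M"
proof (rule antisym)
  show "fst ` graph \<subseteq> carr M" using graph_in_carr by auto
  show "carr M \<subseteq> fst ` graph"
    unfolding x(2)[unfolded generates_def, symmetric]
  proof (rule M.span_minimal)
    show "{act_word M xs x |xs. xs \<in> lists (gl_idx N)} \<subseteq> fst ` graph"
    proof
      fix u assume "u \<in> {act_word M xs x |xs. xs \<in> lists (gl_idx N)}"
      then obtain xs where xs: "xs \<in> lists (gl_idx N)" "u = act_word M xs x" by blast
      then have "act_word P xs (x,x') \<in> graph"
        unfolding graph_def by (intro P.span_base) blast
      then show "u \<in> fst ` graph" by (force simp: xs act_word_prod_smod)
    qed
    show "M.subspace (fst ` graph)"
    proof (rule M.subspaceI)
      show "0 \<in> fst ` graph" using graph_closed(1) by force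
      show "y + z \<in> fst ` graph" if yz: "y \<in> fst ` graph" "z \<in> fst ` graph" for y z
      proof -
        obtain u u' v v' where uv: "(u,u') \<in> graph" "(v,v') \<in> graph" "y = fst (u,u')" "z = fst (v,v')"
          using yz by (auto simp del: fst_conv snd_conv)
        show ?thesis using graph_closed(2)[OF uv(1,2)] uv(3,4) by force
      qed
      show "scl M c y \<in> fst ` graph" if y: "y \<in> fst ` graph" for c y
      proof -
        obtain u u' where uv: "(u,u') \<in> graph" "y = fst (u,u')"
          using y by (auto simp del: fst_conv snd_conv)
        show ?thesis using graph_closed(4)[OF uv(1), of c] uv(2) by force
      qed
    qed
  qed
qed

lemma snd_graph: "snd ` graph = carr M'"
proof (rule antisym)
  show "snd ` graph \<subseteq> carr M'" using graph_in_carr by auto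
  show "carr M' \<subseteq> snd ` graph"
    unfolding x'(2)[unfolded generates_def, symmetric]
  proof (rule M'.span_minimal)
    show "{act_word M' xs x' |xs. xs \<in> lists (gl_idx N)} \<subseteq> snd ` graph"
    proof
      fix u assume "u \<in> {act_word M' xs x' |xs. xs \<in> lists (gl_idx N)}"
      then obtain xs where xs: "xs \<in> lists (gl_idx N)" "u = act_word M' xs x'" by blast
      then have "act_word P xs (x,x') \<in> graph"
        unfolding graph_def by (intro P.span_base) blast
      then show "u \<in> snd ` graph" by (force simp: xs act_word_prod_smod)
    qed
    show "M'.subspace (snd ` graph)"
    proof (rule M'.subspaceI)
      show "0 \<in> snd ` graph" using graph_closed(1) by force
      show "y + z \<in> snd ` graph" if yz: "y \<in> snd ` graph" "z \<in> snd ` graph" for y z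
      proof -
        obtain u u' v v' where uv: "(u,u') \<in> graph" "(v,v') \<in> graph" "y = snd (u,u')" "z = snd (v,v')"
          using yz by (auto simp del: fst_conv snd_conv)
        show ?thesis using graph_closed(2)[OF uv(1,2)] uv(3,4) by force
      qed
      show "scl M' c y \<in> snd ` graph" if y: "y \<in> snd ` graph" for c y
      proof -
        obtain u u' where uv: "(u,u') \<in> graph" "y = snd (u,u')"
          using y by (auto simp del: fst_conv snd_conv)
        show ?thesis using graph_closed(4)[OF uv(1), of c] uv(2) by force
      qed
    qed
  qed
qed


text \<open>For the grading \<open>g a = - a\<close> the letters of positive degree are the raising operators, and the Euler
  operator separates the line through \<open>(x,x')\<close> from everything that they produce.\<close>

lemma graph_weight_space:
  assumes "(scl M \<alpha> x, scl M' \<beta> x') \<in> graph"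
  shows "\<alpha> = \<beta>"
proof -
  have P: "(x,x') \<in> carr P" by (simp add: carr_prod_smod x_carr)
  have line: "P.span {(x,x')} = range (\<lambda>k. (scl M k x, scl M' k x'))"
    by (simp add: P.span_singleton)
  interpret graded_generation m "gl_idx N" P "\<lambda>a. - int a" "P.span {(x,x')}"
  proof unfold_locales
    show "P.span {(x,x')} \<subseteq> carr P" using P by (intro P.span_minimal P.subspace_carr) simp
    show "act P a b y \<in> P.span {(x,x')}"
      if "(a,b) \<in> gl_idx N" "- int a = - int b" "y \<in> P.span {(x,x')}" for a b y
    proof -
      obtain k where y: "y = (scl M k x, scl M' k x')" using \<open>y \<in> P.span {(x,x')}\<close> unfolding line by blast
      have "act P a b y = (scl M (\<mu> a * k) x, scl M' (\<mu> a * k) x')"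
        using that(1,2) x_carr by (simp add: y M.act_scale M'.act_scale x_weight mult.commute)
      then show ?thesis unfolding line by blast
    qed
    show "act P a b y = 0"
      if "(a,b) \<in> gl_idx N" "- int a < - int b" "y \<in> P.span {(x,x')}" for a b y
    proof -
      obtain k where y: "y = (scl M k x, scl M' k x')" using \<open>y \<in> P.span {(x,x')}\<close> unfolding line by blast
      then show ?thesis
        using that(1,2) x(3) x'(3) x_carr by (simp add: y M.act_scale M'.act_scale zero_prod_def)
    qed
  qed (auto simp: gl_idx_def)
  define c where "c = (\<Sum>a | (a,a) \<in> gl_idx N. of_int (- int a) * \<mu> a)"
  have ev: "P.euler (\<lambda>a. - int a) (scl M k x, scl M' l x') = scl P c (scl M k x, scl M' l x')" for k l
  proof -
    have "scl P (of_int (- int a)) (act P a a (scl M k x, scl M' l x'))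
        = scl P (of_int (- int a) * \<mu> a) (scl M k x, scl M' l x')" if "(a,a) \<in> gl_idx N" for a
      using that x_carr by (simp add: M.act_scale M'.act_scale x_weight mult.left_commute mult.commute)
    then show ?thesis
      unfolding P.euler_def c_def P.scale_sum_left by (intro sum.cong) auto
  qed
  have "(scl M \<alpha> x, scl M' \<beta> x') \<in> P.span {(x,x')}"
  proof (rule euler_eigenvector_in_Y)
    show "finite (gl_idx N)" by (simp add: gl_idx_def)
    show "(b,a) \<in> gl_idx N" if "(a,b) \<in> gl_idx N" for a b using that by (auto simp: gl_idx_def)
    show "P.euler (\<lambda>a. - int a) y = scl P c y" if "y \<in> P.span {(x,x')}" for y
      using that ev unfolding line by blast
    show "P.euler (\<lambda>a. - int a) (scl M \<alpha> x, scl M' \<beta> x') = scl P c (scl M \<alpha> x, scl M' \<beta> x')"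
      by (rule ev)
    have "{act_word P xs (x,x') |xs. xs \<in> lists (gl_idx N)}
      \<subseteq> {act_word P xs y |xs y. xs \<in> lists (gl_idx N) \<and> y \<in> P.span {(x,x')}}"
      using P.span_base[of "(x,x')" "{(x,x')}"] by blast
    then show "(scl M \<alpha> x, scl M' \<beta> x') \<in>
        P.span {act_word P xs y |xs y. xs \<in> lists (gl_idx N) \<and> y \<in> P.span {(x,x')}}"
      using assms P.span_mono unfolding graph_def by blast
  qed
  then obtain k where "scl M \<alpha> x = scl M k x" "scl M' \<beta> x' = scl M' k x'" unfolding line by blast
  then show ?thesis using x_homog(3,4) by simp
qed

lemma graph_left: "(u,0) \<in> graph \<Longrightarrow> u = 0"
proof -
  let ?W = "{u. (u,0) \<in> graph}"
  have "submod (gl_idx N) M ?W"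
  proof (rule M.submodI)
    show "M.subspace ?W"
    proof (rule M.subspaceI)
      show "0 \<in> ?W" using graph_closed(1) by simp
      show "u + v \<in> ?W" if "u \<in> ?W" "v \<in> ?W" for u v
        using that graph_closed(2)[of u 0 v 0] by simp
      show "scl M c u \<in> ?W" if "u \<in> ?W" for c u
        using that graph_closed(4)[of u 0 c] by simp
    qed
    show "?W \<subseteq> carr M" using graph_in_carr by blast
    show "parity_comp M 0 u \<in> ?W" if "u \<in> ?W" for u
      using that graph_closed(6)[of u 0 0] by simp
    show "act M a b u \<in> ?W" if "(a,b) \<in> gl_idx N" "u \<in> ?W" for a b u
      using that graph_closed(5)[of a b u 0] M'.act_zero by simp
  qed
  then have "?W = {0} \<or> ?W = carr M"
    using simple(1) unfolding simple_mod_def by blast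
  moreover have "x \<notin> ?W"
  proof
    assume "x \<in> ?W"
    then have "(scl M 1 x, scl M' 0 x') \<in> graph" by simp
    then show False using graph_weight_space by fastforce
  qed
  ultimately show "(u,0) \<in> graph \<Longrightarrow> u = 0" using x_carr by blast
qed

lemma graph_right: "(0,u) \<in> graph \<Longrightarrow> u = 0"
proof -
  let ?W = "{u. (0,u) \<in> graph}"
  have "submod (gl_idx N) M' ?W"
  proof (rule M'.submodI)
    show "M'.subspace ?W"
    proof (rule M'.subspaceI)
      show "0 \<in> ?W" using graph_closed(1) by simp
      show "u + v \<in> ?W" if "u \<in> ?W" "v \<in> ?W" for u v
        using that graph_closed(2)[of 0 u 0 v] by simp
      show "scl M' c u \<in> ?W" if "u \<in> ?W" for c u
        using that graph_closed(4)[of 0 u c] by simp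
    qed
    show "?W \<subseteq> carr M'" using graph_in_carr by blast
    show "parity_comp M' 0 u \<in> ?W" if "u \<in> ?W" for u
      using that graph_closed(6)[of 0 u 0] by simp
    show "act M' a b u \<in> ?W" if "(a,b) \<in> gl_idx N" "u \<in> ?W" for a b u
      using that graph_closed(5)[of a b 0 u] M.act_zero by simp
  qed
  then have "?W = {0} \<or> ?W = carr M'"
    using simple(2) unfolding simple_mod_def by blast
  moreover have "x' \<notin> ?W"
  proof
    assume "x' \<in> ?W"
    then have "(scl M 0 x, scl M' 1 x') \<in> graph" by simp
    then show False using graph_weight_space by fastforce
  qed
  ultimately show "(0,u) \<in> graph \<Longrightarrow> u = 0" using x_carr by blast
qed

lemma isomorphic: "isomorphic_mod (gl_idx N) M M'"
proof -
  have "\<exists>u'. (u,u') \<in> graph" if "u \<in> carr M" for u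
    using that unfolding fst_graph[symmetric] by auto
  then obtain f where f: "\<And>u. u \<in> carr M \<Longrightarrow> (u, f u) \<in> graph" by metis
  have f_eq: "f u = u'" if "(u,u') \<in> graph" for u u'
  proof -
    have "u \<in> carr M" using that graph_in_carr by blast
    then have "(u - u, f u - u') \<in> graph" using graph_closed(3)[OF f that] by blast
    then show ?thesis using graph_right[of "f u - u'"] by simp
  qed
  have "linear_on_carr M (scl M') f"
    unfolding linear_on_carr_def using f_eq graph_closed(2)[OF f f] graph_closed(4)[OF f] by blast
  moreover have "f ` homog M s \<subseteq> homog M' s" for s
  proof (rule image_subsetI)
    fix u assume u: "u \<in> homog M s"
    then have fu: "(u, f u) \<in> graph" using f M.homog_in_carr by blast
    have "f u = parity_comp M' s (f u)"
      using f_eq[OF graph_closed(6)[OF fu, of s]] by (simp only: M.parity_comp_homog[OF u])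
    moreover have "f u \<in> carr M'" using fu graph_in_carr by blast
    then have "parity_comp M' s (f u) \<in> homog M' s" by (rule M'.parity_decomposition(1))
    ultimately show "f u \<in> homog M' s" by (simp only:)
  qed
  moreover have "f (act M a b v) = act M' a b (f v)" if "(a,b) \<in> gl_idx N" "v \<in> carr M" for a b v
    using f_eq graph_closed(5)[OF that(1) f[OF that(2)]] by blast
  ultimately have "even_hom (gl_idx N) M M' f"
    unfolding even_hom_def by blast
  moreover have "bij_betw f (carr M) (carr M')"
  proof (rule bij_betw_imageI)
    show "inj_on f (carr M)"
    proof (rule inj_onI)
      fix u v assume uv: "u \<in> carr M" "v \<in> carr M" "f u = f v"
      then have "(u - v, f u - f v) \<in> graph" using graph_closed(3)[OF f f] by blast
      then show "u = v" using uv(3) graph_left[of "u - v"] by simp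
    qed
    show "f ` carr M = carr M'"
    proof
      show "f ` carr M \<subseteq> carr M'" using f graph_in_carr by blast
      show "carr M' \<subseteq> f ` carr M"
      proof
        fix u' assume "u' \<in> carr M'"
        then obtain u where "(u,u') \<in> graph" unfolding snd_graph[symmetric] by auto
        then show "u' \<in> f ` carr M" using f_eq graph_in_carr by blast
      qed
    qed
  qed
  ultimately show ?thesis unfolding isomorphic_mod_def by blast
qed

end

theorem simple_lowest_weight_mods_isomorphic:
  assumes "simple_lowest_weight_mod m (gl_idx N) \<mu> M" "simple_lowest_weight_mod m (gl_idx N) \<mu> M'"
  shows "isomorphic_mod (gl_idx N) M M'"
proof -
  obtain x where x: "even_weight_vector (gl_idx N) M \<mu> x" "generates (gl_idx N) M x"
      "\<forall>(a,b)\<in>gl_idx N. a > b \<longrightarrow> act M a b x = 0"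
    using assms(1) unfolding simple_lowest_weight_mod_def by blast
  obtain x' where x': "even_weight_vector (gl_idx N) M' \<mu> x'" "generates (gl_idx N) M' x'"
      "\<forall>(a,b)\<in>gl_idx N. a > b \<longrightarrow> act M' a b x' = 0"
    using assms(2) unfolding simple_lowest_weight_mod_def by blast
  interpret lowest_weight_pair m N M M' \<mu> x x'
    using assms x x' by unfold_locales (auto simp: simple_lowest_weight_mod_def)
  show ?thesis by (rule isomorphic)
qed

section \<open>From the graded dual to the module\<close>

lemma star_sign_sym: "star_sign p a b = star_sign p b a"
  by (auto simp: star_sign_def)

lemma dual_star_sign_sym: "dual_star_sign p m a b = dual_star_sign p m b a"
  by (auto simp: dual_star_sign_def star_sign_sym[of p a b] add.commute[of "par m a"])

lemma star_sign_square: "star_sign p a b * star_sign p a b = 1"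
  by (simp add: star_sign_def)

lemma dual_star_sign_square: "dual_star_sign p m a b * dual_star_sign p m a b = 1"
  by (simp add: dual_star_sign_def star_sign_def)

lemma cnj_signs [simp]: "cnj (star_sign p a b) = star_sign p a b"
    "cnj (dual_star_sign p m a b) = dual_star_sign p m a b" "cnj (koszul s t) = koszul s t"
  by (simp_all add: star_sign_def dual_star_sign_def koszul_def)

text \<open>The reason for the dual star-operation: passing from parity t to the shifted parity changes the Koszul
  sign exactly when the matrix unit is odd, which is the sign by which the two star-operations differ.\<close>

lemma koszul_dual_star_sign:
  "koszul (epar m a b) (epar m a b + t) * dual_star_sign p m a b = koszul (epar m a b) t * star_sign p a b"
  by (cases "epar m a b"; cases t) (simp_all add: dual_star_sign_def)

context simple_parabolic_quotient
begin

sublocale D: smod "p+q" "gl" dual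
  by (rule smod_dual)

lemma act_dual_vanishes:
  assumes "f \<in> carr dual" "v \<in> carr L" "act L a b v = 0"
  shows "act dual a b f v = 0"
  using functional_lin(4)[OF carr_dual_functional[OF assms(1)]] assms(2,3)
  by (simp add: dual_def graded_dual_def)

lemma parity_comp_dual:
  assumes "f \<in> carr dual" "v \<in> carr L"
  shows "parity_comp dual s f v = f (parity_comp L s v)"
proof -
  let ?g = "parity_comp dual s f" and ?h = "f - parity_comp dual s f"
  have g: "?g \<in> homog dual s" and h: "?h \<in> homog dual (s+1)"
    using D.parity_decomposition[OF assms(1)] by blast+
  have "?h (parity_comp L (s+1+1) v) = 0"
    by (rule homog_dual_parity_comp(2)[OF h assms(2)])
  then have "?h (parity_comp L s v) = 0" by (simp only: add.assoc bit_add_self) simp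
  then show ?thesis
    using homog_dual_parity_comp(1)[OF g assms(2)] by simp
qed

text \<open>The common kernel of all functionals is a submodule; it is not all of \<open>L\<close>, as the dual is nonzero.\<close>

lemma dual_separates_points:
  assumes "carr dual \<noteq> {0}" "v \<in> carr L" "\<And>f. f \<in> carr dual \<Longrightarrow> f v = 0"
  shows "v = 0"
proof -
  let ?Z = "{v \<in> carr L. \<forall>f\<in>carr dual. f v = 0}"
  have "submod (gl) L ?Z"
  proof (rule submodI)
    show "subspace ?Z"
    proof (rule subspaceI)
      show "0 \<in> ?Z" using functional_lin(4)[OF carr_dual_functional] carr_closed(1) by simp
      show "x + y \<in> ?Z" if "x \<in> ?Z" "y \<in> ?Z" for x y
        using that by (auto simp: carr_closed functional_lin(1)[OF carr_dual_functional])
      show "scl L c x \<in> ?Z" if "x \<in> ?Z" for c x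
        using that by (auto simp: carr_closed functional_lin(2)[OF carr_dual_functional])
    qed
    show "parity_comp L 0 w \<in> ?Z" if "w \<in> ?Z" for w
    proof -
      have wc: "w \<in> carr L" and Zw: "\<forall>f\<in>carr dual. f w = 0" using that by simp_all
      have "f (parity_comp L 0 w) = 0" if f: "f \<in> carr dual" for f
        using bspec[OF Zw D.parity_comp_in_carr[OF f, of 0]] parity_comp_dual[OF f wc, of 0] by simp
      then show ?thesis using parity_comp_in_carr[OF wc] by simp
    qed
    show "act L a b w \<in> ?Z" if ab: "(a,b) \<in> gl" and w: "w \<in> ?Z" for a b w
    proof -
      have wc: "w \<in> carr L" and Zw: "\<forall>f\<in>carr dual. f w = 0" using w by simp_all
      have "f (act L a b w) = 0" if "f \<in> carr dual" for f
        using that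
      proof (induction rule: D.homog_induct)
        case (homog s f)
        have "act dual a b f w = 0"
          by (rule bspec[OF Zw D.act_in_carr[OF ab D.homog_in_carr[OF homog]]])
        then show ?case
          using act_dual_homog[OF homog wc ab] by simp
      next
        case (add f g)
        then show ?case by simp
      qed
      then show ?thesis using act_in_carr[OF ab wc] by blast
    qed
  qed auto
  then have "?Z = {0} \<or> ?Z = carr L" using simple unfolding simple_mod_def by blast
  moreover have "?Z \<noteq> carr L"
  proof
    assume Z: "?Z = carr L"
    have "f = 0" if f: "f \<in> carr dual" for f
    proof
      fix v
      show "f v = 0 v"
        using Z f functional_lin(5)[OF carr_dual_functional[OF f]] by (cases "v \<in> carr L") auto
    qed
    then show False using assms(1) D.carr_closed(1) by blast
  qed
  ultimately show ?thesis using assms(2,3) by blast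
qed

text \<open>Evaluation at \<open>v\<close> is called represented by \<open>\<phi>\<close> (\<open>rep v \<phi>\<close>) if it equals \<open>g \<phi>\<close> on the graded
  dual.  The represented vectors form a nonzero submodule, so all vectors are represented.\<close>

lemma unitary_if_dual_unitary:
  assumes du: "dual_unitary p (p+q) (p+q+n) dual"
    and f0: "f0 \<in> carr dual" "f0 \<noteq> 0" "generates (gl) dual f0"
      "\<And>a. (a,a) \<in> gl \<Longrightarrow> act dual a a f0 = scl dual (\<mu> a) f0"
      "\<And>a b. (a,b) \<in> gl \<Longrightarrow> a > b \<Longrightarrow> act dual a b f0 = 0"
  shows "unitary p (p+q+n) L"
proof -
  let ?gl = "gl" and ?m = "p + q" and ?\<sigma> = "dual_star_sign p (p+q)"
  obtain g where hg: "hermitian_smod ?m ?gl dual g"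
    and g_even: "\<And>s u v. u \<in> homog dual s \<Longrightarrow> v \<in> homog dual (s+1) \<Longrightarrow> g u v = 0"
    and g_inv: "\<And>a b v w. (a,b) \<in> ?gl \<Longrightarrow> v \<in> carr dual \<Longrightarrow> w \<in> carr dual \<Longrightarrow>
      g (act dual a b v) w = ?\<sigma> a b * g v (act dual b a w)"
    using D.even_invariant_form[OF du[unfolded dual_unitary_def] refl] by blast
  interpret G: hermitian_smod ?m ?gl dual g by (rule hg)
  have sym: "(b,a) \<in> ?gl" if "(a,b) \<in> ?gl" for a b using that by (rule gl_sym)
  have g_adj: "g v (act dual a b w) = ?\<sigma> a b * g (act dual b a v) w"
    if "(a,b) \<in> ?gl" "v \<in> carr dual" "w \<in> carr dual" for a b v w
    using g_inv[OF sym[OF that(1)] that(2,3)] dual_star_sign_square[of p ?m a b]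
    by (simp add: dual_star_sign_sym[of p ?m b a])
  \<comment> \<open>The dual is spanned by \<open>f0\<close> and the images of raising operators.  On the latter both sides vanish: \<open>v0\<close> is killed
    by raising operators, and \<open>f0\<close> by their adjoints.\<close>
  have f0_gen: "f v0 * g f0 f0 = f0 v0 * g f0 f" if f: "f \<in> carr dual" for f
  proof -
    interpret R: graded_generation ?m ?gl dual "\<lambda>a. - int a" "D.span {f0}"
    proof unfold_locales
      show "D.span {f0} \<subseteq> carr dual" using f0(1) by (intro D.span_minimal D.subspace_carr) simp
      show "act dual a b y \<in> D.span {f0}"
        if ab: "(a,b) \<in> ?gl" "- int a = - int b" and y: "y \<in> D.span {f0}" for a b y
      proof -
        obtain k where "y = scl dual k f0" using y unfolding D.span_singleton by blast
        then show ?thesis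
          using ab f0(4)[of a] D.act_scale[OF ab(1) f0(1), of k]
          by (simp add: D.span_scale D.span_base)
      qed
      show "act dual a b y = 0"
        if ab: "(a,b) \<in> ?gl" "- int a < - int b" and y: "y \<in> D.span {f0}" for a b y
      proof -
        obtain k where "y = scl dual k f0" using y unfolding D.span_singleton by blast
        then show ?thesis
          using ab f0(5)[of a b] D.act_scale[OF ab(1) f0(1), of k] by simp
      qed
    qed (auto simp: gl_idx_def)
    let ?W = "{f \<in> carr dual. f v0 * g f0 f0 = f0 v0 * g f0 f}"
    have W: "D.subspace ?W"
    proof (rule D.subspaceI)
      show "0 \<in> ?W" using D.carr_closed(1) G.form_zero_right[OF f0(1)] by simp
      show "x + y \<in> ?W" if "x \<in> ?W" "y \<in> ?W" for x y
        using that f0(1) by (simp add: D.carr_closed G.form_add_right distrib_left distrib_right)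
      show "scl dual c x \<in> ?W" if "x \<in> ?W" for c x
        using that f0(1) by (simp add: D.carr_closed G.form_scale_right scl_dual mult.left_commute)
    qed
    have f0W: "f0 \<in> ?W" using f0(1) by simp
    have "{act_word dual xs y |xs y. xs \<in> lists (positive_letters ?gl (\<lambda>a. - int a)) \<and> y \<in> D.span {f0}} \<subseteq> ?W"
    proof
      fix z assume "z \<in> {act_word dual xs y |xs y. xs \<in> lists (positive_letters ?gl (\<lambda>a. - int a)) \<and> y \<in> D.span {f0}}"
      then obtain xs y where xs: "xs \<in> lists (positive_letters ?gl (\<lambda>a. - int a))"
        and y: "y \<in> D.span {f0}" and z: "z = act_word dual xs y" by blast
      have yc: "y \<in> carr dual" using y R.Y_in_carr by blast
      show "z \<in> ?W"
      proof (cases xs)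
        case Nil
        have "D.span {f0} \<subseteq> ?W" using f0W W by (intro D.span_minimal) auto
        then show ?thesis using Nil y z by auto
      next
        case (Cons l ys)
        obtain a b where l: "l = (a,b)" by (cases l)
        have ab: "(a,b) \<in> ?gl" "a < b" using xs by (auto simp: Cons l positive_letters_def)
        have "ys \<in> lists ?gl" using xs R.lists_F_subset Cons by auto
        then have w: "act_word dual ys y \<in> carr dual" using D.act_word_in_carr yc by blast
        have ab': "a \<in> {1..p+q+n}" "b \<in> {1..p+q+n}" using ab(1) unfolding gl_iff by blast+
        have "z v0 = 0"
          using act_dual_vanishes[OF w v0_in_carr v0_raising[OF ab' ab(2)]] by (simp add: z Cons l)
        moreover have "g f0 z = 0"
          using g_adj[OF ab(1) f0(1) w] f0(5)[OF sym[OF ab(1)] ab(2)] G.form_zero_left[OF w]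
          by (simp add: z Cons l)
        moreover have "z \<in> carr dual"
          using D.act_in_carr[OF ab(1) w] by (simp add: z Cons l)
        ultimately show ?thesis by simp
      qed
    qed
    then have "D.span {act_word dual xs y |xs y. xs \<in> lists (positive_letters ?gl (\<lambda>a. - int a)) \<and> y \<in> D.span {f0}} \<subseteq> ?W"
      using W by (rule D.span_minimal)
    moreover have "carr dual \<subseteq> D.span {act_word dual xs y |xs y. xs \<in> lists ?gl \<and> y \<in> D.span {f0}}"
      unfolding f0(3)[unfolded generates_def, symmetric]
      by (rule D.span_mono) (use D.span_base[of f0 "{f0}"] in blast)
    ultimately show ?thesis using f unfolding R.span_words_eq by blast
  qed
  define rep where "rep v \<phi> \<longleftrightarrow> \<phi> \<in> carr dual \<and> (\<forall>f\<in>carr dual. f v = g \<phi> f)" for v \<phi>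
  have rep_unique: "\<phi> = \<psi>" if "rep v \<phi>" "rep v \<psi>" for v \<phi> \<psi>
    using that G.form_nondegenerate[of \<phi> \<psi>] unfolding rep_def by metis
  have rep_zero: "rep 0 0"
    unfolding rep_def using D.carr_closed(1) by (simp add: G.form_zero_left functional_lin(4)[OF carr_dual_functional])
  have rep_add: "rep (v + w) (\<phi> + \<psi>)" if "rep v \<phi>" "rep w \<psi>" "v \<in> carr L" "w \<in> carr L" for v w \<phi> \<psi>
    using that unfolding rep_def
    by (simp add: D.carr_closed G.form_add_left functional_lin(1)[OF carr_dual_functional])
  have rep_scale: "rep (scl L c v) (scl dual (cnj c) \<phi>)" if "rep v \<phi>" "v \<in> carr L" for c v \<phi>
    using that unfolding rep_def
    by (simp add: D.carr_closed G.form_scale_left functional_lin(2)[OF carr_dual_functional])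
  have rep_parity: "rep (parity_comp L s v) (parity_comp dual s \<phi>)" if r: "rep v \<phi>" "v \<in> carr L" for s v \<phi>
    unfolding rep_def
  proof (intro conjI ballI)
    have \<phi>: "\<phi> \<in> carr dual" using r by (simp add: rep_def)
    then show "parity_comp dual s \<phi> \<in> carr dual" by (rule D.parity_comp_in_carr)
    fix f assume f: "f \<in> carr dual"
    have pf: "parity_comp dual s f \<in> carr dual" using f by (rule D.parity_comp_in_carr)
    have "f (parity_comp L s v) = parity_comp dual s f v"
      using parity_comp_dual[OF f r(2)] by simp
    also have "\<dots> = g \<phi> (parity_comp dual s f)"
      using r pf by (simp add: rep_def)
    also have "\<dots> = g (parity_comp dual s \<phi>) (parity_comp dual s f)"
    proof -
      have "g (parity_comp dual s f) (\<phi> - parity_comp dual s \<phi>) = 0"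
        using g_even D.parity_decomposition[OF \<phi>] D.parity_decomposition[OF f] by blast
      then have "g (\<phi> - parity_comp dual s \<phi>) (parity_comp dual s f) = 0"
        using G.form_cnj[OF pf D.carr_closed(3)[OF \<phi> D.parity_comp_in_carr[OF \<phi>]]] by (metis complex_cnj_zero)
      then show ?thesis using \<phi> pf by (simp add: G.form_diff_left D.parity_comp_in_carr)
    qed
    also have "\<dots> = g (parity_comp dual s \<phi>) f"
    proof -
      have "g (parity_comp dual s \<phi>) (f - parity_comp dual s f) = 0"
        using g_even D.parity_decomposition[OF \<phi>] D.parity_decomposition[OF f] by blast
      then show ?thesis using \<phi> f pf by (simp add: G.form_diff_right D.parity_comp_in_carr)
    qed
    finally show "f (parity_comp L s v) = g (parity_comp dual s \<phi>) f" .
  qed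
  have rep_homog: "\<phi> \<in> homog dual t" if "rep v \<phi>" "v \<in> homog L t" for v \<phi> t
  proof -
    have "parity_comp dual t \<phi> = \<phi>"
      using rep_unique[OF rep_parity[OF that(1) homog_in_carr[OF that(2)], of t]] that by simp
    then show ?thesis using D.parity_decomposition(1)[of \<phi> t] that(1) by (simp add: rep_def)
  qed
  \<comment> \<open>Only functionals \<open>f\<close> of parity \<open>epar a b + t\<close> matter, as both sides vanish on the others; for these the sign is given by
    \<open>koszul_dual_star_sign\<close>.\<close>
  have rep_act: "rep (act L a b v) (scl dual (- (koszul (epar ?m a b) t * star_sign p a b)) (act dual b a \<phi>))"
    if r: "rep v \<phi>" and v: "v \<in> homog L t" and ab: "(a,b) \<in> ?gl" for a b v \<phi> t
    unfolding rep_def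
  proof (intro conjI ballI)
    let ?P = "epar ?m a b"
    have \<phi>: "\<phi> \<in> homog dual t" by (rule rep_homog[OF r v])
    have \<phi>c: "\<phi> \<in> carr dual" using \<phi> D.homog_in_carr by blast
    have vc: "v \<in> carr L" using v homog_in_carr by blast
    have E\<phi>: "act dual b a \<phi> \<in> homog dual (?P + t)"
      using D.act_homog[OF sym[OF ab] \<phi>] by (simp add: add.commute)
    have E\<phi>c: "act dual b a \<phi> \<in> carr dual" using E\<phi> D.homog_in_carr by blast
    let ?c = "- (koszul ?P t * star_sign p a b)"
    show "scl dual ?c (act dual b a \<phi>) \<in> carr dual" using E\<phi>c D.carr_closed by blast
    fix f assume "f \<in> carr dual"
    then show "f (act L a b v) = g (scl dual ?c (act dual b a \<phi>)) f"
    proof (induction rule: D.homog_induct)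
      case (homog s f)
      have fc: "f \<in> carr dual" using homog D.homog_in_carr by blast
      have rhs: "g (scl dual ?c (act dual b a \<phi>)) f = ?c * g (act dual b a \<phi>) f"
        using G.form_scale_left[OF fc E\<phi>c, of ?c] by simp
      show ?case
      proof (cases "s = ?P + t")
        case True
        have "act dual a b f v = - (koszul ?P s * f (act L a b v))"
          by (rule act_dual_homog[OF homog vc ab])
        then have "f (act L a b v) = - koszul ?P s * act dual a b f v" by simp
        also have "act dual a b f v = g \<phi> (act dual a b f)"
          using r D.act_in_carr[OF ab fc] by (simp add: rep_def)
        also have "\<dots> = ?\<sigma> a b * g (act dual b a \<phi>) f"
          by (rule g_adj[OF ab \<phi>c fc])
        finally show ?thesis
          unfolding rhs True using koszul_dual_star_sign[of ?m a b t p] by simp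
      next
        case False
        then have s: "?P + t = s + 1" "s = ?P + t + 1"
          by (cases s; cases "?P + t"; simp)+
        have "f (act L a b v) = 0"
          using homog act_homog[OF ab v] unfolding s(1) homog_dual by blast
        moreover have "g (act dual b a \<phi>) f = 0"
          using g_even[OF E\<phi>] homog unfolding s(2)[symmetric] by blast
        ultimately show ?thesis unfolding rhs by simp
      qed
    next
      case (add f f')
      show ?case
        unfolding G.form_add_right[OF D.carr_closed(5)[OF E\<phi>c] add(1,2)]
        using add(3,4) by (simp only: plus_fun_apply)
    qed
  qed
  let ?U = "{v \<in> carr L. \<exists>\<phi>. rep v \<phi>}"
  have "submod ?gl L ?U"
  proof (rule submodI)
    show "subspace ?U"
    proof (rule subspaceI)
      show "0 \<in> ?U" using rep_zero carr_closed(1) by blast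
      show "x + y \<in> ?U" if "x \<in> ?U" "y \<in> ?U" for x y
        using that rep_add carr_closed(2) by blast
      show "scl L c x \<in> ?U" if "x \<in> ?U" for c x
        using that rep_scale carr_closed(5) by blast
    qed
    show "parity_comp L 0 w \<in> ?U" if "w \<in> ?U" for w
      using that rep_parity parity_comp_in_carr by blast
    show "act L a b w \<in> ?U" if ab: "(a,b) \<in> ?gl" and w: "w \<in> ?U" for a b w
    proof -
      obtain \<phi> where \<phi>: "rep w \<phi>" and wc: "w \<in> carr L" using w by blast
      have "\<exists>\<psi>. rep (act L a b (parity_comp L s w)) \<psi>" for s
        using rep_act[OF rep_parity[OF \<phi> wc] parity_decomposition(1)[OF wc] ab] by blast
      then obtain \<psi>0 \<psi>1 where "rep (act L a b (parity_comp L 0 w)) \<psi>0" "rep (act L a b (parity_comp L 1 w)) \<psi>1"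
        by metis
      then have "rep (act L a b (parity_comp L 0 w) + act L a b (parity_comp L 1 w)) (\<psi>0 + \<psi>1)"
        by (rule rep_add) (simp_all add: act_in_carr[OF ab] parity_comp_in_carr[OF wc])
      moreover have "act L a b (parity_comp L 0 w) + act L a b (parity_comp L 1 w) = act L a b w"
        using act_add[OF ab parity_comp_in_carr[OF wc, of 0] parity_comp_in_carr[OF wc, of 1]]
          parity_comp_sum[OF wc] by simp
      ultimately show ?thesis using act_in_carr[OF ab wc] by auto
    qed
  qed auto
  moreover have "v0 \<in> ?U"
  proof -
    have pos: "g f0 f0 \<noteq> 0" using G.form_definite f0(1,2) by blast
    let ?\<phi> = "scl dual (cnj (f0 v0 / g f0 f0)) f0"
    have "rep v0 ?\<phi>"
      unfolding rep_def
      using f0_gen pos f0(1) by (simp add: D.carr_closed G.form_scale_left field_simps)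
    then show ?thesis using v0_in_carr by blast
  qed
  ultimately have U: "?U = carr L"
    using simple v0_nonzero unfolding simple_mod_def by blast
  then obtain \<phi> where \<phi>: "\<And>v. v \<in> carr L \<Longrightarrow> rep v (\<phi> v)"
    using bchoice[of "carr L" rep] by blast
  have \<phi>c: "\<phi> v \<in> carr dual" if "v \<in> carr L" for v using \<phi>[OF that] by (simp add: rep_def)
  have \<phi>g: "f v = g (\<phi> v) f" if "v \<in> carr L" "f \<in> carr dual" for v f using \<phi>[OF that(1)] that(2) by (simp add: rep_def)
  define h where "h v w = \<phi> v w" for v w
  have "positive_hermitian_form L h"
    unfolding positive_hermitian_form_def
  proof (intro conjI ballI impI)
    fix v assume v: "v \<in> carr L"
    show "linear_on_carr L (*) (h v)"
      unfolding h_def using carr_dual_functional[OF \<phi>c[OF v]] by (simp add: finite_functional_def)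
    show "h w v = cnj (h v w)" if w: "w \<in> carr L" for w
      unfolding h_def \<phi>g[OF v \<phi>c[OF w]] \<phi>g[OF w \<phi>c[OF v]]
      using G.form_cnj[OF \<phi>c[OF w] \<phi>c[OF v]] by simp
    assume "v \<noteq> 0"
    have "\<phi> v \<noteq> 0"
    proof
      assume "\<phi> v = 0"
      then have "f v = 0" if "f \<in> carr dual" for f
        using \<phi>g[OF v that] G.form_zero_left[OF that] by simp
      moreover have "carr dual \<noteq> {0}" using f0(1,2) by blast
      ultimately show False
        using dual_separates_points[OF _ v] \<open>v \<noteq> 0\<close> by blast
    qed
    then show "Re (h v v) > 0"
      unfolding h_def using \<phi>g[OF v \<phi>c[OF v]] G.form_pos[OF \<phi>c[OF v]] by simp
  qed
  moreover have "h (act L a b v) w = h v (scl L (star_sign p a b) (act L b a w))"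
    if ab: "a \<in> {1..p+q+n}" "b \<in> {1..p+q+n}" and v: "v \<in> carr L" and w: "w \<in> carr L" for a b v w
    using v
  proof (induction rule: homog_induct)
    case (homog t v)
    have ab: "(a,b) \<in> ?gl" using ab by (simp add: gl_iff)
    have ba: "(b,a) \<in> ?gl" by (rule sym[OF ab])
    let ?P = "epar ?m a b"
    have vc: "v \<in> carr L" using homog homog_in_carr by blast
    have Ew: "act L b a w \<in> carr L" using act_in_carr[OF ba w] .
    have \<phi>v: "\<phi> v \<in> homog dual t" by (rule rep_homog[OF \<phi>[OF vc] homog])
    have "\<phi> (act L a b v) = scl dual (- (koszul ?P t * star_sign p a b)) (act dual b a (\<phi> v))"
      using rep_unique[OF \<phi>[OF act_in_carr[OF ab vc]] rep_act[OF \<phi>[OF vc] homog ab]] .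
    then have "h (act L a b v) w = - (koszul ?P t * star_sign p a b) * act dual b a (\<phi> v) w"
      unfolding h_def by (simp add: scl_dual)
    also have "act dual b a (\<phi> v) w = - (koszul ?P t * \<phi> v (act L b a w))"
      using act_dual_homog[OF \<phi>v w ba] by (simp add: add.commute[of "par ?m b"])
    finally have "h (act L a b v) w = star_sign p a b * \<phi> v (act L b a w)"
      by (simp add: mult.assoc mult.left_commute)
    then show ?case
      unfolding h_def using functional_lin(2)[OF carr_dual_functional[OF \<phi>c[OF vc]] Ew] by simp
  next
    case (add u v)
    have ab: "(a,b) \<in> ?gl" using ab by (simp add: gl_iff)
    have "\<phi> (x + y) = \<phi> x + \<phi> y" if "x \<in> carr L" "y \<in> carr L" for x y
      using rep_unique[OF \<phi>[OF carr_closed(2)[OF that]] rep_add[OF \<phi>[OF that(1)] \<phi>[OF that(2)] that]] .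
    then show ?case
      using add act_add[OF ab add(1,2)] act_in_carr[OF ab] by (simp add: h_def)
  qed
  ultimately show ?thesis
    unfolding unitary_def unitary_wrt_def by blast
qed

end

section \<open>From the module to its graded dual\<close>

locale unitary_parabolic_quotient = simple_parabolic_quotient p q n \<Lambda> L B v0
  for p q n :: nat and \<Lambda> :: "nat \<Rightarrow> complex" and L :: "'w::ab_group_add supermod"
    and B :: "'w set" and v0 :: 'w +
  fixes h :: "'w \<Rightarrow> 'w \<Rightarrow> complex"
  assumes hermitian: "positive_hermitian_form L h"
    and h_even: "\<And>s u v. u \<in> homog L s \<Longrightarrow> v \<in> homog L (s+1) \<Longrightarrow> h u v = 0"
    and h_inv: "\<And>a b v w. (a,b) \<in> gl \<Longrightarrow> v \<in> carr L \<Longrightarrow> w \<in> carr L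
        \<Longrightarrow> h (act L a b v) w = star_sign p a b * h v (act L b a w)"
    and \<Lambda>_real: "\<And>a. a \<in> {1..p+q+n} \<Longrightarrow> \<Lambda> a \<in> \<real>"
begin

sublocale hermitian_smod "p+q" "gl" L h
  using hermitian by unfold_locales

subsection \<open>Finite-dimensionality of the graded components\<close>

definition k_even :: "(nat \<times> nat) set" where
  "k_even = {(a,b) \<in> levi. epar (p+q) a b = 0}"

lemma k_even_in_k: "k_even \<subseteq> levi"
  by (auto simp: k_even_def)

lemma k_even_iff: "(a,b) \<in> k_even \<longleftrightarrow> (a,b) \<in> levi \<and> (a \<le> p+q \<longleftrightarrow> b \<le> p+q)"
  by (auto simp: k_even_def par_def)

lemma k_trans: "(a,b) \<in> levi \<Longrightarrow> (b,c) \<in> levi \<Longrightarrow> (a,c) \<in> levi"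
  by (auto simp: k_idx_def)

lemma v0_raising': "(a,b) \<in> gl \<Longrightarrow> a < b \<Longrightarrow> act L a b v0 = 0"
  using v0_raising by (simp add: gl_iff)

lemma v0_weight': "(a,a) \<in> gl \<Longrightarrow> act L a a v0 = scl L (\<Lambda> a) v0"
  using v0_weight by (simp add: gl_iff)

text \<open>The even part of \<open>\<kk>\<close> normalises the span of the odd raising operators of \<open>\<kk>\<close>.\<close>

lemma odd_raising_kills_even_words:
  assumes "xs \<in> lists k_even"
  shows "(a,b) \<in> levi \<Longrightarrow> a \<le> p+q \<Longrightarrow> p+q < b \<Longrightarrow> act L a b (act_word L xs v0) = 0"
  using assms
proof (induction arbitrary: a b rule: lists.induct)
  case Nil
  then show ?case using v0_raising'[of a b] k_in_gl by auto
next
  case (Cons x xs)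
  obtain c d where x: "x = (c,d)" by (cases x)
  have cd: "(c,d) \<in> k_even" using Cons.hyps x by simp
  then have cdk: "(c,d) \<in> levi" and cdm: "c \<le> p+q \<longleftrightarrow> d \<le> p+q"
    unfolding k_even_iff by simp_all
  have gl: "(a,b) \<in> gl" "(c,d) \<in> gl" using Cons.prems(1) cdk k_in_gl by blast+
  have "lists k_even \<subseteq> lists (gl)"
    using k_even_in_k k_in_gl by (intro lists_mono) blast
  then have w: "act_word L xs v0 \<in> carr L"
    using act_word_in_carr Cons.hyps(2) v0_in_carr by blast
  have 1: "act L a b (act_word L xs v0) = 0" using Cons.IH Cons.prems by blast
  have 2: "act L a d (act_word L xs v0) = 0" if "b = c"
    using Cons.IH[of a d] Cons.prems cdm k_trans[OF Cons.prems(1)] cdk that by simp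
  have 3: "act L c b (act_word L xs v0) = 0" if "d = a"
    using Cons.IH[of c b] Cons.prems cdm k_trans[OF cdk] that by simp
  show ?case
    using act_commute[OF gl w] 1 2 3 act_zero[OF gl(2)] by (auto simp: x)
qed

text \<open>\<open>B\<close> is obtained by applying odd lowering operators to the module that the even part of \<open>\<kk>\<close> generates
  from \<open>v0\<close>.\<close>

lemma B_finitely_spanned: "\<exists>G. finite G \<and> B = span G"
proof -
  let ?k = "levi"
  have sub: "k_even \<subseteq> gl" using k_even_in_k k_in_gl by blast
  have fin: "finite ?k" using finite_subset[OF k_in_gl finite_gl] .
  interpret E: smod "p+q" k_even L by (rule restrict[OF sub])
  interpret EH: hermitian_smod "p+q" k_even L h using hermitian by unfold_locales
  interpret K: smod "p+q" ?k L by (rule restrict[OF k_in_gl])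
  let ?W = "span {act_word L xs v0 |xs. xs \<in> lists k_even}"
  have "\<exists>G. finite G \<and> G \<subseteq> carr L \<and> ?W = span G"
  proof (rule EH.finite_even_generation)
    show "finite k_even" using finite_subset[OF k_even_in_k fin] .
    show "(b,a) \<in> k_even" if "(a,b) \<in> k_even" for a b
      using that unfolding k_even_iff by (auto simp: k_idx_def)
    show "(a,c) \<in> k_even" if "(a,b) \<in> k_even" "(b,c) \<in> k_even" for a b c
      using that k_trans unfolding k_even_iff by blast
    show "epar (p+q) a b = 0" if "(a,b) \<in> k_even" for a b
      using that by (simp add: k_even_def)
    show "h (act L a b v) w = h v (act L b a w)" if "(a,b) \<in> k_even" "v \<in> carr L" "w \<in> carr L" for a b v w
    proof -
      have "star_sign p a b = 1"
        using that(1) by (auto simp: k_even_iff k_idx_def star_sign_def)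
      then show ?thesis using h_inv[of a b v w] that sub by auto
    qed
    show "v0 \<in> carr L" by (rule v0_in_carr)
    show "act L a a v0 = scl L (\<Lambda> a) v0" if "(a,a) \<in> k_even" for a
      using v0_weight' that sub by blast
    show "act L a b v0 = 0" if "(a,b) \<in> k_even" "a < b" for a b
      using v0_raising' that sub by blast
  qed
  then obtain G where G: "finite G" "G \<subseteq> carr L" "?W = span G" by blast
  have words_carr: "{act_word L xs v0 |xs. xs \<in> lists k_even} \<subseteq> carr L"
    using E.act_word_in_carr v0_in_carr by blast
  interpret O: graded_generation "p+q" ?k L "\<lambda>a. if a \<le> p+q then 0 else 1" ?W
  proof unfold_locales
    show "?W \<subseteq> carr L" using words_carr subspace_carr by (rule span_minimal)
    show "act L a b y \<in> ?W" if ab: "(a,b) \<in> ?k" "(if a \<le> p+q then 0 else 1) = (if b \<le> p+q then 0 else (1::int))"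
      and y: "y \<in> ?W" for a b y
    proof (rule K.act_on_span[OF y ab(1) words_carr])
      fix z assume "z \<in> {act_word L xs v0 |xs. xs \<in> lists k_even}"
      then obtain xs where xs: "xs \<in> lists k_even" "z = act_word L xs v0" by blast
      have "(a,b) \<in> k_even" using ab unfolding k_even_iff by (auto split: if_splits)
      then have "(a,b) # xs \<in> lists k_even" using xs(1) by simp
      then have "act_word L ((a,b) # xs) v0 \<in> ?W" by (intro span_base) blast
      then show "act L a b z \<in> ?W" by (simp add: xs(2))
    qed simp
    show "act L a b y = 0" if ab: "(a,b) \<in> ?k" "(if a \<le> p+q then 0 else 1) < (if b \<le> p+q then 0 else (1::int))"
      and y: "y \<in> ?W" for a b y
    proof -
      have "a \<le> p+q" "p+q < b" using ab(2) by (auto split: if_splits)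
      then have "act L a b z \<in> {0}" if "z \<in> {act_word L xs v0 |xs. xs \<in> lists k_even}" for z
        using odd_raising_kills_even_words[OF _ ab(1)] that by auto
      then have "act L a b y \<in> {0}"
        by (intro K.act_on_span[OF y ab(1) words_carr]) simp_all
      then show ?thesis by simp
    qed
  qed (use k_trans in \<open>simp_all\<close>)
  have "\<exists>G'. finite G' \<and> G' \<subseteq> carr L \<and> span {act_word L xs y |xs y. xs \<in> lists ?k \<and> y \<in> ?W} = span G'"
    by (rule O.finite_odd_generation[OF refl fin G(1,3)])
  then obtain G' where G': "finite G'" "span {act_word L xs y |xs y. xs \<in> lists ?k \<and> y \<in> ?W} = span G'"
    by blast
  have "span {act_word L xs y |xs y. xs \<in> lists ?k \<and> y \<in> ?W} = B"
  proof (rule antisym)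
    have WB: "?W \<subseteq> B"
      unfolding B_generated using lists_mono[OF k_even_in_k] by (intro span_mono) blast
    have "act_word L xs y \<in> B" if "xs \<in> lists ?k" "y \<in> B" for xs y
      using that
    proof (induction rule: lists.induct)
      case (Cons x xs)
      then show ?case by (cases x) (simp add: k_act_B)
    qed simp
    then show "span {act_word L xs y |xs y. xs \<in> lists ?k \<and> y \<in> ?W} \<subseteq> B"
      using WB subspace_B by (intro span_minimal) blast+
    have "act_word L [] v0 \<in> ?W" by (rule span_base) blast
    then have "v0 \<in> ?W" by simp
    then show "B \<subseteq> span {act_word L xs y |xs y. xs \<in> lists ?k \<and> y \<in> ?W}"
      unfolding B_generated by (intro span_mono) blast
  qed
  then show ?thesis using G' by blast
qed

lemma bounded_degree_finitely_spanned:
  "\<exists>G. finite G \<and> span (\<Union>k<K. piece (int k)) = span G"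
proof -
  obtain G where G: "finite G" "B = span G" using B_finitely_spanned by blast
  have GB: "G \<subseteq> B" using G(2) span_superset by blast
  have finF: "finite F" using finite_subset[OF F_subset finite_gl] .
  have deg: "word_degree (block_degree p) xs = int (length xs)" if "xs \<in> lists F" for xs
    using that word_degree_kminus positive_letters_kminus by simp
  define G' where "G' = (\<lambda>(xs,y). act_word L xs y) ` ({xs. set xs \<subseteq> F \<and> length xs \<le> K \<and> length xs < K} \<times> G)"
  have "finite {xs. set xs \<subseteq> F \<and> length xs \<le> K \<and> length xs < K}"
    by (rule finite_subset[OF _ finite_lists_length_le[OF finF, of K]]) blast
  then have "finite G'" unfolding G'_def using G(1) by simp
  moreover have "G' \<subseteq> (\<Union>k<K. piece (int k))"
  proof
    fix z assume "z \<in> G'"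
    then obtain xs y where xs: "xs \<in> lists F" "length xs < K" "y \<in> B" "z = act_word L xs y"
      unfolding G'_def using GB by auto
    then have "z \<in> piece (int (length xs))" using word_in_piece deg by blast
    then show "z \<in> (\<Union>k<K. piece (int k))" using xs(2) by blast
  qed
  moreover have "piece (int k) \<subseteq> span G'" if k: "k < K" for k
    unfolding piece_def
  proof (intro span_minimal subspace_span subsetI)
    fix z assume "z \<in> piece_gens (int k)"
    then obtain xs y where xs: "xs \<in> lists F" "word_degree (block_degree p) xs = int k" "y \<in> span G" "z = act_word L xs y"
      using G(2) unfolding piece_gens_def by blast
    have len: "length xs = k" using deg[OF xs(1)] xs(2) by simp
    have xsgl: "xs \<in> lists (gl)" using xs(1) lists_F_subset by blast
    show "z \<in> span G'"
      unfolding xs(4)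
    proof (rule act_word_on_span[OF xs(3) xsgl _ subspace_span])
      show "G \<subseteq> carr L" using GB B_in_carr by blast
      fix y assume "y \<in> G"
      then have "act_word L xs y \<in> G'"
        unfolding G'_def using xs(1) len k by (intro image_eqI[of _ _ "(xs,y)"]) auto
      then show "act_word L xs y \<in> span G'" by (rule span_base)
    qed
  qed
  then have "(\<Union>k<K. piece (int k)) \<subseteq> span G'" by blast
  ultimately have "span (\<Union>k<K. piece (int k)) = span G'"
    unfolding span_eq using span_superset[of "\<Union>k<K. piece (int k)"] by blast
  then show ?thesis using \<open>finite G'\<close> by blast
qed

subsection \<open>Orthogonality of the graded components\<close>

text \<open>The eigenvalue on \<open>B\<close> of \<open>\<Sum>E\<^sub>a\<^sub>a\<close> over the indices a > p, which is central in \<open>\<kk>\<close>.\<close>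

definition top_degree :: complex where
  "top_degree = (\<Sum>a | (a,a) \<in> gl. of_int (block_degree p a) * \<Lambda> a)"

lemma top_degree_real: "cnj top_degree = top_degree"
proof -
  have "top_degree \<in> \<real>"
    unfolding top_degree_def using \<Lambda>_real by (intro sum_in_Reals Reals_mult) (auto simp: gl_iff)
  then show ?thesis by (simp add: Reals_cnj_iff)
qed

lemma euler_B: "y \<in> B \<Longrightarrow> euler (block_degree p) y = scl L top_degree y"
proof -
  have "act_word L xs v0 \<in> {v \<in> carr L. euler (block_degree p) v = scl L top_degree v}"
    if "xs \<in> lists (levi)" for xs
    using that
  proof (induction rule: lists.induct)
    case Nil
    have "euler (block_degree p) v0 = (\<Sum>a | (a,a) \<in> gl. scl L (of_int (block_degree p a) * \<Lambda> a) v0)"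
      unfolding euler_def using v0_weight' by (intro sum.cong) auto
    then show ?case using v0_in_carr by (simp add: top_degree_def scale_sum_left)
  next
    case (Cons x xs)
    obtain a b where x: "x = (a,b)" by (cases x)
    have ab: "(a,b) \<in> gl" "block_degree p a = block_degree p b"
      using Cons.hyps(1) block_degree_k unfolding x by blast+
    have aabb: "(a,a) \<in> gl" "(b,b) \<in> gl" using ab(1) by (auto simp: gl_iff)
    show ?case
      using Cons.IH euler_act[OF finite_gl ab(1) aabb, of "act_word L xs v0"] ab(2)
      by (simp add: x act_in_carr[OF ab(1)] act_scale[OF ab(1)])
  qed
  then have "{act_word L xs v0 |xs. xs \<in> lists (levi)}
      \<subseteq> {v \<in> carr L. euler (block_degree p) v = scl L top_degree v}" by blast
  then have "B \<subseteq> {v \<in> carr L. euler (block_degree p) v = scl L top_degree v}"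
    unfolding B_generated using subspace_eigenspace[OF linear_euler] by (rule span_minimal)
  then show "y \<in> B \<Longrightarrow> euler (block_degree p) y = scl L top_degree y" by blast
qed

lemma euler_selfadjoint:
  assumes "u \<in> carr L" "w \<in> carr L"
  shows "h (euler g u) w = h u (euler g w)"
proof -
  have "cnj (h w (euler g u)) = (\<Sum>a | (a,a) \<in> gl. cnj (h w (scl L (of_int (g a)) (act L a a u))))"
    unfolding euler_def using assms
    by (subst form_sum_right) (simp_all add: act_in_carr carr_closed)
  also have "\<dots> = (\<Sum>a | (a,a) \<in> gl. h u (scl L (of_int (g a)) (act L a a w)))"
  proof (intro sum.cong refl)
    fix a assume "a \<in> {a. (a,a) \<in> gl}"
    then have a: "(a,a) \<in> gl" by simp
    have "star_sign p a a = 1" by (auto simp: star_sign_def)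
    then show "cnj (h w (scl L (of_int (g a)) (act L a a u))) = h u (scl L (of_int (g a)) (act L a a w))"
      using h_inv[OF a assms] form_cnj[OF assms(2) act_in_carr[OF a assms(1)]]
        form_scale_right[OF assms(2) act_in_carr[OF a assms(1)]]
        form_scale_right[OF assms(1) act_in_carr[OF a assms(2)]] by simp
  qed
  also have "\<dots> = h u (euler g w)"
    unfolding euler_def using assms
    by (subst form_sum_right) (simp_all add: act_in_carr carr_closed)
  finally show ?thesis using form_cnj assms euler_in_carr by simp
qed

text \<open>Different degrees belong to different real eigenvalues of a self-adjoint operator.\<close>

lemma pieces_orthogonal:
  assumes "u \<in> piece j" "w \<in> piece k" "j \<noteq> k"
  shows "h u w = 0"
proof -
  have u: "u \<in> carr L" and w: "w \<in> carr L" using assms piece_in_carr by blast+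
  have ev: "euler (block_degree p) v = scl L (top_degree + of_int i) v" if "v \<in> piece i" for v i
    by (rule euler_piece[OF finite_gl gl_sym euler_B that])
  have "(top_degree + of_int j) * h u w = (top_degree + of_int k) * h u w"
    using euler_selfadjoint[OF u w, of "block_degree p"] u w
    by (simp add: ev[OF assms(1)] ev[OF assms(2)] form_scale_left form_scale_right top_degree_real)
  then show ?thesis using assms(3) by simp
qed

subsection \<open>The Riesz isomorphism\<close>

definition riesz :: "'w \<Rightarrow> 'w \<Rightarrow> complex" where
  "riesz v = (\<lambda>w. if w \<in> carr L then h v w else 0)"

lemma riesz_add: "u \<in> carr L \<Longrightarrow> v \<in> carr L \<Longrightarrow> riesz (u + v) = riesz u + riesz v"
  by (rule ext) (simp add: riesz_def form_add_left)

lemma riesz_scale: "v \<in> carr L \<Longrightarrow> riesz (scl L c v) = scl dual (cnj c) (riesz v)"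
  by (rule ext) (simp add: riesz_def scl_dual form_scale_left)

lemma riesz_zero: "riesz 0 = 0"
  by (rule ext) (simp add: riesz_def form_zero_left)

lemma riesz_inj: "u \<in> carr L \<Longrightarrow> v \<in> carr L \<Longrightarrow> riesz u = riesz v \<Longrightarrow> u = v"
  by (rule form_nondegenerate) (auto simp: riesz_def fun_eq_iff split: if_splits)

lemma finite_functional_riesz:
  assumes v: "v \<in> carr L"
  shows "finite_functional (riesz v)"
proof -
  obtain K where K: "v \<in> span (\<Union>k<K. piece (int k))" using carr_bounded_degree[OF v] by blast
  have sub: "(\<Union>k<K. piece (int k)) \<subseteq> carr L" using piece_in_carr by blast
  have "riesz v w = 0" if k: "k \<ge> K" and w: "w \<in> piece (int k)" for k w
  proof -
    have wc: "w \<in> carr L" using w piece_in_carr by blast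
    have "h w v = 0"
      by (rule orthogonal_span[OF wc sub _ K]) (use pieces_orthogonal[OF w] k in auto)
    then show ?thesis using form_cnj[OF wc v] wc by (simp add: riesz_def)
  qed
  then have "\<exists>K. \<forall>k\<ge>K. \<forall>w\<in>piece (int k). riesz v w = 0" by blast
  then show ?thesis
    unfolding finite_functional_def linear_on_carr_def
    using v by (simp add: riesz_def carr_closed form_add_right form_scale_right)
qed

lemma riesz_homog: "v \<in> homog L s \<Longrightarrow> riesz v \<in> homog dual s"
  using finite_functional_riesz[OF homog_in_carr] h_even[of v s] by (simp add: homog_dual riesz_def)

lemma riesz_in_carr:
  assumes "v \<in> carr L"
  shows "riesz v \<in> carr dual"
  using assms
proof (induction rule: homog_induct)
  case (homog s v)
  then show ?case using riesz_homog D.homog_in_carr by blast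
next
  case (add v w)
  then show ?case using D.carr_closed(2) by (simp only: riesz_add)
qed

text \<open>A functional of the graded dual sees only finitely many components.  On their finite-dimensional sum
  it is represented by a vector of that sum, which is orthogonal to all other components.\<close>

lemma riesz_surj:
  assumes f: "finite_functional f"
  obtains v where "v \<in> carr L" "f = riesz v"
proof -
  obtain K where K: "\<And>k w. k \<ge> K \<Longrightarrow> w \<in> piece (int k) \<Longrightarrow> f w = 0"
    using f unfolding finite_functional_def by blast
  let ?D = "span (\<Union>k<K. piece (int k))"
  obtain G where G: "finite G" "?D = span G" using bounded_degree_finitely_spanned by blast
  have sub: "(\<Union>k<K. piece (int k)) \<subseteq> carr L" using piece_in_carr by blast
  have D: "?D \<subseteq> carr L" using sub subspace_carr by (rule span_minimal)
  have "G \<subseteq> carr L" using D G(2) span_superset[of G] by simp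
  moreover have lin: "linear_on_carr L (*) f" using f by (simp add: finite_functional_def)
  ultimately obtain v where v: "v \<in> span G" "\<forall>w\<in>span G. h v w = f w"
    using riesz_finite_span[OF G(1)] by blast
  have vc: "v \<in> carr L" using v(1) D G(2) by blast
  have agree: "f w = h v w" if w: "w \<in> piece (int k)" for w k
  proof (cases "k < K")
    case True
    then have "w \<in> ?D" using w by (intro span_base) blast
    then show ?thesis using v(2) G(2) by simp
  next
    case False
    have wc: "w \<in> carr L" using w piece_in_carr by blast
    have vD: "v \<in> ?D" using v(1) G(2) by simp
    have "h w v = 0"
      by (rule orthogonal_span[OF wc sub _ vD]) (use pieces_orthogonal[OF w] False in auto)
    then have "h v w = 0" using form_cnj[OF wc vc] by simp
    then show ?thesis using K[OF _ w] False by simp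
  qed
  have "f w = h v w" if "w \<in> carr L" for w
  proof -
    have "w \<in> span (\<Union>k. piece (int k))" using that carr_span_pieces by simp
    then have "w \<in> carr L \<and> f w = h v w"
    proof (induction rule: span_induct_alt)
      case base
      show ?case using functional_lin(4)[OF f] form_zero_right[OF vc] carr_closed(1) by simp
    next
      case (step c x y)
      then obtain k where x: "x \<in> piece (int k)" by blast
      then have "x \<in> carr L" using piece_in_carr by blast
      then show ?case
        using step.IH agree[OF x] vc
        by (simp add: carr_closed functional_lin(1,2)[OF f] form_add_right form_scale_right)
    qed
    then show ?thesis ..
  qed
  then have "f = riesz v"
    using functional_lin(5)[OF f] by (intro ext) (simp add: riesz_def)
  then show thesis using that vc by blast
qed

lemma act_dual_riesz:
  assumes v: "v \<in> homog L t" and ab: "(a,b) \<in> gl"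
  shows "act dual a b (riesz v)
    = scl dual (- (koszul (epar (p+q) a b) t * star_sign p a b)) (riesz (act L b a v))"
proof
  fix w
  show "act dual a b (riesz v) w
    = scl dual (- (koszul (epar (p+q) a b) t * star_sign p a b)) (riesz (act L b a v)) w"
  proof (cases "w \<in> carr L")
    case False
    then show ?thesis by (simp add: act_dual_outside scl_dual riesz_def)
  next
    case True
    have vc: "v \<in> carr L" using v homog_in_carr by blast
    have "act dual a b (riesz v) w = - (koszul (epar (p+q) a b) t * h v (act L a b w))"
      using act_dual_homog[OF riesz_homog[OF v] True ab] act_in_carr[OF ab True] by (simp add: riesz_def)
    also have "h v (act L a b w) = star_sign p a b * h (act L b a v) w"
      using h_inv[OF gl_sym[OF ab] vc True] star_sign_square[of p a b]
      by (simp add: star_sign_sym[of p b a])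
    finally show ?thesis using True by (simp add: scl_dual riesz_def)
  qed
qed

lemma riesz_parity_comp:
  assumes "v \<in> carr L"
  shows "parity_comp dual s (riesz v) = riesz (parity_comp L s v)"
proof (rule D.parity_comp_unique)
  show "riesz (parity_comp L s v) \<in> homog dual s"
    using riesz_homog parity_decomposition(1)[OF assms] by blast
  have "riesz v - riesz (parity_comp L s v) = riesz (v - parity_comp L s v)"
    using assms parity_comp_in_carr[OF assms] by (intro ext) (simp add: riesz_def form_diff_left)
  then show "riesz v - riesz (parity_comp L s v) \<in> homog dual (s+1)"
    using riesz_homog parity_decomposition(2)[OF assms] by simp
qed

text \<open>The inverse image of a submodule under the Riesz map is a submodule of \<open>L\<close>; the map is bijective.\<close>

lemma simple_dual: "simple_mod (p+q) (gl) dual"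
  unfolding simple_mod_def
proof (intro conjI allI impI)
  show "supermodule (p+q) (gl) dual" by (rule D.supermodule)
  have "riesz v0 \<noteq> 0"
    using riesz_inj[OF v0_in_carr carr_closed(1)] v0_nonzero riesz_zero by auto
  then show "carr dual \<noteq> {0}" using riesz_in_carr[OF v0_in_carr] by blast
  fix W assume W: "submod (gl) dual W"
  have sW: "D.subspace W" using W by (simp add: submod_def)
  have W_carr: "W \<subseteq> carr dual"
    using W unfolding submod_def carr_def by blast
  let ?U = "{v \<in> carr L. riesz v \<in> W}"
  have "submod (gl) L ?U"
  proof (rule submodI)
    show "subspace ?U"
    proof (rule subspaceI)
      show "0 \<in> ?U" using carr_closed(1) D.subspace_0[OF sW] by (simp add: riesz_zero)
      show "x + y \<in> ?U" if "x \<in> ?U" "y \<in> ?U" for x y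
        using that D.subspace_add[OF sW] by (simp add: carr_closed riesz_add)
      show "scl L c x \<in> ?U" if "x \<in> ?U" for c x
        using that D.subspace_scale[OF sW] by (simp add: carr_closed riesz_scale)
    qed
    have pc: "parity_comp L s w \<in> ?U" if "w \<in> ?U" for w s
    proof -
      have w: "w \<in> carr L" "riesz w \<in> W" using that by simp_all
      have "riesz (parity_comp L s w) \<in> W"
        using D.submod_parity_comp[OF W w(2), of s] riesz_parity_comp[OF w(1)] by simp
      then show ?thesis using parity_comp_in_carr[OF w(1)] by simp
    qed
    then show "parity_comp L 0 w \<in> ?U" if "w \<in> ?U" for w using that .
    show "act L a b w \<in> ?U" if ab: "(a,b) \<in> gl" and w: "w \<in> ?U" for a b w
    proof -
      have wc: "w \<in> carr L" using w by simp
      have *: "riesz (act L a b (parity_comp L s w)) \<in> W" for s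
      proof -
        let ?u = "parity_comp L s w"
        define c where "c = - (koszul (epar (p+q) b a) s * star_sign p b a)"
        have c: "c \<noteq> 0" by (simp add: c_def star_sign_def)
        have u: "?u \<in> homog L s" using parity_decomposition(1)[OF wc] .
        have "riesz ?u \<in> W" using pc[OF w, of s] by simp
        then have "act dual b a (riesz ?u) \<in> W" using W gl_sym[OF ab] unfolding submod_def by fast
        then have "scl dual c (riesz (act L a b ?u)) \<in> W"
          using act_dual_riesz[OF u gl_sym[OF ab]] by (simp add: c_def)
        then have "scl dual (1 / c) (scl dual c (riesz (act L a b ?u))) \<in> W"
          by (rule D.subspace_scale[OF sW])
        then show ?thesis using c by simp
      qed
      have "act L a b w = act L a b (parity_comp L 0 w) + act L a b (parity_comp L 1 w)"
        using act_add[OF ab parity_comp_in_carr[OF wc, of 0] parity_comp_in_carr[OF wc, of 1]]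
          parity_comp_sum[OF wc] by simp
      then have "riesz (act L a b w) = riesz (act L a b (parity_comp L 0 w)) + riesz (act L a b (parity_comp L 1 w))"
        using riesz_add[OF act_in_carr[OF ab] act_in_carr[OF ab]] parity_comp_in_carr[OF wc] by simp
      then show ?thesis
        using D.subspace_add[OF sW *[of 0] *[of 1]] act_in_carr[OF ab wc] by simp
    qed
  qed auto
  then consider "?U = {0}" | "?U = carr L" using simple unfolding simple_mod_def by blast
  then show "W = {0} \<or> W = carr dual"
  proof cases
    case 1
    have "f = 0" if f: "f \<in> W" for f
    proof -
      obtain v where v: "v \<in> carr L" "f = riesz v"
        using riesz_surj[OF carr_dual_functional] W_carr f by blast
      then have "v \<in> ?U" using f by simp
      then show ?thesis using 1 v riesz_zero by simp
    qed
    then show ?thesis using D.subspace_0[OF sW] by blast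
  next
    case 2
    have "f \<in> W" if f: "f \<in> carr dual" for f
    proof -
      obtain v where v: "v \<in> carr L" "f = riesz v"
        using riesz_surj[OF carr_dual_functional[OF f]] by blast
      then have "v \<in> ?U" using 2 by simp
      then show ?thesis using v by simp
    qed
    then show ?thesis using W_carr by blast
  qed
qed

lemma lowest_weight_dual:
  "simple_lowest_weight_mod (p+q) (gl) (\<lambda>a. - \<Lambda> a) dual"
  unfolding simple_lowest_weight_mod_def
proof (intro conjI exI)
  show "simple_mod (p+q) (gl) dual" by (rule simple_dual)
  have ne: "riesz v0 \<noteq> 0"
    using riesz_inj[OF v0_in_carr carr_closed(1)] v0_nonzero riesz_zero by auto
  have ev: "riesz v0 \<in> homog dual 0" by (rule riesz_homog[OF v0_even])
  have "act dual a a (riesz v0) = scl dual (- \<Lambda> a) (riesz v0)" if a: "(a,a) \<in> gl" for a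
  proof -
    have "cnj (\<Lambda> a) = \<Lambda> a" using \<Lambda>_real a by (simp add: gl_iff Reals_cnj_iff)
    moreover have "star_sign p a a = 1" by (auto simp: star_sign_def)
    ultimately show ?thesis
      using act_dual_riesz[OF v0_even a] v0_weight'[OF a] v0_in_carr
      by (simp add: riesz_scale)
  qed
  then show "even_weight_vector (gl) dual (\<lambda>a. - \<Lambda> a) (riesz v0)"
    using ne ev by (simp add: even_weight_vector_def)
  show "generates (gl) dual (riesz v0)"
    by (rule D.simple_mod_generated[OF simple_dual ev ne])
  have "act dual a b (riesz v0) = 0" if "(a,b) \<in> gl" "b < a" for a b
    using act_dual_riesz[OF v0_even that(1)] v0_raising'[OF gl_sym[OF that(1)] that(2)]
    by (simp add: riesz_zero)
  then show "\<forall>(a,b)\<in>gl. b < a \<longrightarrow> act dual a b (riesz v0) = 0" by blast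
qed

text \<open>The form is transported along the Riesz map \<open>v \<mapsto> h v\<close>.  Since this map is anti-linear, the two arguments are exchanged.\<close>

lemma dual_unitary_dual: "dual_unitary p (p+q) (p+q+n) dual"
proof -
  let ?\<sigma> = "dual_star_sign p (p+q)"
  define r where "r f = (SOME v. v \<in> carr L \<and> f = riesz v)" for f
  have r: "r f \<in> carr L \<and> f = riesz (r f)" if "f \<in> carr dual" for f
    unfolding r_def using riesz_surj[OF carr_dual_functional[OF that]] by (rule someI_ex) blast
  have r_riesz: "r (riesz v) = v" if "v \<in> carr L" for v
    using r[OF riesz_in_carr[OF that]] riesz_inj that by metis
  define g :: "('w \<Rightarrow> complex) \<Rightarrow> ('w \<Rightarrow> complex) \<Rightarrow> complex" where "g f f' = f' (r f)" for f f'
  have g_riesz: "g (riesz u) (riesz v) = h v u" if "u \<in> carr L" "v \<in> carr L" for u v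
    using that by (simp add: g_def r_riesz) (simp add: riesz_def)
  have form: "positive_hermitian_form dual g"
    unfolding positive_hermitian_form_def
  proof (intro conjI ballI impI)
    fix f assume f: "f \<in> carr dual"
    show "linear_on_carr dual (*) (g f)"
      by (simp add: linear_on_carr_def g_def scl_dual)
    show "g f' f = cnj (g f f')" if f': "f' \<in> carr dual" for f'
      using r[OF f] r[OF f'] g_riesz form_cnj by metis
    assume "f \<noteq> 0"
    then have "r f \<noteq> 0" using r[OF f] riesz_zero by metis
    then show "0 < Re (g f f)"
      using r[OF f] g_riesz form_pos by metis
  qed
  interpret G: hermitian_smod "p+q" "gl" dual g
    using form by unfold_locales
  have homog_riesz: "\<exists>v \<in> homog L s. f = riesz v" if "f \<in> homog dual s" for f s
  proof -
    have rf: "r f \<in> carr L" "f = riesz (r f)" using r[OF D.homog_in_carr[OF that]] by simp_all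
    have "f = parity_comp dual s f" using that by simp
    also have "\<dots> = riesz (parity_comp L s (r f))"
      using riesz_parity_comp[OF rf(1)] rf(2) by metis
    finally show ?thesis using parity_decomposition(1)[OF rf(1)] by blast
  qed
  have inv: "g (act dual a b f) f' = ?\<sigma> a b * g f (act dual b a f')"
    if ab: "(a,b) \<in> gl" and f: "f \<in> carr dual" and f': "f' \<in> carr dual" for a b f f'
    using f
  proof (induction rule: D.homog_induct)
    case (homog t f)
    have ba: "(b,a) \<in> gl" using gl_sym[OF ab] .
    let ?P = "epar (p+q) a b"
    obtain v where v: "v \<in> homog L t" "f = riesz v" using homog_riesz[OF homog] by blast
    have vc: "v \<in> carr L" using v homog_in_carr by blast
    have Ev: "act L b a v \<in> homog L (?P + t)" using act_homog[OF ba v(1)] by (simp add: add.commute)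
    have Evc: "act L b a v \<in> carr L" using act_in_carr[OF ba vc] .
    show ?case
      using f'
    proof (induction rule: D.homog_induct)
      case (homog s f')
      obtain w where w: "w \<in> homog L s" "f' = riesz w" using homog_riesz[OF homog] by blast
      have wc: "w \<in> carr L" using w homog_in_carr by blast
      have Ewc: "act L a b w \<in> carr L" using act_in_carr[OF ab wc] .
      \<comment> \<open>Both sides are multiples of \<open>h w (act L b a v)\<close>, which vanishes by parity unless
        \<open>s = epar a b + t\<close>.\<close>
      have lhs: "g (act dual a b f) f' = - (koszul ?P t * star_sign p a b) * h w (act L b a v)"
        unfolding v(2) w(2) act_dual_riesz[OF v(1) ab]
        by (subst G.form_scale_left) (simp_all add: riesz_in_carr Evc wc g_riesz)
      have rhs: "g f (act dual b a f') = - (koszul ?P s * star_sign p a b) * (star_sign p a b * h w (act L b a v))"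
        unfolding v(2) w(2) act_dual_riesz[OF w(1) ba]
        by (subst G.form_scale_right)
          (simp_all add: riesz_in_carr Ewc vc g_riesz h_inv[OF ab wc vc] star_sign_sym[of p b a] add.commute[of "par (p+q) b"])
      show ?case
      proof (cases "s = ?P + t")
        case True
        have "?\<sigma> a b * koszul ?P (?P + t) = koszul ?P t * star_sign p a b"
          using koszul_dual_star_sign[of "p+q" a b t p] by (simp add: mult.commute)
        moreover have "star_sign p a b * (star_sign p a b * z) = z" for z
          using star_sign_square[of p a b] by (metis mult.assoc mult_1)
        ultimately show ?thesis unfolding lhs rhs True by (simp add: mult.assoc[symmetric])
      next
        case False
        then have "?P + t = s + 1" by (cases s; cases "?P + t"; simp)
        then have "h w (act L b a v) = 0" using h_even[OF w(1)] Ev by simp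
        then show ?thesis unfolding lhs rhs by simp
      qed
    next
      case (add x y)
      have fc: "f \<in> carr dual" using homog D.homog_in_carr by blast
      show ?case
        unfolding G.form_add_right[OF D.act_in_carr[OF ab fc] add(1,2)] act_dual_add
          G.form_add_right[OF fc D.act_in_carr[OF ba add(1)] D.act_in_carr[OF ba add(2)]] add(3,4)
        by (simp only: distrib_left)
    qed
  next
    case (add x y)
    have ba: "(b,a) \<in> gl" using gl_sym[OF ab] .
    show ?case
      unfolding act_dual_add G.form_add_left[OF f' D.act_in_carr[OF ab add(1)] D.act_in_carr[OF ab add(2)]]
        G.form_add_left[OF D.act_in_carr[OF ba f'] add(1,2)] add(3,4)
      by (simp only: distrib_left)
  qed
  have "g (act dual a b f) f' = g f (scl dual (?\<sigma> a b) (act dual b a f'))"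
    if "a \<in> {1..p+q+n}" "b \<in> {1..p+q+n}" "f \<in> carr dual" "f' \<in> carr dual" for a b f f'
  proof -
    have ab: "(a,b) \<in> gl" using that by (simp add: gl_iff)
    show ?thesis
      unfolding inv[OF ab that(3,4)]
      by (rule G.form_scale_right[symmetric, OF that(3) D.act_in_carr[OF gl_sym[OF ab] that(4)]])
  qed
  then show ?thesis
    unfolding dual_unitary_def unitary_wrt_def using form by blast
qed

end

section \<open>Unitarity and dual unitarity\<close>

text \<open>A lowest weight vector is pulled back along the isomorphism; the defining equations follow from
  injectivity.\<close>

lemma lowest_weight_vector_transport:
  assumes M: "smod m S M" and M': "simple_lowest_weight_mod m S \<mu> M'" and iso: "isomorphic_mod S M M'"
  obtains x where "x \<in> carr M" "x \<noteq> 0" "generates S M x"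
    "\<And>a. (a,a) \<in> S \<Longrightarrow> act M a a x = scl M (\<mu> a) x"
    "\<And>a b. (a,b) \<in> S \<Longrightarrow> a > b \<Longrightarrow> act M a b x = 0"
proof -
  interpret M: smod m S M by (rule M)
  interpret M': smod m S M'
    using M' by unfold_locales (simp add: simple_lowest_weight_mod_def simple_mod_def)
  obtain y where y: "y \<in> homog M' 0" "y \<noteq> 0" "\<And>a. (a,a) \<in> S \<Longrightarrow> act M' a a y = scl M' (\<mu> a) y"
      "generates S M' y" "\<And>a b. (a,b) \<in> S \<Longrightarrow> a > b \<Longrightarrow> act M' a b y = 0"
    using M' unfolding simple_lowest_weight_mod_def even_weight_vector_def by blast
  obtain f where f: "even_hom S M M' f" and bij: "bij_betw f (carr M) (carr M')"
    using iso unfolding isomorphic_mod_def by blast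
  have lin: "linear_on_carr M (scl M') f" using f by (simp add: even_hom_def)
  have f_act: "f (act M a b v) = act M' a b (f v)" if "(a,b) \<in> S" "v \<in> carr M" for a b v
    using f that unfolding even_hom_def by blast
  have inj: "u = v" if "u \<in> carr M" "v \<in> carr M" "f u = f v" for u v
    using bij that unfolding bij_betw_def inj_on_def by blast
  have f0: "f 0 = 0" by (rule M.linear_map_zero[OF M'.vector_space_axioms lin])
  have "y \<in> f ` carr M" using bij M'.homog_in_carr[OF y(1)] unfolding bij_betw_def by simp
  then obtain x where x: "x \<in> carr M" "f x = y" by blast
  have f_scale: "f (scl M c v) = scl M' c (f v)" if "v \<in> carr M" for c v
    using lin that unfolding linear_on_carr_def by blast
  have f_add: "f (u + v) = f u + f v" if "u \<in> carr M" "v \<in> carr M" for u v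
    using lin that unfolding linear_on_carr_def by blast
  let ?W = "M.span {act_word M xs x |xs. xs \<in> lists S}"
  have gens: "{act_word M xs x |xs. xs \<in> lists S} \<subseteq> carr M"
    using M.act_word_in_carr x(1) by blast
  then have W: "?W \<subseteq> carr M" using M.subspace_carr by (rule M.span_minimal)
  have "carr M' \<subseteq> f ` ?W"
    unfolding y(4)[unfolded generates_def, symmetric]
  proof (rule M'.span_minimal)
    show "{act_word M' xs y |xs. xs \<in> lists S} \<subseteq> f ` ?W"
    proof
      fix z assume "z \<in> {act_word M' xs y |xs. xs \<in> lists S}"
      then obtain xs where xs: "xs \<in> lists S" "z = act_word M' xs y" by blast
      have "z = f (act_word M xs x)"
        using M.hom_act_word[OF f_act x(1) xs(1)] xs(2) x(2) by simp
      moreover have "act_word M xs x \<in> ?W" using xs(1) by (intro M.span_base) blast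
      ultimately show "z \<in> f ` ?W" by blast
    qed
    show "M'.subspace (f ` ?W)"
    proof (rule M'.subspaceI)
      show "0 \<in> f ` ?W" by (rule image_eqI[of _ _ 0]) (simp_all only: f0 M.span_zero)
      show "u + v \<in> f ` ?W" if uv: "u \<in> f ` ?W" "v \<in> f ` ?W" for u v
      proof -
        obtain u' v' where "u' \<in> ?W" "v' \<in> ?W" "u = f u'" "v = f v'" using uv by blast
        then have "u + v = f (u' + v')" "u' + v' \<in> ?W"
          using f_add subsetD[OF W] M.span_add by simp_all
        then show ?thesis by blast
      qed
      show "scl M' c u \<in> f ` ?W" if u: "u \<in> f ` ?W" for c u
      proof -
        obtain u' where "u' \<in> ?W" "u = f u'" using u by blast
        then have "scl M' c u = f (scl M c u')" "scl M c u' \<in> ?W"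
          using f_scale subsetD[OF W] M.span_scale by simp_all
        then show ?thesis by blast
      qed
    qed
  qed
  have "carr M \<subseteq> ?W"
  proof
    fix u assume u: "u \<in> carr M"
    then have "f u \<in> carr M'" using bij unfolding bij_betw_def by blast
    then obtain w where "w \<in> ?W" "f u = f w" using \<open>carr M' \<subseteq> f ` ?W\<close> by blast
    then show "u \<in> ?W" using inj[OF u] W by blast
  qed
  then have "generates S M x" unfolding generates_def using W by blast
  moreover have "x \<noteq> 0" using f0 x(2) y(2) by blast
  moreover have "act M a a x = scl M (\<mu> a) x" if "(a,a) \<in> S" for a
    by (rule inj) (simp_all add: M.act_in_carr[OF that x(1)] M.carr_closed x f_act[OF that x(1)] y(3)[OF that] f_scale)
  moreover have "act M a b x = 0" if "(a,b) \<in> S" "a > b" for a b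
    by (rule inj) (simp_all add: M.act_in_carr[OF that(1) x(1)] M.carr_closed x f_act[OF that(1) x(1)] y(5)[OF that] f0)
  ultimately show thesis using that x(1) by blast
qed

theorem (in simple_parabolic_quotient) unitary_iff_dual_unitary:
  assumes \<Lambda>_real: "\<And>a. a \<in> {1..p+q+n} \<Longrightarrow> \<Lambda> a \<in> \<real>"
    and Lminus: "simple_lowest_weight_mod (p+q) (gl_idx (p+q+n)) (\<lambda>a. - \<Lambda> a) Lminus"
  shows "unitary p (p+q+n) L \<longleftrightarrow>
    dual_unitary p (p+q) (p+q+n) dual \<and> isomorphic_mod (gl_idx (p+q+n)) dual Lminus"
proof (intro iffI)
  assume "unitary p (p+q+n) L"
  then obtain h where "hermitian_smod (p+q) (gl_idx (p+q+n)) L h"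
    and h: "\<And>s u v. u \<in> homog L s \<Longrightarrow> v \<in> homog L (s+1) \<Longrightarrow> h u v = 0"
      "\<And>a b v w. (a,b) \<in> gl_idx (p+q+n) \<Longrightarrow> v \<in> carr L \<Longrightarrow> w \<in> carr L
        \<Longrightarrow> h (act L a b v) w = star_sign p a b * h v (act L b a w)"
    using even_invariant_form[OF _ refl, of "star_sign p"] unfolding unitary_def by blast
  interpret H: hermitian_smod "p+q" "gl_idx (p+q+n)" L h by fact
  interpret U: unitary_parabolic_quotient p q n \<Lambda> L B v0 h
    by unfold_locales (fact H.form h \<Lambda>_real)+
  show "dual_unitary p (p+q) (p+q+n) dual \<and> isomorphic_mod (gl_idx (p+q+n)) dual Lminus"
    using U.dual_unitary_dual simple_lowest_weight_mods_isomorphic[OF U.lowest_weight_dual Lminus] ..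
next
  assume *: "dual_unitary p (p+q) (p+q+n) dual \<and> isomorphic_mod (gl_idx (p+q+n)) dual Lminus"
  then obtain f0 where f0: "f0 \<in> carr dual" "f0 \<noteq> 0" "generates (gl_idx (p+q+n)) dual f0"
      "\<And>a. (a,a) \<in> gl_idx (p+q+n) \<Longrightarrow> act dual a a f0 = scl dual (- \<Lambda> a) f0"
      "\<And>a b. (a,b) \<in> gl_idx (p+q+n) \<Longrightarrow> a > b \<Longrightarrow> act dual a b f0 = 0"
    using lowest_weight_vector_transport[OF smod_dual Lminus] by blast
  show "unitary p (p+q+n) L"
    by (rule unitary_if_dual_unitary[OF _ f0]) (use * in simp_all)
qed

theorem proposition10p3:
  fixes p q n :: nat
    and \<Lambda> :: "nat \<Rightarrow> complex"
    and L0 :: "'u::ab_group_add supermod"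
    and V :: "'v::ab_group_add supermod"
    and \<iota> :: "'u \<Rightarrow> 'v"
    and L :: "'w::ab_group_add supermod"
    and \<pi> :: "'v \<Rightarrow> 'w"
    and Lminus :: "'x::ab_group_add supermod"
  assumes "p > 0" and "q > 0" and "n > 0"
    and "\<Lambda> \<in> Dplus p q n"
    and "is_simple_quotient_of_induced p q n \<Lambda> L0 V \<iota> L \<pi>"
    and "simple_lowest_weight_mod (p+q) (gl_idx (p+q+n)) (\<lambda>a. - \<Lambda> a) Lminus"
  shows "unitary p (p+q+n) L \<longleftrightarrow>
     (let Ldual = graded_dual p (p+q) (p+q+n) L (\<pi> ` \<iota> ` carr L0)
      in dual_unitary p (p+q) (p+q+n) Ldual \<and>
         isomorphic_mod (gl_idx (p+q+n)) Ldual Lminus)"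
proof -
  obtain v0 where "simple_parabolic_quotient p q n \<Lambda> L (\<pi> ` \<iota> ` carr L0) v0"
    using simple_parabolic_quotientI[OF assms(5)] by blast
  then interpret simple_parabolic_quotient p q n \<Lambda> L "\<pi> ` \<iota> ` carr L0" v0 .
  have "\<Lambda> a \<in> \<real>" if "a \<in> {1..p+q+n}" for a
    using assms(4) that by (simp add: Dplus_def)
  then show ?thesis
    unfolding Let_def dual_def[symmetric] using assms(6) by (rule unitary_iff_dual_unitary)
qed

end
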